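(* Let $\{i_n\}_{n\in\mathbb N}$ be the zeros of the Airy function $\mathrm{Ai}(z)$ (all real and negative), and let $$\zeta_{\mathrm{Ai}}(s)=\sum_{n=1}^\infty(-i_n)^{-s},\qquad \Re(s)>3/2 .$$ Then the analytic continuation of $\zeta_{\mathrm{Ai}}$ is regular at every integer $n\le1$, and its values there are $$\zeta_{\mathrm{Ai}}(1)=-3^{1/3}\,\frac{\Gamma(2/3)}{\Gamma(1/3)},\qquad \zeta_{\mathrm{Ai}}(0)=-\frac14,$$ $$\zeta_{\mathrm{Ai}}(-3j)=-3j\,p_{2j},\qquad j\in\mathbb N,$$ $$\zeta_{\mathrm{Ai}}(-n)=0\qquad\text{for all } n\in\mathbb N \text{ that are not multiples of } 3,$$ where the numbers $p_j$ are defined by the formal power series identity $$\sum_{j=1}^\infty p_jy^j=\ln\left(1+\sum_{k=1}^\infty\left(\frac{-3i}{2}\right)^k\frac{\Gamma(k+\frac16)\Gamma(k+\frac56)}{2\pi(-2)^kk!}\,y^k\right).$$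
   Context: $\mathbb N=\{1,2,\dots\}$; the powers $(-i_n)^{-s}$ of the positive numbers $-i_n$ are the usual real-exponential ones (principal branch). In the expression for $p_j$, $i$ without subscript is the imaginary unit (e.g. $p_1=5i/48$, $p_2=-5/64$). *)

theory Defs
  imports "HOL-Complex_Analysis.Complex_Analysis"
begin

text \<open>
  The Airy function is the entire solution of \<open>w'' = z w\<close> with the standard initial values
  \<open>Ai(0) = 3\<^sup>-\<^sup>2\<^sup>/\<^sup>3 / \<Gamma>(2/3)\<close> and \<open>Ai'(0) = -3\<^sup>-\<^sup>1\<^sup>/\<^sup>3 / \<Gamma>(1/3)\<close>. It is defined by its Maclaurin series,
  whose coefficients are determined by the recurrence equivalent to the differential equation.
\<close>

fun Airy_coeff :: "nat \<Rightarrow> real" where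
  "Airy_coeff 0 = 3 powr (-2/3) / Gamma (2/3)"
| "Airy_coeff (Suc 0) = - (3 powr (-1/3) / Gamma (1/3))"
| "Airy_coeff (Suc (Suc 0)) = 0"
| "Airy_coeff (Suc (Suc (Suc n))) = Airy_coeff n / (real (n + 2) * real (n + 3))"

definition Airy_Ai :: "complex \<Rightarrow> complex" where
  "Airy_Ai z = (\<Sum>n. of_real (Airy_coeff n) * z ^ n)"

lemma summable_Airy_Ai: "summable (\<lambda>n. of_real (Airy_coeff n) * (z :: complex) ^ n)"
proof -
  define R where "R = norm z + 1"
  have R: "R > 0" "norm z < R"
    by (auto simp: R_def add_nonneg_pos)
  obtain N :: nat where N: "R ^ 3 \<le> real N"
    using real_arch_simple by blast
  define b where "b = (\<lambda>n. norm (of_real (Airy_coeff n) :: complex) * R ^ n)"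
  have b_nonneg: "b n \<ge> 0" for n
    using R by (simp add: b_def)
  define M where "M = Max (b ` {..N + 3})"
  have step: "b (Suc (Suc (Suc n))) \<le> b n" if "n \<ge> N" for n
  proof -
    have "real N \<le> real (n + 2) * 1"
      using that by simp
    also have "\<dots> \<le> real (n + 2) * real (n + 3)"
      by (intro mult_left_mono) auto
    finally have le: "R ^ 3 \<le> real (n + 2) * real (n + 3)"
      using N by linarith
    have "b (Suc (Suc (Suc n))) = b n * (R ^ 3 / (real (n + 2) * real (n + 3)))"
      by (simp add: b_def abs_mult power3_eq_cube norm_divide)
    also have "\<dots> \<le> b n * 1"
      using le b_nonneg by (intro mult_left_mono) (auto simp: divide_le_eq)
    finally show ?thesis by simp
  qed
  have bound: "b n \<le> M" for n
  proof (induction n rule: less_induct)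
    case (less n)
    show ?case
    proof (cases "n \<le> N + 3")
      case True
      then show ?thesis by (auto simp: M_def intro!: Max_ge)
    next
      case False
      define m where "m = n - 3"
      have m: "n = Suc (Suc (Suc m))" "m \<ge> N" "m < n"
        using False by (auto simp: m_def)
      show ?thesis
        using step[OF m(2)] less[OF m(3)] unfolding m(1) by linarith
    qed
  qed
  have "summable (\<lambda>n. norm (of_real (Airy_coeff n) :: complex) * norm z ^ n)"
    by (rule Abel_lemma[of _ R _ M]) (use R bound in \<open>auto simp: b_def\<close>)
  then show ?thesis
    by (intro summable_norm_cancel[of "\<lambda>n. of_real (Airy_coeff n) * z ^ n"])
       (simp add: norm_mult norm_power)
qed

lemma has_field_derivative_Airy_Ai:
  "(Airy_Ai has_field_derivative (\<Sum>n. diffs (\<lambda>n. of_real (Airy_coeff n)) n * z ^ n)) (at z)"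
  unfolding Airy_Ai_def[abs_def]
  by (rule termdiffs_strong_converges_everywhere) (rule summable_Airy_Ai)

lemma deriv_Airy_Ai:
  "deriv Airy_Ai = (\<lambda>z. \<Sum>n. diffs (\<lambda>n. of_real (Airy_coeff n)) n * z ^ n)"
  using has_field_derivative_Airy_Ai by (blast intro: DERIV_imp_deriv)

lemma holomorphic_Airy_Ai: "Airy_Ai holomorphic_on UNIV"
  using has_field_derivative_Airy_Ai by (auto simp: holomorphic_on_open)

lemma Airy_Ai_0: "Airy_Ai 0 = of_real (3 powr (-2/3) / Gamma (2/3))"
  by (simp add: Airy_Ai_def powser_zero)

lemma deriv_Airy_Ai_0: "deriv Airy_Ai 0 = - of_real (3 powr (-1/3) / Gamma (1/3))"
  by (simp add: deriv_Airy_Ai powser_zero diffs_def)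

lemma Airy_ode: "(deriv ^^ 2) Airy_Ai z = z * Airy_Ai z"
proof -
  define a :: "nat \<Rightarrow> complex" where "a = (\<lambda>n. of_real (Airy_coeff n))"
  have sm: "summable (\<lambda>n. a n * w ^ n)" for w
    using summable_Airy_Ai by (simp add: a_def)
  have sm1: "summable (\<lambda>n. diffs a n * w ^ n)" for w
    by (rule termdiff_converges_all) (rule sm)
  have sm2: "summable (\<lambda>n. diffs (diffs a) n * w ^ n)" for w
    by (rule termdiff_converges_all) (rule sm1)
  have "(deriv ^^ 2) Airy_Ai z = deriv (\<lambda>w. \<Sum>n. diffs a n * w ^ n) z"
    by (simp add: numeral_2_eq_2 deriv_Airy_Ai a_def)
  also have "\<dots> = (\<Sum>n. diffs (diffs a) n * z ^ n)"
    by (rule DERIV_imp_deriv, rule termdiffs_strong_converges_everywhere, rule sm1)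
  also have "\<dots> = diffs (diffs a) 0 + (\<Sum>n. diffs (diffs a) (Suc n) * z ^ Suc n)"
    using suminf_split_head[OF sm2[of z]] by simp
  also have "diffs (diffs a) 0 = 0"
    by (simp add: diffs_def a_def)
  also have "(\<lambda>n. diffs (diffs a) (Suc n) * z ^ Suc n) = (\<lambda>n. z * (a n * z ^ n))"
  proof
    fix n
    have "diffs (diffs a) (Suc n) = a n"
    proof -
      have "(of_nat n + 2 :: complex) \<noteq> 0" "(of_nat n + 3 :: complex) \<noteq> 0"
        by (metis of_nat_add of_nat_numeral of_nat_eq_0_iff add_is_0 zero_neq_numeral)+
      then show ?thesis
        by (simp add: diffs_def a_def divide_simps add_ac)
    qed
    then show "diffs (diffs a) (Suc n) * z ^ Suc n = z * (a n * z ^ n)"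
      by simp
  qed
  also have "(\<Sum>n. z * (a n * z ^ n)) = z * Airy_Ai z"
    using suminf_mult[OF sm[of z], of z] by (simp add: Airy_Ai_def a_def)
  finally show ?thesis by simp
qed

text \<open>
  The sequence \<open>i\<close> is indexed by \<open>{1, 2, ...}\<close>; \<open>powr\<close> is the principal branch.
\<close>

definition Airy_zeta :: "(nat \<Rightarrow> complex) \<Rightarrow> complex \<Rightarrow> complex" where
  "Airy_zeta i s = (\<Sum>n. (- i (Suc n)) powr (- s))"

text \<open>
  \<open>fps_ln 1\<close> is the series of \<open>ln (1 + y)\<close>, so composing it with a series \<open>F\<close> without
  constant term gives \<open>ln (1 + F)\<close>.
\<close>

definition Airy_p_series :: "complex fps" where
  "Airy_p_series = Abs_fps (\<lambda>k. if k = 0 then 0 else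
     (- 3 * \<i> / 2) ^ k * (Gamma (of_nat k + 1/6) * Gamma (of_nat k + 5/6)
        / (2 * of_real pi * (- 2) ^ k * fact k)))"

definition Airy_p :: "nat \<Rightarrow> complex" where
  "Airy_p j = fps_nth (fps_ln 1 oo Airy_p_series) j"

lemma Gamma_1_6_5_6: "Gamma (1/6 :: complex) * Gamma (5/6) = 2 * of_real pi"
proof -
  have "Gamma (1/6 :: complex) * Gamma (1 - 1/6) = of_real pi / sin (of_real pi * (1/6))"
    by (rule Gamma_reflection_complex)
  also have "sin (of_real pi * (1/6) :: complex) = of_real (sin (pi / 6))"
    by (simp flip: sin_of_real)
  finally show ?thesis by (simp add: sin_30)
qed

lemma Airy_p_series_nth:
  "fps_nth Airy_p_series 0 = 0"
  "fps_nth Airy_p_series (Suc 0) = 5 * \<i> / 48"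
  "fps_nth Airy_p_series 2 = - 385 / 4608"
proof -
  have nonpos: "(1/6 :: complex) \<notin> \<int>\<^sub>\<le>\<^sub>0" "(5/6 :: complex) \<notin> \<int>\<^sub>\<le>\<^sub>0"
    "(7/6 :: complex) \<notin> \<int>\<^sub>\<le>\<^sub>0" "(11/6 :: complex) \<notin> \<int>\<^sub>\<le>\<^sub>0"
    by (auto elim!: nonpos_Ints_cases' simp: complex_eq_iff)
  have G: "Gamma (7/6 :: complex) = 1/6 * Gamma (1/6)"
    "Gamma (11/6 :: complex) = 5/6 * Gamma (5/6)"
    "Gamma (13/6 :: complex) = 7/6 * Gamma (7/6)"
    "Gamma (17/6 :: complex) = 11/6 * Gamma (11/6)"
    using nonpos[THEN Gamma_plus1] by simp_all
  have G1: "Gamma (7/6 :: complex) * Gamma (11/6) = 5/36 * (2 * of_real pi)"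
    unfolding G Gamma_1_6_5_6[symmetric] by simp
  have G2: "Gamma (13/6 :: complex) * Gamma (17/6) = 385/1296 * (2 * of_real pi)"
    unfolding G Gamma_1_6_5_6[symmetric] by simp
  show "fps_nth Airy_p_series 0 = 0"
    by (simp add: Airy_p_series_def)
  show "fps_nth Airy_p_series (Suc 0) = 5 * \<i> / 48"
    using arg_cong[OF G1, of "\<lambda>x. \<i> * x * 18"] by (simp add: Airy_p_series_def mult_ac)
  show "fps_nth Airy_p_series 2 = - 385 / 4608"
    using arg_cong[OF G2, of "\<lambda>x. x * 648"]
    by (simp add: Airy_p_series_def fact_numeral power2_eq_square mult_ac)
qed

lemma Airy_p_1: "Airy_p 1 = 5 * \<i> / 48"
  using Airy_p_series_nth by (simp add: Airy_p_def fps_compose_nth fps_ln_nth)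

lemma Airy_p_2: "Airy_p 2 = - 5 / 64"
proof -
  have "Airy_p 2 = fps_nth Airy_p_series 2 - (fps_nth Airy_p_series (Suc 0))\<^sup>2 / 2"
    using Airy_p_series_nth(1)
    by (simp add: Airy_p_def fps_compose_nth fps_ln_nth numeral_2_eq_2 fps_mult_nth)
  then show ?thesis
    by (simp add: Airy_p_series_nth power2_eq_square)
qed

end

theory Submission
  imports Defs "HOL-Real_Asymp.Real_Asymp"
begin

text \<open>
  Write \<open>\<lambda>\<^sub>n = - i\<^sub>n\<close> and \<open>u = - Ai' / Ai\<close>. The Airy equation becomes the Riccati equation \<open>u' = u\<^sup>2 - x\<close>,
  and everything is read off from \<open>u'\<close> on the positive axis.

  Since \<open>Ai\<close> has growth order \<open>3/2 < 2\<close> and simple, negative zeros, \<open>u'(x) = \<Sum> 1 / (x + \<lambda>\<^sub>n)\<^sup>2\<close>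
  (\<open>log_deriv_deriv_sum_zeros\<close>, \<open>neg_log_deriv2_sums\<close>). Integrating termwise gives, for
  \<open>3/2 < s < 2\<close>, \<open>\<integral>\<^sub>0\<^sup>\<infinity> x\<^sup>1\<^sup>-\<^sup>s u'(x) dx = \<Gamma>(s) \<Gamma>(2 - s) \<zeta>(s)\<close> (\<open>Mellin_transform_zeta\<close>). The left side
  continues to the left as far as the behaviour of \<open>u'\<close> at infinity is known: a term
  \<open>g x powr (1 - 3k/2)\<close> of its asymptotic expansion contributes \<open>g / (s - (3 - 3k/2))\<close>. Multiplication by
  \<open>1 / (\<Gamma>(s) \<Gamma>(2 - s))\<close>, which vanishes at the integers \<open>s \<le> 0\<close>, cancels the poles at those integers and
  turns their residues into the values of the zeta function; where there is no pole to cancel, i.e. at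
  negative integers not divisible by 3, the value is 0. At \<open>s = 1\<close> the value is the regularised integral
  of \<open>u'\<close>, which is \<open>- u(0)\<close> because \<open>u(x) - sqrt x\<close> tends to 0.

  The asymptotic expansion rests on two facts. A contour integral identifies the function defined by the
  power series as the solution that decays on the positive axis (\<open>Airy_Ai_decay\<close>). From this decay follow
  the position of the zeros, \<open>u > 0\<close>, and, together with \<open>0 \<le> u' \<le> u'(0)\<close>, the estimate \<open>u = sqrt x + O(1)\<close>.
  Secondly, the difference between \<open>u\<close> and a truncated formal solution satisfies a linear equation
  \<open>e' = a e + \<rho>\<close> with \<open>a \<ge> 1\<close>, for which a bounded solution is never larger than the residual \<open>\<rho>\<close>
  (\<open>unstable_ode_bound\<close>). So the formal solution of the Riccati equation is the asymptotic expansion.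
  That formal solution is \<open>sqrt x B(x powr (-3/2))\<close> with \<open>B = 1 + t/4 + 3/2 t\<^sup>2 S'/S\<close>, where \<open>S\<close> is the series
  with the Gamma coefficients (\<open>riccati_fps_equation\<close>). The series whose logarithm defines the numbers
  \<open>p\<^sub>j\<close> is \<open>S(- \<i> y)\<close>, which expresses the even \<open>p\<^sub>j\<close> by the coefficients of \<open>S'/S\<close>, hence by the residues
  (\<open>asymp_coeff_even\<close>).
\<close>

section \<open>An integral representation of the Airy function\<close>

text \<open>
  Used with three different pairs of parameters, this single substitution in Euler's integral yields the
  moments of the Airy integral, the factor 1 / (x + l)^2, and the Beta integral of the Mellin transform.
\<close>

lemma nn_integral_Gamma_scaled:
  fixes a b :: real
  assumes "a > 0" "b > 0"
  shows "(\<integral>\<^sup>+t. ennreal (indicator {0<..} t * (t powr (a - 1) * exp (- b * t))) \<partial>lborel)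
           = ennreal (Gamma a * b powr (- a))"
proof -
  let ?I = "\<integral>\<^sup>+t. ennreal (indicator {0<..} t * (t powr (a - 1) * exp (- b * t))) \<partial>lborel"
  have *: "indicator {0..} (b * t) * (b * t) powr (a - 1) / exp (b * t) =
        b powr (a - 1) * (indicator {0<..} t * (t powr (a - 1) * exp (- b * t)))" for t :: real
    using assms by (cases "t = 0")
      (auto simp: indicator_def powr_mult exp_minus field_simps zero_le_mult_iff)
  have "ennreal (Gamma a) = (\<integral>\<^sup>+t. ennreal (indicator {0..} t * t powr (a - 1) / exp t) \<partial>lborel)"
    using assms by (intro Gamma_conv_nn_integral_real) auto
  also have "\<dots> = ennreal \<bar>b\<bar> * (\<integral>\<^sup>+t. ennreal (indicator {0..} (0 + b * t) * (0 + b * t) powr (a - 1) / exp (0 + b * t)) \<partial>lborel)"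
    using assms by (intro nn_integral_real_affine) auto
  also have "(\<integral>\<^sup>+t. ennreal (indicator {0..} (0 + b * t) * (0 + b * t) powr (a - 1) / exp (0 + b * t)) \<partial>lborel)
     = (\<integral>\<^sup>+t. ennreal (b powr (a - 1)) * ennreal (indicator {0<..} t * (t powr (a - 1) * exp (- b * t))) \<partial>lborel)"
    by (simp only: add_0 *) (simp add: ennreal_mult)
  also have "\<dots> = ennreal (b powr (a - 1)) * ?I"
    by (intro nn_integral_cmult) auto
  finally have 1: "ennreal (Gamma a) = ennreal (b powr a) * ?I"
    using assms by (simp add: mult.assoc[symmetric] ennreal_mult[symmetric] powr_diff)
  have "ennreal (Gamma a * b powr (- a)) = ennreal (b powr (- a)) * ennreal (Gamma a)"
    using assms by (simp add: ennreal_mult[symmetric] mult.commute Gamma_real_nonneg)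
  also have "\<dots> = ?I"
    unfolding 1 using assms by (simp add: mult.assoc[symmetric] ennreal_mult[symmetric] powr_minus)
  finally show ?thesis by simp
qed

lemma has_bochner_integral_Gamma_scaled:
  fixes a b :: real
  assumes "a > 0" "b > 0"
  shows "has_bochner_integral lborel (\<lambda>t. indicator {0<..} t * (t powr (a - 1) * exp (- b * t)))
           (Gamma a * b powr (- a))"
  using nn_integral_Gamma_scaled[OF assms] assms
  by (intro has_bochner_integral_nn_integral) (auto simp: Gamma_real_nonneg)

text \<open>
  In the contour integral for \<open>Ai\<close> the path is the pair of rays \<open>t = r cis (\<plusminus>\<pi>/3)\<close>, on which
  \<open>exp (t^3/3)\<close> is \<open>exp (- r^3/3)\<close>. The substitution \<open>v = r^3/3\<close> turns this factor into \<open>exp (- v)\<close>,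
  so that all moments are values of the Gamma function; \<open>r\<close> is then \<open>cbrt3 v\<close> and \<open>dr\<close> is
  \<open>(3 v) powr (-2/3) dv\<close>.
\<close>

definition cbrt3 :: "real \<Rightarrow> real" where "cbrt3 v = (3 * v) powr (1/3)"
definition Airy_weight :: "real \<Rightarrow> real" where "Airy_weight v = indicator {0<..} v * (exp (- v) * (3 * v) powr (- 2/3))"

lemma cbrt3_measurable [measurable]: "cbrt3 \<in> borel_measurable borel" unfolding cbrt3_def by measurable
lemma Airy_weight_measurable [measurable]: "Airy_weight \<in> borel_measurable borel" unfolding Airy_weight_def by measurable
lemma Airy_weight_nonneg: "Airy_weight v \<ge> 0" by (auto simp: Airy_weight_def indicator_def)
lemma cbrt3_nonneg: "cbrt3 v \<ge> 0" by (auto simp: cbrt3_def)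

lemma Airy_weight_moment_powr:
  fixes a :: real
  assumes "a > -1"
  shows "has_bochner_integral lborel (\<lambda>v. Airy_weight v * cbrt3 v powr a) (3 powr ((a - 2) / 3) * Gamma ((a + 1) / 3))"
proof -
  have eq: "Airy_weight v * cbrt3 v powr a = 3 powr ((a - 2) / 3) * (indicator {0<..} v * (v powr ((a + 1)/3 - 1) * exp (- 1 * v)))" for v
  proof -
    have "(3 * v) powr (-2/3) * (3 * v) powr (a/3) = 3 powr ((a - 2)/3) * v powr ((a + 1)/3 - 1)" if "v > 0"
    proof -
      have "(3 * v) powr (-2/3) * (3 * v) powr (a/3) = (3 * v) powr ((a - 2)/3)"
        by (simp add: powr_add[symmetric] field_simps)
      also have "\<dots> = 3 powr ((a - 2)/3) * v powr ((a - 2)/3)"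
        using that by (simp add: powr_mult)
      also have "v powr ((a - 2)/3) = v powr ((a + 1)/3 - 1)"
        by (rule arg_cong[of _ _ "\<lambda>x. v powr x"]) (simp add: field_simps)
      finally show ?thesis .
    qed
    then show ?thesis by (auto simp: Airy_weight_def cbrt3_def indicator_def powr_powr)
  qed
  have "has_bochner_integral lborel (\<lambda>v. 3 powr ((a - 2) / 3) * (indicator {0<..} v * (v powr ((a + 1)/3 - 1) * exp (- 1 * v))))
      (3 powr ((a - 2) / 3) * (Gamma ((a + 1)/3) * 1 powr (- ((a + 1)/3))))"
    using assms by (intro has_bochner_integral_mult_right has_bochner_integral_Gamma_scaled) auto
  then show ?thesis unfolding eq by simp
qed

definition Airy_moment :: "nat \<Rightarrow> real" where "Airy_moment n = 3 powr ((real n - 2) / 3) * Gamma ((real n + 1) / 3)"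

lemma Airy_weight_moment: "has_bochner_integral lborel (\<lambda>v. Airy_weight v * cbrt3 v ^ n) (Airy_moment n)"
proof -
  have "Airy_weight v * cbrt3 v ^ n = Airy_weight v * cbrt3 v powr (real n)" for v
    by (cases "v > 0") (auto simp: Airy_weight_def cbrt3_def powr_realpow)
  then show ?thesis using Airy_weight_moment_powr[of "real n"] by (simp only: Airy_moment_def)
qed

text \<open>
  An integrable function that dominates the weight times \<open>exp (B r)\<close> up to a factor depending only on \<open>B\<close>.
  The size of this factor is what bounds the growth order of \<open>Ai\<close>.
\<close>

definition Airy_majorant :: "real \<Rightarrow> real" where
  "Airy_majorant v = 3 powr (-2/3) * (indicator {0<..} v * (v powr (1/3 - 1) * exp (- (1/2) * v)))"

lemma integrable_Airy_majorant: "integrable lborel Airy_majorant"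
  unfolding Airy_majorant_def using has_bochner_integral_Gamma_scaled[of "1/3" "1/2"]
  by (intro integrable_mult_right) (auto simp: has_bochner_integral_iff)

text \<open>
  With \<open>r\<close> the cube root, the exponent satisfies \<open>B r \<le> r^3/6\<close> as soon as \<open>r^2 \<ge> 6 \<bar>B\<bar>\<close>, and half of the
  decay of \<open>exp (- r^3/3)\<close> absorbs it; for smaller \<open>r\<close> it is at most \<open>\<bar>B\<bar> sqrt (6 \<bar>B\<bar>)\<close>.
\<close>

lemma Airy_weight_exp_le: "norm (Airy_weight v * exp (B * cbrt3 v)) \<le> exp (\<bar>B\<bar> * sqrt (6 * \<bar>B\<bar>)) * Airy_majorant v"
proof (cases "v > 0")
  case True
  define c where "c = \<bar>B\<bar> * sqrt (6 * \<bar>B\<bar>)"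
  have le: "B * cbrt3 v \<le> v / 2 + c"
  proof -
    have q3: "cbrt3 v ^ 3 = 3 * v"
      using True by (simp add: cbrt3_def powr_powr powr_realpow[symmetric])
    have q0: "cbrt3 v \<ge> 0" by (rule cbrt3_nonneg)
    show ?thesis
    proof (cases "(cbrt3 v)\<^sup>2 \<ge> 6 * \<bar>B\<bar>")
      case True
      have "6 * \<bar>B\<bar> * cbrt3 v \<le> (cbrt3 v)\<^sup>2 * cbrt3 v"
        using True q0 by (intro mult_right_mono) auto
      then have "\<bar>B\<bar> * cbrt3 v \<le> v / 2"
        using q3 by (simp add: power2_eq_square power3_eq_cube)
      moreover have "B * cbrt3 v \<le> \<bar>B\<bar> * cbrt3 v" using q0 by (intro mult_right_mono) auto
      moreover have "c \<ge> 0" by (auto simp: c_def)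
      ultimately show ?thesis by linarith
    next
      case False
      then have "cbrt3 v \<le> sqrt (6 * \<bar>B\<bar>)" by (simp add: real_le_rsqrt)
      then have "\<bar>B\<bar> * cbrt3 v \<le> c" unfolding c_def by (intro mult_left_mono) auto
      moreover have "B * cbrt3 v \<le> \<bar>B\<bar> * cbrt3 v" using q0 by (intro mult_right_mono) auto
      ultimately show ?thesis using True \<open>v > 0\<close> by linarith
    qed
  qed
  have "exp (-v) * exp (B * cbrt3 v) \<le> exp c * exp (- (1/2) * v)"
    using le by (simp add: exp_add[symmetric])
  then have "3 powr (-2/3) * v powr (-2/3) * (exp (-v) * exp (B * cbrt3 v)) \<le> 3 powr (-2/3) * v powr (-2/3) * (exp c * exp (- (1/2) * v))"
    by (intro mult_left_mono) auto
  then show ?thesis using True by (simp add: Airy_weight_def Airy_majorant_def powr_mult mult_ac abs_mult c_def)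
qed (auto simp: Airy_weight_def Airy_majorant_def)

lemma Airy_weight_exp_integrable: "integrable lborel (\<lambda>v. Airy_weight v * exp (B * cbrt3 v))"
proof (rule Bochner_Integration.integrable_bound)
  show "integrable lborel (\<lambda>v. exp (\<bar>B\<bar> * sqrt (6 * \<bar>B\<bar>)) * Airy_majorant v)"
    by (intro integrable_mult_right integrable_Airy_majorant)
  show "AE v in lborel. norm (Airy_weight v * exp (B * cbrt3 v)) \<le> norm (exp (\<bar>B\<bar> * sqrt (6 * \<bar>B\<bar>)) * Airy_majorant v)"
    using Airy_weight_exp_le by (intro AE_I2) (metis abs_ge_self order_trans real_norm_def)
qed auto

definition Airy_Laplace :: "complex \<Rightarrow> complex" where
  "Airy_Laplace w = (\<integral>v. of_real (Airy_weight v) * exp (- w * of_real (cbrt3 v)) \<partial>lborel)"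

lemma Airy_Laplace_sums: "(\<lambda>n. (- w) ^ n / fact n * of_real (Airy_moment n)) sums Airy_Laplace w"
proof -
  let ?S = "\<lambda>N v. \<Sum>n<N. (- w) ^ n / fact n * of_real (Airy_weight v * cbrt3 v ^ n)"
  have Seq: "?S N v = of_real (Airy_weight v) * (\<Sum>n<N. (- w * of_real (cbrt3 v)) ^ n /\<^sub>R fact n)" for N v
    unfolding power_mult_distrib[of "- w"]
    by (simp add: sum_distrib_left scaleR_conv_of_real divide_inverse mult_ac)
  have int_S: "has_bochner_integral lborel (?S N) (\<Sum>n<N. (- w) ^ n / fact n * of_real (Airy_moment n))" for N
    by (intro has_bochner_integral_sum has_bochner_integral_mult_right has_bochner_integral_of_real Airy_weight_moment)
  have "(\<lambda>N. integral\<^sup>L lborel (?S N)) \<longlonglongrightarrow> Airy_Laplace w"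
    unfolding Airy_Laplace_def
  proof (rule integral_dominated_convergence[where w = "\<lambda>v. Airy_weight v * exp (norm w * cbrt3 v)"])
    show "integrable lborel (\<lambda>v. Airy_weight v * exp (norm w * cbrt3 v))" by (rule Airy_weight_exp_integrable)
    show "AE v in lborel. (\<lambda>N. ?S N v) \<longlonglongrightarrow> of_real (Airy_weight v) * exp (- w * of_real (cbrt3 v))"
      unfolding Seq using exp_converges[of "- w * of_real (cbrt3 _)"]
      by (intro AE_I2 tendsto_mult tendsto_const) (simp add: sums_def)
    show "AE v in lborel. norm (?S N v) \<le> Airy_weight v * exp (norm w * cbrt3 v)" for N
    proof (rule AE_I2)
      fix v
      have "norm (\<Sum>n<N. (- w * of_real (cbrt3 v)) ^ n /\<^sub>R fact n) \<le> (\<Sum>n<N. (norm w * cbrt3 v) ^ n /\<^sub>R fact n)"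
        by (rule sum_norm_le) (simp add: norm_power norm_mult cbrt3_nonneg)
      also have "\<dots> \<le> exp (norm w * cbrt3 v)"
        unfolding exp_def by (rule sum_le_suminf[OF summable_exp_generic]) (auto simp: cbrt3_nonneg)
      finally have "Airy_weight v * norm (\<Sum>n<N. (- w * of_real (cbrt3 v)) ^ n /\<^sub>R fact n) \<le> Airy_weight v * exp (norm w * cbrt3 v)"
        by (intro mult_left_mono Airy_weight_nonneg)
      then show "norm (?S N v) \<le> Airy_weight v * exp (norm w * cbrt3 v)"
        unfolding Seq by (simp add: norm_mult Airy_weight_nonneg)
    qed
  qed auto
  also have "(\<lambda>N. integral\<^sup>L lborel (?S N)) = (\<lambda>N. (\<Sum>n<N. (- w) ^ n / fact n * of_real (Airy_moment n)))"
    using int_S by (auto simp: has_bochner_integral_iff)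
  finally show ?thesis by (simp add: sums_def)
qed

text \<open>
  Instead of the linear bound, \<open>exp (- x) \<le> x powr (-1/2)\<close> is used: the rate does not matter, and with
  this exponent the remaining moment still converges at the origin.
\<close>

lemma Airy_Laplace_decay:
  assumes "Re w > 0"
  shows "norm (Airy_Laplace w) \<le> 3 powr (-5/6) * Gamma (1/6) * Re w powr (-1/2)"
proof -
  have exp_le: "exp (- x) \<le> x powr (-1/2)" if "x > 0" for x :: real
  proof -
    have "x powr (1/2) \<le> exp x"
    proof (cases "x \<le> 1")
      case True
      then have "x powr (1/2) \<le> 1 powr (1/2)" using that by (intro powr_mono2) auto
      also have "\<dots> \<le> exp x" using that by simp
      finally show ?thesis .
    next
      case False
      then have "x powr (1/2) \<le> x powr 1" by (intro powr_mono) auto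
      also have "\<dots> \<le> exp x" using that exp_ge_add_one_self[of x] by (simp del: exp_ge_add_one_self)
      finally show ?thesis .
    qed
    then have "inverse (exp x) \<le> inverse (x powr (1/2))" using that by (intro le_imp_inverse_le) auto
    then show ?thesis by (simp add: exp_minus powr_minus)
  qed
  have h: "has_bochner_integral lborel (\<lambda>v. Re w powr (-1/2) * (Airy_weight v * cbrt3 v powr (-1/2)))
       (Re w powr (-1/2) * (3 powr ((-1/2 - 2) / 3) * Gamma ((-1/2 + 1) / 3)))"
    by (intro has_bochner_integral_mult_right Airy_weight_moment_powr) auto
  have "norm (Airy_Laplace w) \<le> (\<integral>v. norm (of_real (Airy_weight v) * exp (- w * of_real (cbrt3 v))) \<partial>lborel)"
    unfolding Airy_Laplace_def by (rule integral_norm_bound)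
  also have "\<dots> \<le> (\<integral>v. Re w powr (-1/2) * (Airy_weight v * cbrt3 v powr (-1/2)) \<partial>lborel)"
  proof (rule integral_mono')
    show "integrable lborel (\<lambda>v. Re w powr (-1/2) * (Airy_weight v * cbrt3 v powr (-1/2)))"
      using h by (simp add: has_bochner_integral_iff)
    fix v
    show "norm (of_real (Airy_weight v) * exp (- w * of_real (cbrt3 v))) \<le> Re w powr (-1/2) * (Airy_weight v * cbrt3 v powr (-1/2))"
    proof (cases "v > 0")
      case True
      then have "cbrt3 v > 0" by (simp add: cbrt3_def)
      then have "exp (- (Re w * cbrt3 v)) \<le> (Re w * cbrt3 v) powr (-1/2)" using assms by (intro exp_le) auto
      also have "\<dots> = Re w powr (-1/2) * cbrt3 v powr (-1/2)" using assms \<open>cbrt3 v > 0\<close> by (simp add: powr_mult)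
      finally have "Airy_weight v * exp (- (Re w * cbrt3 v)) \<le> Airy_weight v * (Re w powr (-1/2) * cbrt3 v powr (-1/2))"
        by (intro mult_left_mono Airy_weight_nonneg)
      then show ?thesis by (simp add: norm_mult Airy_weight_nonneg mult_ac)
    qed (auto simp: Airy_weight_def)
  qed (auto intro!: mult_nonneg_nonneg Airy_weight_nonneg)
  also have "\<dots> = Re w powr (-1/2) * (3 powr ((-1/2 - 2) / 3) * Gamma ((-1/2 + 1) / 3))"
    using h by (rule has_bochner_integral_integral_eq)
  finally show ?thesis by (simp add: mult_ac)
qed

lemma Airy_Laplace_growth: "norm (Airy_Laplace w) \<le> exp (norm w * sqrt (6 * norm w)) * integral\<^sup>L lborel Airy_majorant"
proof -
  have "norm (Airy_Laplace w) \<le> (\<integral>v. norm (of_real (Airy_weight v) * exp (- w * of_real (cbrt3 v))) \<partial>lborel)"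
    unfolding Airy_Laplace_def by (rule integral_norm_bound)
  also have "\<dots> \<le> (\<integral>v. exp (norm w * sqrt (6 * norm w)) * Airy_majorant v \<partial>lborel)"
  proof (rule integral_mono')
    show "integrable lborel (\<lambda>v. exp (norm w * sqrt (6 * norm w)) * Airy_majorant v)"
      by (intro integrable_mult_right integrable_Airy_majorant)
    fix v
    have "- Re w * cbrt3 v \<le> norm w * cbrt3 v"
      using abs_Re_le_cmod[of w] by (intro mult_right_mono cbrt3_nonneg) linarith
    then have "norm (of_real (Airy_weight v) * exp (- w * of_real (cbrt3 v))) \<le> Airy_weight v * exp (norm w * cbrt3 v)"
      by (simp add: norm_mult Airy_weight_nonneg mult_left_mono)
    also have "\<dots> \<le> exp (norm w * sqrt (6 * norm w)) * Airy_majorant v"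
      using Airy_weight_exp_le[of v "norm w"] by (simp add: Airy_weight_nonneg)
    finally show "norm (of_real (Airy_weight v) * exp (- w * of_real (cbrt3 v))) \<le> exp (norm w * sqrt (6 * norm w)) * Airy_majorant v" .
    show "0 \<le> exp (norm w * sqrt (6 * norm w)) * Airy_majorant v" by (auto simp: Airy_majorant_def)
  qed
  finally show ?thesis by simp
qed

lemma Gamma_1_3_2_3: "Gamma (1/3 :: real) * Gamma (2/3) = pi / sin (pi / 3)"
proof -
  have "Gamma (1/3 :: complex) * Gamma (1 - 1/3) = of_real pi / sin (of_real pi * (1/3))"
    by (rule Gamma_reflection_complex)
  then have "of_real (Gamma (1/3 :: real) * Gamma (2/3)) = (of_real (pi / sin (pi / 3)) :: complex)"
    by (simp add: Gamma_complex_of_real [symmetric] sin_of_real[symmetric])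
  then show ?thesis by (simp only: of_real_eq_iff)
qed

lemma Airy_coeff_eq: "Airy_coeff n = (- 1) ^ n * Airy_moment n * sin (real (n + 1) * pi / 3) / (pi * fact n)"
proof (induction n rule: Airy_coeff.induct)
  case 1
  have "Gamma (1/3 :: real) * sin (pi/3) / pi = 1 / Gamma (2/3)"
    using Gamma_1_3_2_3 Gamma_real_pos[of "2/3"] by (simp add: sin_60 divide_simps mult_ac del: Gamma_real_pos)
  from arg_cong[OF this, of "\<lambda>x. x * 3 powr (-2/3)"] show ?case by (simp add: Airy_moment_def mult_ac)
next
  case 2
  have s: "sin (2 * pi / 3) = sin (pi / 3)"
    using sin_pi_minus[of "pi/3"] by (simp add: field_simps)
  have "Gamma (2/3 :: real) * sin (pi/3) / pi = 1 / Gamma (1/3)"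
    using Gamma_1_3_2_3 Gamma_real_pos[of "1/3"] by (simp add: sin_60 divide_simps mult_ac del: Gamma_real_pos)
  from arg_cong[OF this, of "\<lambda>x. x * 3 powr (-1/3)"] show ?case using s by (simp add: Airy_moment_def mult_ac)
next
  case 3
  then show ?case by simp
next
  case (4 n)
  have G: "Gamma ((real n + 4) / 3) = (real n + 1) / 3 * Gamma ((real n + 1) / 3)"
    using Gamma_plus1[of "(real n + 1) / 3"] nonpos_Ints_nonpos[of "(real n + 1) / 3"] by (auto simp add: add_divide_distrib add.assoc)
  have P: "3 powr ((real n + 1) / 3) = 3 * 3 powr ((real n - 2) / 3)"
    using powr_add[of 3 "(real n - 2) / 3" 1] by (simp add: add_divide_distrib diff_divide_distrib mult.commute add.commute)
  have am3: "Airy_moment (Suc (Suc (Suc n))) = (real n + 1) * Airy_moment n"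
    unfolding Airy_moment_def using G P by (simp add: add.commute)
  have "sin (real (n + 4) * pi / 3) = sin (real (n + 1) * pi / 3 + pi)"
    by (simp add: field_simps)
  also have "\<dots> = - sin (real (n + 1) * pi / 3)" by (rule sin_periodic_pi)
  finally have s: "sin (real (n + 4) * pi / 3) = - sin (real (n + 1) * pi / 3)" .
  have f: "fact (Suc (Suc (Suc n))) = (real n + 3) * (real n + 2) * (real n + 1) * (fact n :: real)"
    by (simp add: field_simps)
  have "(- 1) ^ Suc (Suc (Suc n)) * Airy_moment (Suc (Suc (Suc n))) * sin (real (Suc (Suc (Suc n)) + 1) * pi / 3) / (pi * fact (Suc (Suc (Suc n)))) =
     (- 1) ^ n * Airy_moment n * sin (real (n + 1) * pi / 3) / (pi * fact n) / (real (n + 2) * real (n + 3))"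
  proof -
    have e: "Suc (Suc (Suc n)) + 1 = n + 4" by simp
    have "real n + 1 \<noteq> 0" "real n + 2 \<noteq> 0" "real n + 3 \<noteq> 0" by linarith+
    then show ?thesis unfolding e s am3 f by (simp add: divide_simps)
  qed
  then show ?case using 4 by simp
qed

text \<open>
  Subtracting the two conjugate rays leaves the factor \<open>sin ((n + 1) \<pi> / 3)\<close> in the \<open>n\<close>-th coefficient. It
  vanishes for \<open>n = 2\<close> and changes sign when \<open>n\<close> grows by 3, just as the recurrence of the Maclaurin
  coefficients demands.
\<close>

lemma Airy_Ai_eq_Laplace:
  "Airy_Ai z = (cis (pi/3) * Airy_Laplace (z * cis (pi/3)) - cis (- pi/3) * Airy_Laplace (z * cis (- pi/3))) / (2 * of_real pi * \<i>)"
proof -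
  let ?t = "\<lambda>n. cis (pi/3) * ((- (z * cis (pi/3))) ^ n / fact n * of_real (Airy_moment n)) -
       cis (- pi/3) * ((- (z * cis (- pi/3))) ^ n / fact n * of_real (Airy_moment n))"
  have "(\<lambda>n. ?t n / (2 * of_real pi * \<i>)) sums
      ((cis (pi/3) * Airy_Laplace (z * cis (pi/3)) - cis (- pi/3) * Airy_Laplace (z * cis (- pi/3))) / (2 * of_real pi * \<i>))"
    by (intro sums_divide sums_diff sums_mult Airy_Laplace_sums)
  also have "(\<lambda>n. ?t n / (2 * of_real pi * \<i>)) = (\<lambda>n. of_real (Airy_coeff n) * z ^ n)"
  proof
    fix n
    define t where "t = real (n + 1) * pi / 3"
    have p: "cis (pi/3) * cis (pi/3) ^ n = cis t" "cis (-pi/3) * cis (-pi/3) ^ n = cis (- t)"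
      unfolding power_Suc[symmetric] Complex.DeMoivre by (simp_all add: t_def cis_mult add_divide_distrib distrib_right)
    have sn: "cis t - cis (- t) = 2 * \<i> * of_real (sin t)"
      by (simp add: complex_eq_iff)
    have "?t n
       = ((- z) ^ n / fact n * of_real (Airy_moment n)) * (cis (pi/3) * cis (pi/3) ^ n - cis (-pi/3) * cis (-pi/3) ^ n)"
      by (simp add: power_mult_distrib[of "- z", symmetric] power_mult_distrib algebra_simps power_minus[of "_ * _"] power_minus[of z])
    also have "\<dots> = ((- z) ^ n / fact n * of_real (Airy_moment n)) * (2 * \<i> * of_real (sin t))"
      unfolding p sn ..
    also have "\<dots> / (2 * of_real pi * \<i>) = of_real (Airy_coeff n) * z ^ n"
      unfolding Airy_coeff_eq t_def[symmetric] by (simp add: power_minus[of z] field_simps)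
    finally show "?t n / (2 * of_real pi * \<i>) = of_real (Airy_coeff n) * z ^ n" .
  qed
  finally show ?thesis unfolding Airy_Ai_def by (simp add: sums_iff)
qed

text \<open>
  The region is a sector around the positive axis; rotating \<open>z\<close> by \<open>\<plusminus>\<pi>/3\<close> keeps it in the right
  half-plane, where both Laplace integrals decay.
\<close>

lemma Airy_Ai_decay:
  obtains C where "C > 0" "\<And>z. Re z > sqrt 3 * \<bar>Im z\<bar> \<Longrightarrow> norm (Airy_Ai z) \<le> C * (Re z - sqrt 3 * \<bar>Im z\<bar>) powr (-1/2)"
proof
  define D :: real where "D = 3 powr (-5/6) * Gamma (1/6)"
  define C where "C = D * (1/2) powr (-1/2) / pi"
  have D: "D > 0" by (simp add: D_def)
  show "C > 0" using D by (simp add: C_def)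
  fix z assume z: "Re z > sqrt 3 * \<bar>Im z\<bar>"
  define k where "k = Re z - sqrt 3 * \<bar>Im z\<bar>"
  have k: "k > 0" using z by (simp add: k_def)
  have bd: "norm (Airy_Laplace w) \<le> D * ((1/2) powr (-1/2) * k powr (-1/2))" if "Re w \<ge> k / 2" for w
  proof -
    have "norm (Airy_Laplace w) \<le> D * Re w powr (-1/2)" unfolding D_def using that k by (intro Airy_Laplace_decay) auto
    also have "Re w powr (-1/2) \<le> (1/2 * k) powr (-1/2)" using that k by (intro powr_mono2') auto
    also have "(1/2 * k) powr (-1/2) = (1/2) powr (-1/2) * k powr (-1/2)" using k by (subst powr_mult) auto
    finally show ?thesis using D by simp
  qed
  have R: "Re (z * cis (pi/3)) \<ge> k / 2" "Re (z * cis (- pi/3)) \<ge> k / 2"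
    using abs_ge_self[of "sqrt 3 * Im z"] abs_ge_minus_self[of "sqrt 3 * Im z"]
    by (auto simp: cos_60 sin_60 k_def field_simps abs_mult)
  have "norm (Airy_Ai z) \<le> (norm (Airy_Laplace (z * cis (pi/3))) + norm (Airy_Laplace (z * cis (- pi/3)))) / (2 * pi)"
    unfolding Airy_Ai_eq_Laplace norm_divide
    by (intro divide_mono order_trans[OF norm_triangle_ineq4]) (auto simp: norm_mult)
  also have "\<dots> \<le> (D * ((1/2) powr (-1/2) * k powr (-1/2)) + D * ((1/2) powr (-1/2) * k powr (-1/2))) / (2 * pi)"
    by (intro divide_right_mono add_mono bd R) auto
  also have "\<dots> = C * k powr (-1/2)" by (simp add: C_def field_simps)
  finally show "norm (Airy_Ai z) \<le> C * (Re z - sqrt 3 * \<bar>Im z\<bar>) powr (-1/2)" by (simp add: k_def)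
qed

lemma Airy_Ai_growth:
  obtains K where "\<And>z. norm (Airy_Ai z) \<le> exp (K + norm z * sqrt (6 * norm z))"
proof
  define E where "E = integral\<^sup>L lborel Airy_majorant"
  define K where "K = ln (max 1 (E / pi))"
  fix z
  have "norm (Airy_Ai z) \<le> (norm (Airy_Laplace (z * cis (pi/3))) + norm (Airy_Laplace (z * cis (- pi/3)))) / (2 * pi)"
    unfolding Airy_Ai_eq_Laplace norm_divide
    by (intro divide_mono order_trans[OF norm_triangle_ineq4]) (auto simp: norm_mult)
  also have "\<dots> \<le> (exp (norm z * sqrt (6 * norm z)) * E + exp (norm z * sqrt (6 * norm z)) * E) / (2 * pi)"
    using Airy_Laplace_growth[of "z * cis (pi/3)"] Airy_Laplace_growth[of "z * cis (- pi/3)"]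
    by (intro divide_right_mono add_mono) (auto simp: norm_mult E_def)
  also have "\<dots> = E / pi * exp (norm z * sqrt (6 * norm z))" by (simp add: field_simps)
  also have "\<dots> \<le> max 1 (E / pi) * exp (norm z * sqrt (6 * norm z))" by (intro mult_right_mono) auto
  also have "\<dots> = exp (K + norm z * sqrt (6 * norm z))"
    unfolding exp_add K_def by (subst exp_ln) auto
  finally show "norm (Airy_Ai z) \<le> exp (K + norm z * sqrt (6 * norm z))" .
qed

section \<open>The zeros of the Airy function\<close>

lemma Airy_Ai_field_differentiable: "Airy_Ai field_differentiable at z"
  using has_field_derivative_Airy_Ai field_differentiable_def by blast

lemma DERIV_Airy_Ai [derivative_intros]:
  assumes "(g has_field_derivative g') (at x within A)"
  shows "((\<lambda>x. Airy_Ai (g x)) has_field_derivative (deriv Airy_Ai (g x) * g')) (at x within A)"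
proof -
  have "(Airy_Ai has_field_derivative deriv Airy_Ai (g x)) (at (g x))"
    using Airy_Ai_field_differentiable by (simp add: DERIV_deriv_iff_field_differentiable)
  from DERIV_chain2[OF this assms] show ?thesis .
qed

lemma DERIV_Airy_Ai_deriv [derivative_intros]:
  assumes "(g has_field_derivative g') (at x within A)"
  shows "((\<lambda>x. deriv Airy_Ai (g x)) has_field_derivative (g x * Airy_Ai (g x) * g')) (at x within A)"
proof -
  have "deriv Airy_Ai holomorphic_on UNIV"
    using holomorphic_Airy_Ai by (intro holomorphic_deriv) auto
  then have "(deriv Airy_Ai has_field_derivative deriv (deriv Airy_Ai) (g x)) (at (g x))"
    by (simp add: holomorphic_derivI)
  also have "deriv (deriv Airy_Ai) (g x) = g x * Airy_Ai (g x)"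
    using Airy_ode[of "g x"] by (simp add: numeral_2_eq_2)
  finally show ?thesis using DERIV_chain2[OF _ assms] by blast
qed

lemma has_vector_derivative_along_line:
  assumes "(F has_field_derivative D) (at (z + of_real t))"
  shows "((\<lambda>t. F (z + of_real t)) has_vector_derivative D) (at t)"
proof -
  have "((\<lambda>t. z + of_real t) has_vector_derivative 1) (at t)"
    by (auto intro!: derivative_eq_intros)
  from field_vector_diff_chain_at[OF this assms] show ?thesis by (simp add: o_def)
qed

lemma Airy_Ai_0_neq_0: "Airy_Ai 0 \<noteq> 0"
proof -
  have "3 powr (-2/3) / Gamma (2/3 :: real) \<noteq> 0"
    using Gamma_real_pos[of "2/3"] by (auto simp del: Gamma_real_pos)
  then show ?thesis unfolding Airy_Ai_0 of_real_eq_0_iff .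
qed

text \<open>
  Identity theorem, in the form in which the monotonicity arguments below lead to a contradiction.
\<close>

lemma Airy_Ai_not_locally_0:
  assumes "\<And>t. a < t \<Longrightarrow> t < b \<Longrightarrow> Airy_Ai (z + of_real t) = 0" "a < b"
  shows False
proof -
  define c where "c = (a + b) / 2"
  let ?U = "(\<lambda>t. z + complex_of_real t) ` {a<..<b}"
  have "(z + of_real c) islimpt ?U"
  proof (rule islimpt_isCont_image)
    show "c islimpt {a<..<b}" using assms(2) by (intro interior_limit_point) (simp add: c_def)
    show "isCont (\<lambda>t. z + complex_of_real t) c" by (intro continuous_intros)
    show "\<forall>\<^sub>F y in at c. z + complex_of_real y \<noteq> z + complex_of_real c"
      by (auto simp: eventually_at intro: exI[of _ 1])
  qed
  then have "Airy_Ai 0 = 0"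
  proof (rule analytic_continuation[OF holomorphic_Airy_Ai open_UNIV connected_UNIV subset_UNIV UNIV_I])
    fix w assume "w \<in> ?U"
    then obtain t where "w = z + of_real t" "a < t" "t < b" by auto
    then show "Airy_Ai w = 0" using assms(1) by simp
  qed simp_all
  then show False using Airy_Ai_0_neq_0 by contradiction
qed

lemma Airy_Ai_tendsto_0: "((\<lambda>t. Airy_Ai (z + of_real t)) \<longlongrightarrow> 0) at_top"
proof -
  obtain C where C: "C > 0" "\<And>z. Re z > sqrt 3 * \<bar>Im z\<bar> \<Longrightarrow> norm (Airy_Ai z) \<le> C * (Re z - sqrt 3 * \<bar>Im z\<bar>) powr (-1/2)"
    using Airy_Ai_decay by blast
  define k where "k = Re z - sqrt 3 * \<bar>Im z\<bar>"
  have "filterlim (\<lambda>t. t + k) at_top at_top"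
    using filterlim_tendsto_add_at_top[OF tendsto_const[of k] filterlim_ident] by (simp add: add.commute)
  then have "((\<lambda>t. C * (t + k) powr (-1/2)) \<longlongrightarrow> C * 0) at_top"
    by (intro tendsto_mult tendsto_const tendsto_neg_powr) auto
  then have "((\<lambda>t. C * (t + k) powr (-1/2)) \<longlongrightarrow> 0) at_top" by simp
  then show ?thesis
  proof (rule Lim_null_comparison[rotated])
    show "\<forall>\<^sub>F t in at_top. norm (Airy_Ai (z + of_real t)) \<le> C * (t + k) powr (-1/2)"
      using eventually_gt_at_top[of "- k"]
    proof eventually_elim
      case (elim t)
      then have "norm (Airy_Ai (z + of_real t)) \<le> C * (Re (z + of_real t) - sqrt 3 * \<bar>Im (z + of_real t)\<bar>) powr (-1/2)"
        by (intro C) (auto simp: k_def)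
      then show ?case by (simp add: k_def algebra_simps)
    qed
  qed
qed

lemma deriv_Airy_Ai_bounded:
  obtains B where "\<forall>\<^sub>F t in at_top. norm (deriv Airy_Ai (z + of_real t)) \<le> B"
proof -
  obtain C where C: "C > 0" "\<And>z. Re z > sqrt 3 * \<bar>Im z\<bar> \<Longrightarrow> norm (Airy_Ai z) \<le> C * (Re z - sqrt 3 * \<bar>Im z\<bar>) powr (-1/2)"
    using Airy_Ai_decay by blast
  have "\<forall>\<^sub>F t in at_top. norm (deriv Airy_Ai (z + of_real t)) \<le> C"
    using eventually_gt_at_top[of "sqrt 3 * (\<bar>Im z\<bar> + 1) + 2 - Re z"]
  proof eventually_elim
    case (elim t)
    have "norm (Airy_Ai x) \<le> C" if x: "norm (z + of_real t - x) = 1" for x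
    proof -
      have "\<bar>Re (z + of_real t - x)\<bar> \<le> 1" "\<bar>Im (z + of_real t - x)\<bar> \<le> 1"
        using abs_Re_le_cmod abs_Im_le_cmod x by metis+
      then have 1: "Re x \<ge> Re z + t - 1" "\<bar>Im x\<bar> \<le> \<bar>Im z\<bar> + 1" by auto
      have "sqrt 3 * \<bar>Im x\<bar> \<le> sqrt 3 * (\<bar>Im z\<bar> + 1)" using 1 by (intro mult_left_mono) auto
      then have 2: "Re x - sqrt 3 * \<bar>Im x\<bar> \<ge> 1" using 1 elim by linarith
      then have "norm (Airy_Ai x) \<le> C * (Re x - sqrt 3 * \<bar>Im x\<bar>) powr (-1/2)"
        by (intro C) auto
      also have "\<dots> \<le> C * 1 powr (-1/2)"
        using 2 C(1) by (intro mult_left_mono powr_mono2') auto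
      finally show ?thesis by simp
    qed
    moreover have "Airy_Ai holomorphic_on A" for A
      using holomorphic_Airy_Ai by (rule holomorphic_on_subset) auto
    ultimately have "norm ((deriv ^^ 1) Airy_Ai (z + of_real t)) \<le> fact 1 * C / 1 ^ 1"
      by (intro Cauchy_inequality holomorphic_on_imp_continuous_on) auto
    then show ?case by simp
  qed
  then show ?thesis by (rule that)
qed

text \<open>
  The function \<open>Im (cnj (Ai (z + t)) Ai' (z + t))\<close> of the real variable \<open>t\<close> has derivative
  \<open>Im z \<bar>Ai (z + t)\<bar>^2\<close>, so multiplied by \<open>Im z\<close> it is nondecreasing. It vanishes at \<open>t = 0\<close> if \<open>z\<close> is a
  zero, and it tends to 0 at infinity; hence it is constant, and \<open>Ai\<close> would vanish on a half-line.
\<close>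

lemma Airy_Ai_zero_Im_0:
  assumes "Airy_Ai z = 0"
  shows "Im z = 0"
proof (rule ccontr)
  assume Im: "Im z \<noteq> 0"
  let ?f = "\<lambda>t::real. Airy_Ai (z + of_real t)"
  let ?f' = "\<lambda>t::real. deriv Airy_Ai (z + of_real t)"
  define J where "J = (\<lambda>t::real. Im z * Im (cnj (?f t) * ?f' t))"
  have J': "(J has_real_derivative (Im z)\<^sup>2 * (norm (?f t))\<^sup>2) (at t)" for t
  proof -
    have 1: "((\<lambda>t. ?f t) has_vector_derivative ?f' t) (at t)"
      using DERIV_Airy_Ai[of "\<lambda>x. x" 1 "z + of_real t" UNIV]
      by (intro has_vector_derivative_along_line) simp
    have 2: "((\<lambda>t. ?f' t) has_vector_derivative (z + of_real t) * ?f t) (at t)"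
      using DERIV_Airy_Ai_deriv[of "\<lambda>x. x" 1 "z + of_real t" UNIV]
      by (intro has_vector_derivative_along_line) simp
    have 3: "((\<lambda>t. cnj (?f t) * ?f' t) has_vector_derivative
       (cnj (?f t) * ((z + of_real t) * ?f t) +
        cnj (?f' t) * ?f' t)) (at t)"
      by (intro has_vector_derivative_mult 2 has_vector_derivative_cnj 1)
    have "((\<lambda>t. Im (cnj (?f t) * ?f' t)) has_vector_derivative
       Im (cnj (?f t) * ((z + of_real t) * ?f t) +
        cnj (?f' t) * ?f' t)) (at t)"
      using bounded_linear.has_vector_derivative[OF bounded_linear_Im 3] .
    also have "Im (cnj (?f t) * ((z + of_real t) * ?f t) +
        cnj (?f' t) * ?f' t) = Im z * (norm (?f t))\<^sup>2"
      unfolding cmod_power2 by (simp add: algebra_simps power2_eq_square)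
    finally show ?thesis unfolding J_def has_real_derivative_iff_has_vector_derivative[symmetric]
      by (rule DERIV_cmult[THEN DERIV_cong]) (simp add: power2_eq_square)
  qed
  have mono: "J s \<le> J t" if "s \<le> t" for s t
    by (rule DERIV_nonneg_imp_nondecreasing[OF that]) (use J' in \<open>force\<close>)
  have J0: "J 0 = 0" by (simp add: J_def assms)
  have lim: "(J \<longlongrightarrow> 0) at_top"
  proof -
    obtain B where B: "\<forall>\<^sub>F t in at_top. norm (?f' t) \<le> B"
      by (rule deriv_Airy_Ai_bounded)
    have "((\<lambda>t. \<bar>Im z\<bar> * (norm (?f t) * B)) \<longlongrightarrow> \<bar>Im z\<bar> * (0 * B)) at_top"
      by (intro tendsto_intros tendsto_norm_zero Airy_Ai_tendsto_0)
    then have "((\<lambda>t. \<bar>Im z\<bar> * (norm (?f t) * B)) \<longlongrightarrow> 0) at_top" by simp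
    then show ?thesis
    proof (rule Lim_null_comparison[rotated])
      show "\<forall>\<^sub>F t in at_top. norm (J t) \<le> \<bar>Im z\<bar> * (norm (?f t) * B)"
        using B
      proof eventually_elim
        case (elim t)
        have "\<bar>Im (cnj (?f t) * ?f' t)\<bar> \<le> norm (cnj (?f t) * ?f' t)"
          by (rule abs_Im_le_cmod)
        also have "\<dots> \<le> norm (?f t) * B"
          unfolding norm_mult complex_mod_cnj using elim by (intro mult_left_mono) auto
        finally show ?case unfolding J_def real_norm_def abs_mult by (intro mult_left_mono) auto
      qed
    qed
  qed
  have Jz: "J t = 0" if "t \<ge> 0" for t
  proof -
    have "J t \<le> 0"
      by (rule tendsto_lowerbound[OF lim]) (auto intro!: eventually_mono[OF eventually_ge_at_top[of t]] mono)
    then show ?thesis using mono[OF that] J0 by simp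
  qed
  have "?f t = 0" if "0 < t" "t < 1" for t
  proof -
    have "(J has_real_derivative 0) (at t)"
    proof (rule DERIV_cong_ev[THEN iffD2, OF refl _ refl])
      show "\<forall>\<^sub>F x in nhds t. J x = 0"
        using eventually_nhds_in_open[of "{0<..}" t] that by (auto elim!: eventually_mono intro: Jz)
    qed auto
    from DERIV_unique[OF this J'[of t]] Im show ?thesis by simp
  qed
  then show False by (rule Airy_Ai_not_locally_0[of 0 1 z]) simp_all
qed

definition Ai_real :: "real \<Rightarrow> real" where "Ai_real x = Re (Airy_Ai (of_real x))"
definition Ai_real' :: "real \<Rightarrow> real" where "Ai_real' x = Re (deriv Airy_Ai (of_real x))"

lemma Airy_Ai_of_real: "Airy_Ai (of_real x) = of_real (Ai_real x)"
proof -
  have "(\<lambda>n. of_real (Airy_coeff n * x ^ n) :: complex) sums Airy_Ai (of_real x)"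
    using summable_sums[OF summable_Airy_Ai[of "of_real x"]] by (simp only: of_real_mult of_real_power Airy_Ai_def)
  from sums_Im[OF this] have "(\<lambda>_. 0) sums Im (Airy_Ai (of_real x))" by simp
  then have "Im (Airy_Ai (of_real x)) = 0" using sums_unique2 sums_zero by blast
  then show ?thesis by (simp add: complex_eq_iff Ai_real_def)
qed

lemma DERIV_Ai_real: "(Ai_real has_real_derivative Ai_real' x) (at x)"
proof -
  have "((\<lambda>t. Airy_Ai (of_real t)) has_vector_derivative deriv Airy_Ai (of_real x)) (at x)"
    using DERIV_Airy_Ai[of "\<lambda>x. x" 1 "of_real x" UNIV]
    by (intro has_vector_derivative_real_field) simp
  from bounded_linear.has_vector_derivative[OF bounded_linear_Re this]
  show ?thesis unfolding Ai_real_def[abs_def] Ai_real'_def has_real_derivative_iff_has_vector_derivative .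
qed

lemma deriv_Airy_Ai_of_real: "deriv Airy_Ai (of_real x) = of_real (Ai_real' x)"
proof -
  have "((\<lambda>t. Airy_Ai (of_real t)) has_vector_derivative deriv Airy_Ai (of_real x)) (at x)"
    using DERIV_Airy_Ai[of "\<lambda>x. x" 1 "of_real x" UNIV]
    by (intro has_vector_derivative_real_field) simp
  from bounded_linear.has_vector_derivative[OF bounded_linear_Im this]
  have "((\<lambda>t. 0) has_vector_derivative Im (deriv Airy_Ai (of_real x))) (at x)"
    by (simp add: Airy_Ai_of_real)
  then have "Im (deriv Airy_Ai (of_real x)) = 0"
    by (rule vector_derivative_unique_at) (rule has_vector_derivative_const)
  then show ?thesis by (simp add: complex_eq_iff Ai_real'_def)
qed

lemma DERIV_Ai_real': "(Ai_real' has_real_derivative x * Ai_real x) (at x)"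
proof -
  have "((\<lambda>t. deriv Airy_Ai (of_real t)) has_vector_derivative of_real x * Airy_Ai (of_real x)) (at x)"
    using DERIV_Airy_Ai_deriv[of "\<lambda>x. x" 1 "of_real x" UNIV]
    by (intro has_vector_derivative_real_field) simp
  from bounded_linear.has_vector_derivative[OF bounded_linear_Re this]
  show ?thesis unfolding Ai_real_def Ai_real'_def[abs_def] has_real_derivative_iff_has_vector_derivative
    by (simp add: Airy_Ai_of_real)
qed

text \<open>
  On the positive axis the derivative of \<open>y y'\<close> is \<open>y'^2 + x y^2 \<ge> 0\<close>. If \<open>y y'\<close> were nonnegative
  somewhere, then \<open>y^2\<close> would be nondecreasing from there on, which is impossible because it tends to 0.
\<close>

lemma Ai_real_mult_deriv_neg:
  assumes "x \<ge> 0"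
  shows "Ai_real x * Ai_real' x < 0"
proof (rule ccontr)
  assume neg: "\<not> Ai_real x * Ai_real' x < 0"
  have nonneg: "Ai_real t * Ai_real' t \<ge> 0" if "t \<ge> x" for t
  proof -
    have "Ai_real x * Ai_real' x \<le> Ai_real t * Ai_real' t"
    proof (rule DERIV_nonneg_imp_nondecreasing[OF that])
      fix s assume s: "x \<le> s" "s \<le> t"
      have "((\<lambda>x. Ai_real x * Ai_real' x) has_real_derivative (Ai_real' s)\<^sup>2 + s * (Ai_real s)\<^sup>2) (at s)"
        by (auto intro!: derivative_eq_intros DERIV_Ai_real DERIV_Ai_real' simp: power2_eq_square)
      then show "\<exists>y. ((\<lambda>x. Ai_real x * Ai_real' x) has_real_derivative y) (at s) \<and> 0 \<le> y"
        by (intro exI conjI, assumption) (use s assms in simp)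
    qed
    then show ?thesis using neg by linarith
  qed
  have mono: "(Ai_real s)\<^sup>2 \<le> (Ai_real t)\<^sup>2" if "x \<le> s" "s \<le> t" for s t
  proof (rule DERIV_nonneg_imp_nondecreasing[OF that(2)])
    fix r assume r: "s \<le> r" "r \<le> t"
    have "((\<lambda>x. (Ai_real x)\<^sup>2) has_real_derivative 2 * (Ai_real r * Ai_real' r)) (at r)"
      by (auto intro!: derivative_eq_intros DERIV_Ai_real)
    then show "\<exists>y. ((\<lambda>x. (Ai_real x)\<^sup>2) has_real_derivative y) (at r) \<and> 0 \<le> y"
      by (intro exI conjI, assumption) (use nonneg[of r] r that in simp)
  qed
  have "((\<lambda>t. (Ai_real t)\<^sup>2) \<longlongrightarrow> (Re 0)\<^sup>2) at_top"
    using Airy_Ai_tendsto_0[of 0] unfolding Ai_real_def by (intro tendsto_intros) simp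
  then have lim: "((\<lambda>t. (Ai_real t)\<^sup>2) \<longlongrightarrow> 0) at_top" by simp
  have "Airy_Ai (of_real x + of_real t) = 0" if "0 < t" "t < 1" for t
  proof -
    have "(Ai_real (x + t))\<^sup>2 \<le> 0"
      by (rule tendsto_lowerbound[OF lim])
         (use that in \<open>auto intro!: eventually_mono[OF eventually_ge_at_top[of "x + t"]] mono\<close>)
    then show ?thesis by (simp add: Airy_Ai_of_real flip: of_real_add)
  qed
  then show False by (rule Airy_Ai_not_locally_0[of 0 1 "of_real x"]) simp_all
qed

lemma Airy_Ai_zero_obtain:
  assumes "Airy_Ai z = 0"
  obtains a where "z = of_real a" "a < 0" "Ai_real a = 0"
proof
  show z: "z = of_real (Re z)"
    using Airy_Ai_zero_Im_0[OF assms] by (intro complex_eqI) simp_all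
  show r0: "Ai_real (Re z) = 0"
    unfolding Ai_real_def z[symmetric] using assms by simp
  show "Re z < 0"
  proof (rule ccontr)
    assume "\<not> Re z < 0"
    then have "Ai_real (Re z) * Ai_real' (Re z) < 0" by (intro Ai_real_mult_deriv_neg) linarith
    then show False unfolding r0 by simp
  qed
qed

text \<open>
  Uniqueness for the initial value problem with zero data, proved with the energy \<open>y^2 + y'^2\<close>: after
  multiplication by \<open>exp (- M x)\<close> with \<open>M\<close> large it is nonincreasing.
\<close>

lemma Airy_Ai_zero_simple:
  assumes "Airy_Ai z = 0"
  shows "deriv Airy_Ai z \<noteq> 0"
proof
  assume d: "deriv Airy_Ai z = 0"
  obtain a where z: "z = of_real a" and ra: "Ai_real a = 0"
    using assms by (rule Airy_Ai_zero_obtain)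
  \<comment> \<open>On \<open>[a, a + 1]\<close> the derivative \<open>2 y y' (1 + x)\<close> of the energy is at most \<open>M\<close> times the energy.\<close>
  define M where "M = \<bar>a\<bar> + 2"
  define E where "E = (\<lambda>x. ((Ai_real x)\<^sup>2 + (Ai_real' x)\<^sup>2) * exp (- M * x))"
  have Ea: "E a = 0"
    using ra d by (simp add: E_def z Ai_real'_def)
  have le: "E x \<le> E a" if "a \<le> x" "x \<le> a + 1" for x
  proof (rule DERIV_nonpos_imp_nonincreasing[OF that(1)])
    fix s assume s: "a \<le> s" "s \<le> x"
    let ?D = "(2 * Ai_real s * Ai_real' s * (1 + s) - M * ((Ai_real s)\<^sup>2 + (Ai_real' s)\<^sup>2)) * exp (- M * s)"
    have "(E has_real_derivative ?D) (at s)"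
      unfolding E_def by (auto intro!: derivative_eq_intros DERIV_Ai_real DERIV_Ai_real' simp: algebra_simps power2_eq_square)
    moreover have "?D \<le> 0"
    proof -
      have "2 * Ai_real s * Ai_real' s * (1 + s) \<le> \<bar>2 * Ai_real s * Ai_real' s\<bar> * \<bar>1 + s\<bar>"
        unfolding abs_mult[symmetric] by (rule abs_ge_self)
      also have "\<dots> \<le> ((Ai_real s)\<^sup>2 + (Ai_real' s)\<^sup>2) * M"
      proof (intro mult_mono)
        have "(Ai_real s + Ai_real' s)\<^sup>2 \<ge> 0" "(Ai_real s - Ai_real' s)\<^sup>2 \<ge> 0" by auto
        then show "\<bar>2 * Ai_real s * Ai_real' s\<bar> \<le> (Ai_real s)\<^sup>2 + (Ai_real' s)\<^sup>2"
          by (auto simp: power2_sum power2_diff abs_le_iff)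
      qed (use s that in \<open>auto simp: M_def\<close>)
      finally show ?thesis by (simp add: mult_le_0_iff mult.commute)
    qed
    ultimately show "\<exists>y. (E has_real_derivative y) (at s) \<and> y \<le> 0" by blast
  qed
  have "Airy_Ai (z + of_real t) = 0" if "0 < t" "t < 1" for t
  proof -
    have "((Ai_real (a + t))\<^sup>2 + (Ai_real' (a + t))\<^sup>2) * exp (- M * (a + t)) \<le> 0"
      using le[of "a + t"] Ea that by (simp add: E_def)
    then have "(Ai_real (a + t))\<^sup>2 + (Ai_real' (a + t))\<^sup>2 \<le> 0"
      by (simp add: mult_le_0_iff not_le[symmetric])
    then have "Ai_real (a + t) = 0" by (simp add: sum_power2_le_zero_iff)
    then show ?thesis by (simp add: z Airy_Ai_of_real flip: of_real_add)
  qed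
  then show False by (rule Airy_Ai_not_locally_0[of 0 1 z]) simp_all
qed

text \<open>
  The function \<open>u\<close> of the Riccati equation. The sign makes it positive on the positive axis.
\<close>

definition neg_log_deriv :: "real \<Rightarrow> real" where "neg_log_deriv x = - (Ai_real' x / Ai_real x)"

lemma Ai_real_neq_0:
  assumes "x \<ge> 0"
  shows "Ai_real x \<noteq> 0"
proof
  assume "Ai_real x = 0"
  then show False using Ai_real_mult_deriv_neg[OF assms] by simp
qed

lemma neg_log_deriv_pos:
  assumes "x \<ge> 0"
  shows "neg_log_deriv x > 0"
proof -
  have "neg_log_deriv x = - (Ai_real x * Ai_real' x) / (Ai_real x)\<^sup>2"
    using Ai_real_neq_0[OF assms] by (simp add: neg_log_deriv_def power2_eq_square)
  also have "\<dots> > 0"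
    using Ai_real_mult_deriv_neg[OF assms] Ai_real_neq_0[OF assms] by (intro divide_pos_pos) simp_all
  finally show ?thesis .
qed

lemma DERIV_neg_log_deriv:
  assumes "x \<ge> 0"
  shows "(neg_log_deriv has_real_derivative (neg_log_deriv x)\<^sup>2 - x) (at x)"
proof -
  have "((\<lambda>x. - (Ai_real' x / Ai_real x)) has_real_derivative
      - ((x * Ai_real x * Ai_real x - Ai_real' x * Ai_real' x) / (Ai_real x * Ai_real x))) (at x)"
    by (intro DERIV_minus DERIV_divide DERIV_Ai_real DERIV_Ai_real' Ai_real_neq_0 assms)
  also have "- ((x * Ai_real x * Ai_real x - Ai_real' x * Ai_real' x) / (Ai_real x * Ai_real x)) = (neg_log_deriv x)\<^sup>2 - x"
    using Ai_real_neq_0[OF assms] by (simp add: neg_log_deriv_def power2_eq_square diff_divide_distrib)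
  finally show ?thesis unfolding neg_log_deriv_def[abs_def] .
qed

lemma neg_log_deriv_0: "neg_log_deriv 0 = 3 powr (1/3) * (Gamma (2/3) / Gamma (1/3))"
proof -
  have "3 powr (-1/3) / 3 powr (-2/3) = (3 powr (1/3) :: real)"
    by (simp add: powr_diff[symmetric])
  moreover have "Ai_real 0 = 3 powr (-2/3) / Gamma (2/3)" "Ai_real' 0 = - (3 powr (-1/3) / Gamma (1/3))"
    by (simp_all add: Ai_real_def Ai_real'_def Airy_Ai_0 deriv_Airy_Ai_0)
  moreover have "neg_log_deriv 0 = (3 powr (-1/3) / 3 powr (-2/3)) * (Gamma (2/3) / Gamma (1/3))"
    unfolding neg_log_deriv_def calculation(2,3) by simp
  ultimately show ?thesis by simp
qed

section \<open>The second logarithmic derivative as a sum over the zeros\<close>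

text \<open>
  A bound for the real part from above controls all derivatives (Borel and Caratheodory). Schwarz's lemma is
  applied to the composition of \<open>g\<close> with a Moebius map from the half-plane to the unit disc; Cauchy's
  inequality on a disc of radius \<open>R / 4\<close> then gives the second derivative.
\<close>

lemma Borel_Caratheodory_deriv2:
  assumes holg: "g holomorphic_on ball 0 R" and R: "R > 0" and D: "D > 0"
      and Re_less: "\<And>z. z \<in> ball 0 R \<Longrightarrow> Re (g z - g 0) < D"
      and z: "norm z \<le> R / 4"
  shows "norm ((deriv ^^ 2) g z) \<le> 96 * D / R\<^sup>2"
proof -
  define h where "h = (\<lambda>w. g (of_real R * w) - g 0)"
  \<comment> \<open>The Moebius map \<open>h / (2 D - h)\<close> takes the half-plane \<open>Re h < D\<close> to the unit disc and fixes 0.\<close>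
  define \<phi> where "\<phi> = (\<lambda>w. h w / (2 * of_real D - h w))"
  have in_ball: "of_real R * w \<in> ball 0 R" if "norm w < 1" for w :: complex
    using that R by (simp add: norm_mult)
  have holh: "h holomorphic_on ball 0 1"
    unfolding h_def using in_ball
    by (intro holomorphic_intros holomorphic_on_compose_gen[OF _ holg, unfolded o_def]) auto
  have Re_h: "Re (h w) < D" if "norm w < 1" for w
    using Re_less[OF in_ball[OF that]] by (simp add: h_def)
  have nz: "2 * of_real D - h w \<noteq> 0" if "norm w < 1" for w
  proof
    assume "2 * of_real D - h w = 0"
    then have "Re (2 * of_real D - h w) = 0" by simp
    then show False using Re_h[OF that] D by simp
  qed
  have lt: "norm (h w) < norm (2 * of_real D - h w)" if "norm w < 1" for w
  proof -
    have "(norm (2 * of_real D - h w))\<^sup>2 - (norm (h w))\<^sup>2 = 4 * D * (D - Re (h w))"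
      unfolding cmod_power2 by (simp add: power2_eq_square algebra_simps)
    also have "\<dots> > 0" using Re_h[OF that] D by simp
    finally show ?thesis by (simp add: power2_less_imp_less)
  qed
  have phi_le: "norm (\<phi> w) \<le> norm w" if "norm w < 1" for w
  proof (rule Schwarz_Lemma(1)[of \<phi>])
    show "\<phi> holomorphic_on ball 0 1"
      unfolding \<phi>_def using nz by (intro holomorphic_intros holh) auto
    show "\<phi> 0 = 0" by (simp add: \<phi>_def h_def)
    show "norm (\<phi> w) < 1" if "norm w < 1" for w
      using lt[OF that] nz[OF that] by (simp add: \<phi>_def norm_divide divide_less_eq)
  qed fact
  have h_le: "norm (h w) \<le> 2 * D" if w: "norm w \<le> 1/2" for w
  proof -
    have w1: "norm w < 1" using w by simp
    have "norm (h w) = norm (\<phi> w) * norm (2 * of_real D - h w)"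
      using nz[OF w1] by (simp add: \<phi>_def norm_divide)
    also have "\<dots> \<le> 1/2 * (2 * D + norm (h w))"
    proof (intro mult_mono)
      show "norm (2 * complex_of_real D - h w) \<le> 2 * D + norm (h w)"
        using norm_triangle_ineq4[of "2 * complex_of_real D" "h w"] D by (simp add: norm_mult)
    qed (use phi_le[OF w1] w in auto)
    finally show ?thesis by simp
  qed
  have "norm ((deriv ^^ 2) g z) \<le> fact 2 * (3 * D) / (R / 4) ^ 2"
  proof (rule Cauchy_higher_deriv_bound[where y = "g 0"])
    have sub: "cball z (R / 4) \<subseteq> ball 0 R"
    proof
      fix w assume "w \<in> cball z (R / 4)"
      then have "norm (w - z) \<le> R / 4" by (simp add: dist_norm norm_minus_commute)
      then show "w \<in> ball 0 R" using norm_triangle_sub[of w z] z R by simp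
    qed
    show "g holomorphic_on ball z (R / 4)"
      using holg sub ball_subset_cball by (blast intro: holomorphic_on_subset)
    show "continuous_on (cball z (R / 4)) g"
      using holg sub by (blast intro: holomorphic_on_subset holomorphic_on_imp_continuous_on)
    fix w assume "w \<in> ball z (R / 4)"
    then have "norm (w - z) < R / 4" by (simp add: dist_norm norm_minus_commute)
    then have "norm (w / of_real R) \<le> 1 / 2"
      using norm_triangle_sub[of w z] z R by (simp add: norm_divide divide_le_eq)
    from h_le[OF this] show "g w \<in> ball (g 0) (3 * D)"
      using R D by (simp add: h_def dist_norm norm_minus_commute)
  qed (use R in auto)
  also have "\<dots> = 96 * D / R\<^sup>2" by (simp add: power2_eq_square)
  finally show ?thesis .
qed

lemma factor_simple_zeros:
  fixes f :: "complex \<Rightarrow> complex"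
  assumes "finite S" "f holomorphic_on UNIV" "\<And>a. a \<in> S \<Longrightarrow> f a = 0"
  shows "\<exists>q. q holomorphic_on UNIV \<and> (\<forall>z. f z = q z * (\<Prod>a\<in>S. z - a))"
  using assms(1,3)
proof (induction S rule: finite_induct)
  case empty
  then show ?case using assms(2) by auto
next
  case (insert a S)
  then obtain q where q: "q holomorphic_on UNIV" "\<And>z. f z = q z * (\<Prod>a\<in>S. z - a)" by auto
  define r where "r = (\<lambda>z. if z = a then deriv q a else (q z - q a) / (z - a))"
  have "(\<Prod>b\<in>S. a - b) \<noteq> 0" using insert.hyps by auto
  then have qa: "q a = 0" using q(2)[of a] insert.prems[of a] by simp
  have "r holomorphic_on UNIV" unfolding r_def by (intro pole_lemma q) auto
  moreover have "f z = r z * (\<Prod>a\<in>insert a S. z - a)" for z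
    using insert.hyps qa by (cases "z = a") (auto simp: q(2) r_def)
  ultimately show ?case by blast
qed

text \<open>
  Multiplying \<open>f\<close> by the inverse of the finite Blaschke product of its zeros in the disc removes the zeros
  without changing the modulus on the circle. The result \<open>exp g\<close> is therefore bounded by the maximum of
  \<open>f\<close>, while at the origin it can only have become larger than \<open>f 0\<close>.
\<close>

lemma Blaschke_log:
  fixes f :: "complex \<Rightarrow> complex"
  assumes hol: "f holomorphic_on UNIV" and f0: "f 0 \<noteq> 0"
      and simple: "\<And>a. f a = 0 \<Longrightarrow> deriv f a \<noteq> 0"
      and R: "R > 0" and bound: "\<And>z. norm z = R \<Longrightarrow> norm (f z) \<le> exp A"
  defines "S \<equiv> {z \<in> ball 0 R. f z = 0}"
  obtains g where "finite S" "g holomorphic_on ball 0 R"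
    "\<And>z. z \<in> ball 0 R \<Longrightarrow> f z * (\<Prod>a\<in>S. (of_real (R\<^sup>2) - cnj a * z) / of_real R) = exp (g z) * (\<Prod>a\<in>S. z - a)"
    "\<And>z. z \<in> ball 0 R \<Longrightarrow> Re (g z) \<le> A"
    "Re (g 0) = ln (norm (f 0)) + (\<Sum>a\<in>S. ln (R / norm a))"
proof -
  have fin: "finite S"
  proof (cases "S = {}")
    case False
    then obtain a where a: "f a = 0" by (auto simp: S_def)
    have "\<not> f constant_on UNIV"
    proof
      assume "f constant_on UNIV"
      then obtain y where "\<And>x. f x = y" by (auto simp: constant_on_def)
      then show False using a f0 by simp
    qed
    then have "finite {z \<in> cball 0 R. f z = 0}"
      by (intro holomorphic_compact_finite_zeros[OF hol]) auto
    then show ?thesis by (rule finite_subset[rotated]) (auto simp: S_def)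
  qed auto
  obtain q where q: "q holomorphic_on UNIV" "\<And>z. f z = q z * (\<Prod>a\<in>S. z - a)"
    using factor_simple_zeros[OF fin hol] by (auto simp: S_def)
  have qnz: "q z \<noteq> 0" if z: "z \<in> ball 0 R" for z
  proof
    assume qz: "q z = 0"
    then have fz: "f z = 0" using q(2) by simp
    then have zS: "z \<in> S" using z by (simp add: S_def)
    have "((\<lambda>w. q w * (\<Prod>a\<in>S. w - a)) has_field_derivative
            q z * (\<Sum>x\<in>S. 1 * (\<Prod>y\<in>S - {x}. z - y)) + deriv q z * (\<Prod>a\<in>S. z - a)) (at z)"
      by (intro DERIV_mult' has_field_derivative_prod holomorphic_derivI[OF q(1)] derivative_eq_intros) auto
    also have "(\<lambda>w. q w * (\<Prod>a\<in>S. w - a)) = f" using q(2) by auto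
    also have "q z * (\<Sum>x\<in>S. 1 * (\<Prod>y\<in>S - {x}. z - y)) + deriv q z * (\<Prod>a\<in>S. z - a) = 0"
      using qz zS fin by auto
    finally show False using simple[OF fz] DERIV_imp_deriv by blast
  qed
  define F where "F = (\<lambda>z. q z * (\<Prod>a\<in>S. (of_real (R\<^sup>2) - cnj a * z) / of_real R))"
  have holF: "F holomorphic_on T" for T
    unfolding F_def using R by (intro holomorphic_intros holomorphic_on_subset[OF q(1)]) auto
  have bnz: "of_real (R\<^sup>2) - cnj a * z \<noteq> 0" if "a \<in> S" "z \<in> ball 0 R" for a z
  proof
    assume "of_real (R\<^sup>2) - cnj a * z = 0"
    then have "norm (of_real (R\<^sup>2) :: complex) = norm (cnj a * z)" by simp
    then have "R\<^sup>2 = norm a * norm z" using R by (simp add: norm_mult norm_power)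
    also have "\<dots> < R * R" using that by (intro mult_strict_mono') (auto simp: S_def)
    finally show False by (simp add: power2_eq_square)
  qed
  have Fnz: "F z \<noteq> 0" if "z \<in> ball 0 R" for z
    using qnz[OF that] bnz[OF _ that] fin R by (auto simp: F_def)
  have norm_eq: "norm (of_real (R\<^sup>2) - cnj a * z) / R = norm (z - a)" if "norm z = R" for a z
  proof -
    have "of_real (R\<^sup>2) - cnj a * z = z * (cnj (z - a))"
      using that by (simp add: algebra_simps complex_norm_square[symmetric])
    then have "norm (of_real (R\<^sup>2) - cnj a * z) = R * norm (z - a)"
      using that by (simp only: norm_mult complex_mod_cnj)
    then show ?thesis using R by simp
  qed
  have F_le: "norm (F z) \<le> exp A" if "z \<in> ball 0 R" for z
  proof (rule maximum_modulus_frontier[OF holF holomorphic_on_imp_continuous_on[OF holF] _ _ that])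
    fix w assume "w \<in> frontier (ball (0::complex) R)"
    then have w: "norm w = R" using R by (simp add: frontier_ball)
    have "norm (F w) = norm (f w)"
      using R norm_eq[OF w] unfolding F_def q(2) norm_mult prod_norm[symmetric] norm_divide norm_of_real
      by simp
    then show "norm (F w) \<le> exp A" using bound[OF w] by simp
  qed auto
  obtain g where g: "g holomorphic_on ball 0 R" "\<And>z. z \<in> ball 0 R \<Longrightarrow> F z = exp (g z)"
    using contractible_imp_holomorphic_log[OF holF convex_imp_contractible[OF convex_ball] Fnz] by blast
  show ?thesis
  proof (rule that[OF fin g(1)])
    fix z :: complex assume z: "z \<in> ball 0 R"
    show "f z * (\<Prod>a\<in>S. (of_real (R\<^sup>2) - cnj a * z) / of_real R) = exp (g z) * (\<Prod>a\<in>S. z - a)"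
      using g(2)[OF z] by (simp add: q(2) F_def)
    show "Re (g z) \<le> A" using F_le[OF z] by (simp add: g(2)[OF z])
  next
    have 0: "0 \<in> ball 0 R" using R by simp
    have aS: "a \<noteq> 0" if "a \<in> S" for a using that f0 by (auto simp: S_def)
    have "exp (Re (g 0)) = norm (F 0)" by (simp add: g(2)[OF 0])
    also have "\<dots> = norm (q 0) * (\<Prod>a\<in>S. R)"
      using R by (simp add: F_def norm_mult prod_norm[symmetric] norm_divide norm_power power2_eq_square)
    also have "\<dots> = norm (f 0) * (\<Prod>a\<in>S. R / norm a)"
      using fin aS by (simp add: q(2) norm_mult prod_norm[symmetric] prod_dividef)
    finally have "Re (g 0) = ln (norm (f 0) * (\<Prod>a\<in>S. R / norm a))" by (metis ln_exp)
    also have "\<dots> = ln (norm (f 0)) + ln (\<Prod>a\<in>S. R / norm a)"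
      using f0 R aS by (intro ln_mult_pos prod_pos) auto
    also have "ln (\<Prod>a\<in>S. R / norm a) = (\<Sum>a\<in>S. ln (R / norm a))"
      using fin R aS by (intro ln_prod) auto
    finally show "Re (g 0) = ln (norm (f 0)) + (\<Sum>a\<in>S. ln (R / norm a))" .
  qed
qed

text \<open>
  Each zero in the smaller disc contributes at least \<open>ln 2\<close> to the value of \<open>Re g\<close> at the origin, for
  the function \<open>g\<close> belonging to the disc of twice the radius.
\<close>

lemma Jensen_zero_count:
  fixes f :: "complex \<Rightarrow> complex"
  assumes hol: "f holomorphic_on UNIV" and f0: "f 0 \<noteq> 0"
      and simple: "\<And>a. f a = 0 \<Longrightarrow> deriv f a \<noteq> 0"
      and R: "R > 0" and bound: "\<And>z. norm z = 2 * R \<Longrightarrow> norm (f z) \<le> exp A"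
  shows "finite {z \<in> ball 0 R. f z = 0}"
    and "real (card {z \<in> ball 0 R. f z = 0}) * ln 2 \<le> A - ln (norm (f 0))"
proof -
  define S where "S = {z \<in> ball 0 (2 * R). f z = 0}"
  define T where "T = {z \<in> ball 0 R. f z = 0}"
  have R2: "2 * R > 0" using R by simp
  obtain g where g: "finite S" "g holomorphic_on ball 0 (2 * R)"
    "\<And>z. z \<in> ball 0 (2 * R) \<Longrightarrow> f z * (\<Prod>a\<in>S. (of_real ((2 * R)\<^sup>2) - cnj a * z) / of_real (2 * R)) = exp (g z) * (\<Prod>a\<in>S. z - a)"
    "\<And>z. z \<in> ball 0 (2 * R) \<Longrightarrow> Re (g z) \<le> A"
    "Re (g 0) = ln (norm (f 0)) + (\<Sum>a\<in>S. ln (2 * R / norm a))"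
    unfolding S_def using Blaschke_log[OF hol f0 simple R2 bound] by blast
  have sub: "T \<subseteq> S" using R by (auto simp: S_def T_def)
  show "finite {z \<in> ball 0 R. f z = 0}" using finite_subset[OF sub g(1)] by (simp add: T_def)
  have nz: "norm a > 0" if "a \<in> S" for a using that f0 by (auto simp: S_def)
  have "real (card T) * ln 2 = (\<Sum>a\<in>T. ln 2)" by simp
  also have "\<dots> \<le> (\<Sum>a\<in>T. ln (2 * R / norm a))"
  proof (rule sum_mono)
    fix a assume a: "a \<in> T"
    then have "norm a > 0" "norm a < R" using nz sub by (auto simp: T_def)
    then show "ln 2 \<le> ln (2 * R / norm a)" using R by (subst ln_le_cancel_iff) (auto simp: field_simps)
  qed
  also have "\<dots> \<le> (\<Sum>a\<in>S. ln (2 * R / norm a))"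
  proof (rule sum_mono2[OF g(1) sub])
    fix a assume "a \<in> S - T"
    then have "norm a > 0" "norm a < 2 * R" using nz by (auto simp: S_def)
    then show "0 \<le> ln (2 * R / norm a)" by (intro ln_ge_zero) (auto simp: field_simps)
  qed
  also have "\<dots> \<le> A - ln (norm (f 0))" using g(4)[of 0] g(5) R by simp
  finally show "real (card {z \<in> ball 0 R. f z = 0}) * ln 2 \<le> A - ln (norm (f 0))" by (simp add: T_def)
qed

text \<open>
  The second logarithmic derivative of \<open>f\<close> differs from the sum over the zeros in the disc by the second
  derivative of \<open>g\<close> and by the contribution of the reflected zeros \<open>R^2 / cnj a\<close>. At distance at most
  \<open>R / 4\<close> from the origin both are small compared with the growth of \<open>f\<close> divided by \<open>R^2\<close>.
\<close>

lemma log_deriv_sum_zeros_bound: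
  fixes f :: "complex \<Rightarrow> complex"
  assumes hol: "f holomorphic_on UNIV" and f0: "f 0 \<noteq> 0"
      and simple: "\<And>a. f a = 0 \<Longrightarrow> deriv f a \<noteq> 0"
      and R: "R > 0" and bound: "\<And>z. norm z = R \<Longrightarrow> norm (f z) \<le> exp A"
      and z: "norm z \<le> R / 4" and fz: "f z \<noteq> 0"
  defines "S \<equiv> {z \<in> ball 0 R. f z = 0}"
  shows "norm (deriv (\<lambda>w. deriv f w / f w) z + (\<Sum>a\<in>S. 1 / (z - a)\<^sup>2))
           \<le> (96 * (A - ln (norm (f 0)) + 1) + 2 * real (card S)) / R\<^sup>2"
proof -
  obtain g where fin: "finite S" and holg: "g holomorphic_on ball 0 R"
    and eq: "\<And>z. z \<in> ball 0 R \<Longrightarrow> f z * (\<Prod>a\<in>S. (of_real (R\<^sup>2) - cnj a * z) / of_real R) = exp (g z) * (\<Prod>a\<in>S. z - a)"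
    and Re_g: "\<And>z. z \<in> ball 0 R \<Longrightarrow> Re (g z) \<le> A"
    and Re_g0: "Re (g 0) = ln (norm (f 0)) + (\<Sum>a\<in>S. ln (R / norm a))"
    unfolding S_def using Blaschke_log[OF hol f0 simple R bound] by blast
  have "(\<Sum>a\<in>S. ln (R / norm a)) \<ge> 0"
  proof (rule sum_nonneg)
    fix a assume a: "a \<in> S"
    then have "norm a > 0" "norm a < R" using f0 by (auto simp: S_def)
    then show "0 \<le> ln (R / norm a)" by (intro ln_ge_zero) (auto simp: field_simps)
  qed
  then have g0: "Re (g 0) \<ge> ln (norm (f 0))" using Re_g0 by simp
  define D where "D = A - ln (norm (f 0)) + 1"
  have D: "D > 0" "\<And>w. w \<in> ball 0 R \<Longrightarrow> Re (g w - g 0) < D"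
    using g0 Re_g Re_g[of 0] R by (fastforce simp: D_def)+
  have bnd: "norm (of_real (R\<^sup>2) - cnj a * w) \<ge> R * (R - norm w)" if "a \<in> S" for a w
  proof -
    have "norm (of_real (R\<^sup>2) - cnj a * w) \<ge> norm (of_real (R\<^sup>2) :: complex) - norm (cnj a * w)"
      by (rule norm_triangle_ineq2)
    moreover have "norm (of_real (R\<^sup>2) :: complex) = R\<^sup>2" using R by (simp add: norm_power)
    moreover have "norm (cnj a * w) \<le> R * norm w"
      unfolding norm_mult complex_mod_cnj using that by (intro mult_right_mono) (auto simp: S_def)
    moreover have "R * (R - norm w) = R\<^sup>2 - R * norm w" by (simp add: power2_eq_square algebra_simps)
    ultimately show ?thesis by linarith
  qed
  have bnz: "of_real (R\<^sup>2) - cnj a * w \<noteq> 0" if "a \<in> S" "w \<in> ball 0 R" for a w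
  proof
    assume "of_real (R\<^sup>2) - cnj a * w = 0"
    then have "norm (of_real (R\<^sup>2) - cnj a * w) = 0" by simp
    moreover have "R * (R - norm w) > 0" using that R by simp
    ultimately show False using bnd[OF that(1), of w] by linarith
  qed
  define U where "U = {w \<in> ball 0 R. f w \<noteq> 0}"
  have "U = ball 0 R \<inter> f -` (- {0})" by (auto simp: U_def)
  then have U: "open U"
    using continuous_open_preimage[OF holomorphic_on_imp_continuous_on[OF hol], of "- {0}"]
    by (auto simp: open_Int)
  have zU: "z \<in> U" using z fz R by (auto simp: U_def)
  have log_deriv: "deriv f w / f w = deriv g w + (\<Sum>a\<in>S. 1 / (w - a)) + (\<Sum>a\<in>S. cnj a / (of_real (R\<^sup>2) - cnj a * w))"
    if w: "w \<in> U" for w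
  proof -
    have wb: "w \<in> ball 0 R" and fw: "f w \<noteq> 0" using w by (auto simp: U_def)
    have wa: "w - a \<noteq> 0" if "a \<in> S" for a using that fw by (auto simp: S_def)
    let ?P1 = "\<Sum>a\<in>S. (- cnj a / of_real R) / ((of_real (R\<^sup>2) - cnj a * w) / of_real R)"
    define P where "P = (\<lambda>z. \<Prod>a\<in>S. (of_real (R\<^sup>2) - cnj a * z) / of_real R)"
    define Q where "Q = (\<lambda>z. \<Prod>a\<in>S. z - a)"
    have Pw: "P w \<noteq> 0" using bnz[OF _ wb] R fin by (auto simp: P_def)
    have P': "(P has_field_derivative P w * ?P1) (at w)"
      unfolding P_def using bnz[OF _ wb] R
      by (intro has_field_derivative_prod') (auto intro!: derivative_eq_intros)
    have Q': "(Q has_field_derivative Q w * (\<Sum>a\<in>S. 1 / (w - a))) (at w)"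
      unfolding Q_def using wa by (intro has_field_derivative_prod') (auto intro!: derivative_eq_intros)
    have f': "(f has_field_derivative deriv f w) (at w)" using holomorphic_derivI[OF hol, of w] by simp
    have g': "(g has_field_derivative deriv g w) (at w)" using holomorphic_derivI[OF holg _ wb] by simp
    have "((\<lambda>z. f z * P z) has_field_derivative
        deriv f w * P w + (P w * ?P1) * f w) (at w)"
      by (intro DERIV_mult f' P')
    moreover have "((\<lambda>z. f z * P z) has_field_derivative
        (exp (g w) * deriv g w) * Q w + (Q w * (\<Sum>a\<in>S. 1 / (w - a))) * exp (g w)) (at w)"
    proof (rule DERIV_cong_ev[THEN iffD1, OF refl _ refl])
      show "((\<lambda>z. exp (g z) * Q z) has_field_derivative
        (exp (g w) * deriv g w) * Q w + (Q w * (\<Sum>a\<in>S. 1 / (w - a))) * exp (g w)) (at w)"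
        by (intro DERIV_mult Q' DERIV_chain2[OF DERIV_exp g'])
      show "\<forall>\<^sub>F x in nhds w. exp (g x) * Q x = f x * P x"
        using eventually_nhds_in_open[OF open_ball wb]
        by eventually_elim (use eq in \<open>simp add: P_def Q_def\<close>)
    qed
    ultimately have "deriv f w * P w + (P w * ?P1) * f w
       = (exp (g w) * deriv g w) * Q w + (Q w * (\<Sum>a\<in>S. 1 / (w - a))) * exp (g w)"
      by (rule DERIV_unique)
    also have "\<dots> = (exp (g w) * Q w) * (deriv g w + (\<Sum>a\<in>S. 1 / (w - a)))" by (simp add: algebra_simps)
    also have "exp (g w) * Q w = f w * P w" using eq[OF wb] by (simp add: P_def Q_def)
    also have "?P1 = - (\<Sum>a\<in>S. cnj a / (of_real (R\<^sup>2) - cnj a * w))"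
      using R by (simp add: sum_negf)
    finally have "P w * (deriv f w - f w * (\<Sum>a\<in>S. cnj a / (of_real (R\<^sup>2) - cnj a * w)))
        = P w * (f w * (deriv g w + (\<Sum>a\<in>S. 1 / (w - a))))" by (simp add: algebra_simps)
    then have "deriv f w - f w * (\<Sum>a\<in>S. cnj a / (of_real (R\<^sup>2) - cnj a * w)) = f w * (deriv g w + (\<Sum>a\<in>S. 1 / (w - a)))"
      using Pw by simp
    then show ?thesis using fw by (simp add: field_simps)
  qed
  have "deriv (\<lambda>w. deriv f w / f w) z = (deriv ^^ 2) g z - (\<Sum>a\<in>S. 1 / (z - a)\<^sup>2) + (\<Sum>a\<in>S. (cnj a)\<^sup>2 / (of_real (R\<^sup>2) - cnj a * z)\<^sup>2)"
  proof (rule DERIV_imp_deriv, rule DERIV_cong_ev[THEN iffD1, OF refl _ refl])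
    show "\<forall>\<^sub>F w in nhds z. deriv g w + (\<Sum>a\<in>S. 1 / (w - a)) + (\<Sum>a\<in>S. cnj a / (of_real (R\<^sup>2) - cnj a * w)) = deriv f w / f w"
      using eventually_nhds_in_open[OF U zU] by eventually_elim (simp add: log_deriv)
    have zb: "z \<in> ball 0 R" using zU by (simp add: U_def)
    have 1: "(deriv g has_field_derivative (deriv ^^ 2) g z) (at z)"
      using holomorphic_derivI[OF holomorphic_deriv[OF holg open_ball] open_ball zb] by (simp add: numeral_2_eq_2)
    have 2: "((\<lambda>w. \<Sum>a\<in>S. 1 / (w - a)) has_field_derivative (\<Sum>a\<in>S. - (1 / (z - a)\<^sup>2))) (at z)"
      using fz by (intro DERIV_sum) (auto intro!: derivative_eq_intros simp: S_def power2_eq_square)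
    have 3: "((\<lambda>w. \<Sum>a\<in>S. cnj a / (of_real (R\<^sup>2) - cnj a * w)) has_field_derivative (\<Sum>a\<in>S. (cnj a)\<^sup>2 / (of_real (R\<^sup>2) - cnj a * z)\<^sup>2)) (at z)"
      using bnz[OF _ zb] by (intro DERIV_sum) (auto intro!: derivative_eq_intros simp: power2_eq_square)
    show "((\<lambda>w. deriv g w + (\<Sum>a\<in>S. 1 / (w - a)) + (\<Sum>a\<in>S. cnj a / (of_real (R\<^sup>2) - cnj a * w))) has_field_derivative
       (deriv ^^ 2) g z - (\<Sum>a\<in>S. 1 / (z - a)\<^sup>2) + (\<Sum>a\<in>S. (cnj a)\<^sup>2 / (of_real (R\<^sup>2) - cnj a * z)\<^sup>2)) (at z)"
      using DERIV_add[OF DERIV_add[OF 1 2] 3] by (simp add: sum_negf)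
  qed
  then have "norm (deriv (\<lambda>w. deriv f w / f w) z + (\<Sum>a\<in>S. 1 / (z - a)\<^sup>2))
     = norm ((deriv ^^ 2) g z + (\<Sum>a\<in>S. (cnj a)\<^sup>2 / (of_real (R\<^sup>2) - cnj a * z)\<^sup>2))" by simp
  also have "\<dots> \<le> 96 * D / R\<^sup>2 + (\<Sum>a\<in>S. 2 / R\<^sup>2)"
  proof (intro order_trans[OF norm_triangle_ineq] add_mono sum_norm_le)
    show "norm ((deriv ^^ 2) g z) \<le> 96 * D / R\<^sup>2"
      by (rule Borel_Caratheodory_deriv2[OF holg R D z])
    fix a assume a: "a \<in> S"
    have "R * (3 / 4 * R) \<le> R * (R - norm z)" using z R by (intro mult_left_mono) auto
    then have le: "R * (3 / 4 * R) \<le> norm (of_real (R\<^sup>2) - cnj a * z)" using bnd[OF a, of z] by linarith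
    have "norm ((cnj a)\<^sup>2 / (of_real (R\<^sup>2) - cnj a * z)\<^sup>2) = (norm a / norm (of_real (R\<^sup>2) - cnj a * z))\<^sup>2"
      by (simp add: norm_divide norm_power power_divide)
    also have "\<dots> \<le> (R / (R * (3 / 4 * R)))\<^sup>2"
      using R a le by (intro power_mono divide_mono) (auto simp: S_def)
    also have "\<dots> = 16 / 9 / R\<^sup>2" using R by (simp add: field_simps power2_eq_square)
    also have "\<dots> \<le> 2 / R\<^sup>2" by (intro divide_right_mono) auto
    finally show "norm ((cnj a)\<^sup>2 / (of_real (R\<^sup>2) - cnj a * z)\<^sup>2) \<le> 2 / R\<^sup>2" .
  qed
  also have "\<dots> = (96 * (A - ln (norm (f 0)) + 1) + 2 * real (card S)) / R\<^sup>2"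
    by (simp add: D_def add_divide_distrib)
  finally show ?thesis .
qed

text \<open>
  For a function of order less than 2 this is Hadamard's factorisation after two logarithmic differentiations;
  it is obtained as the limit of the estimate on discs, the sum being taken along growing discs.
\<close>

lemma log_deriv_deriv_sum_zeros:
  fixes f :: "complex \<Rightarrow> complex" and \<mu> :: "real \<Rightarrow> real"
  assumes hol: "f holomorphic_on UNIV" and f0: "f 0 \<noteq> 0"
      and simple: "\<And>a. f a = 0 \<Longrightarrow> deriv f a \<noteq> 0"
      and bound: "\<And>z. norm (f z) \<le> exp (\<mu> (norm z))"
      and growth: "((\<lambda>R. \<mu> R / R\<^sup>2) \<longlongrightarrow> 0) at_top"
      and fz: "f z \<noteq> 0"
  shows "((\<lambda>R. \<Sum>a\<in>{a \<in> ball 0 R. f a = 0}. 1 / (z - a)\<^sup>2) \<longlongrightarrow> - deriv (\<lambda>w. deriv f w / f w) z) at_top"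
proof -
  define c where "c = ln (norm (f 0))"
  let ?B = "\<lambda>R. 96 * (\<mu> R / R\<^sup>2) + (96 - 96 * c) / R\<^sup>2 + 2 / ln 2 * (4 * (\<mu> (2 * R) / (2 * R)\<^sup>2) - c / R\<^sup>2)"
  let ?S = "\<lambda>R. {a \<in> ball 0 R. f a = 0}"
  have inv: "((\<lambda>R::real. k / R\<^sup>2) \<longlongrightarrow> 0) at_top" for k
    by (rule real_tendsto_divide_at_top[OF tendsto_const]) (simp add: filterlim_pow_at_top filterlim_ident)
  have at2: "filterlim (\<lambda>R::real. 2 * R) at_top at_top"
    by (rule filterlim_tendsto_pos_mult_at_top[OF tendsto_const _ filterlim_ident]) simp
  have g2: "((\<lambda>R. \<mu> (2 * R) / (2 * R)\<^sup>2) \<longlongrightarrow> 0) at_top"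
    by (rule filterlim_compose[OF growth at2])
  have "((\<lambda>R. ?B R) \<longlongrightarrow>
      96 * 0 + 0 + 2 / ln 2 * (4 * 0 - 0)) at_top"
    by (intro tendsto_intros growth inv g2) auto
  then have lim: "((\<lambda>R. ?B R) \<longlongrightarrow> 0) at_top"
    by simp
  have "((\<lambda>R. deriv (\<lambda>w. deriv f w / f w) z + (\<Sum>a\<in>?S R. 1 / (z - a)\<^sup>2)) \<longlongrightarrow> 0) at_top"
  proof (rule Lim_null_comparison[OF _ lim])
    show "\<forall>\<^sub>F R in at_top. norm (deriv (\<lambda>w. deriv f w / f w) z + (\<Sum>a\<in>?S R. 1 / (z - a)\<^sup>2))
       \<le> ?B R"
      using eventually_gt_at_top[of 0] eventually_ge_at_top[of "4 * norm z"]
    proof eventually_elim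
      case (elim R)
      have 1: "norm (deriv (\<lambda>w. deriv f w / f w) z + (\<Sum>a\<in>?S R. 1 / (z - a)\<^sup>2))
         \<le> (96 * (\<mu> R - ln (norm (f 0)) + 1) + 2 * real (card (?S R))) / R\<^sup>2"
        using elim bound by (intro log_deriv_sum_zeros_bound[OF hol f0 simple _ _ _ fz]) auto
      have "real (card (?S R)) * ln 2 \<le> \<mu> (2 * R) - c"
        unfolding c_def using elim bound by (intro Jensen_zero_count(2)[OF hol f0 simple]) (metis)+
      then have "real (card (?S R)) \<le> (\<mu> (2 * R) - c) / ln 2" by (simp add: field_simps)
      then have "(96 * (\<mu> R - c + 1) + 2 * real (card (?S R))) / R\<^sup>2 \<le> (96 * (\<mu> R - c + 1) + 2 * ((\<mu> (2 * R) - c) / ln 2)) / R\<^sup>2"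
        by (intro divide_right_mono add_left_mono mult_left_mono) auto
      also have "\<dots> = ?B R"
        using elim by (simp add: field_simps power2_eq_square)
      finally show ?case using 1 by (simp add: c_def)
    qed
  qed
  from tendsto_diff[OF this tendsto_const[of "deriv (\<lambda>w. deriv f w / f w) z"]] show ?thesis by simp
qed

lemma Airy_Ai_log_deriv_sum_zeros:
  assumes "x \<ge> 0"
  shows "((\<lambda>R. \<Sum>a\<in>{a \<in> ball 0 R. Airy_Ai a = 0}. 1 / (of_real x - a)\<^sup>2) \<longlongrightarrow> of_real ((neg_log_deriv x)\<^sup>2 - x)) at_top"
proof -
  obtain K where K: "\<And>z. norm (Airy_Ai z) \<le> exp (K + norm z * sqrt (6 * norm z))"
    using Airy_Ai_growth by blast
  have fx: "Airy_Ai (of_real x) \<noteq> 0"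
    using Ai_real_neq_0[OF assms] by (simp add: Airy_Ai_of_real)
  have "((\<lambda>R::real. (K + R * sqrt (6 * R)) / R\<^sup>2) \<longlongrightarrow> 0) at_top"
    by real_asymp
  then have "((\<lambda>R. \<Sum>a\<in>{a \<in> ball 0 R. Airy_Ai a = 0}. 1 / (of_real x - a)\<^sup>2) \<longlongrightarrow>
     - deriv (\<lambda>w. deriv Airy_Ai w / Airy_Ai w) (of_real x)) at_top"
    by (intro log_deriv_deriv_sum_zeros[where \<mu> = "\<lambda>R. K + R * sqrt (6 * R)"] holomorphic_Airy_Ai
         Airy_Ai_0_neq_0 Airy_Ai_zero_simple K fx)
  also have "deriv (\<lambda>w. deriv Airy_Ai w / Airy_Ai w) (of_real x) =
     (of_real x * Airy_Ai (of_real x) * Airy_Ai (of_real x) - deriv Airy_Ai (of_real x) * deriv Airy_Ai (of_real x)) / (Airy_Ai (of_real x) * Airy_Ai (of_real x))"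
    using DERIV_Airy_Ai[of "\<lambda>x. x" 1 "of_real x" UNIV] DERIV_Airy_Ai_deriv[of "\<lambda>x. x" 1 "of_real x" UNIV] fx
    by (intro DERIV_imp_deriv DERIV_divide) simp_all
  also have "\<dots> = of_real (x - (neg_log_deriv x)\<^sup>2)"
    using Ai_real_neq_0[OF assms]
    by (simp add: Airy_Ai_of_real deriv_Airy_Ai_of_real neg_log_deriv_def power2_eq_square diff_divide_distrib)
  finally show ?thesis by simp
qed

text \<open>
  For nonnegative terms the limit along any exhaustion by finite sets is the sum of the series; here the
  enumeration of the zeros is arbitrary, whereas the limit is taken over discs.
\<close>

lemma sums_if_exhaustion_limit:
  fixes f :: "nat \<Rightarrow> real"
  assumes f: "\<And>n. f n \<ge> 0" and fin: "\<And>R::real. finite (S R)"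
      and mono: "\<And>R R'. R \<le> R' \<Longrightarrow> S R \<subseteq> S R'" and ex: "\<And>n. \<exists>R. n \<in> S R"
      and lim: "((\<lambda>R. sum f (S R)) \<longlongrightarrow> L) at_top"
  shows "f sums L"
proof -
  have le: "sum f (S R) \<le> L" for R
    by (rule tendsto_lowerbound[OF lim])
       (auto intro!: eventually_mono[OF eventually_ge_at_top[of R]] sum_mono2 f fin mono)
  have le': "sum f F \<le> L" if F: "finite F" for F
  proof -
    have "\<exists>R. F \<subseteq> S R" using F
    proof (induction F rule: finite_induct)
      case (insert n F)
      then obtain R R' where "F \<subseteq> S R" "n \<in> S R'" using ex by blast
      then have "insert n F \<subseteq> S (max R R')" using mono[of R "max R R'"] mono[of R' "max R R'"] by auto
      then show ?case by blast
    qed auto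
    then obtain R where "F \<subseteq> S R" by blast
    then have "sum f F \<le> sum f (S R)" by (intro sum_mono2 fin f)
    then show ?thesis using le[of R] by linarith
  qed
  have sm: "summable f"
    by (rule summableI_nonneg_bounded[where x = L]) (use f le' in auto)
  have "suminf f \<le> L" by (rule suminf_le_const[OF sm]) (use le' in auto)
  moreover have "L \<le> suminf f"
    by (rule tendsto_upperbound[OF lim always_eventually]) (simp_all add: sum_le_suminf[OF sm] fin f)
  ultimately show ?thesis using summable_sums[OF sm] by simp
qed

section \<open>The formal solution of the Riccati equation\<close>

text \<open>
  The series \<open>S\<close> in \<open>t = x powr (-3/2)\<close> with \<open>Ai(x) ~ exp (- 2/3 x powr (3/2)) x powr (-1/4) S / (2 sqrt \<pi>)\<close>.
\<close>

definition Airy_S :: "real fps" where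
  "Airy_S = Abs_fps (\<lambda>k. (- 3 / 2) ^ k * (Gamma (of_nat k + 1/6) * Gamma (of_nat k + 5/6) / (2 * pi * 2 ^ k * fact k)))"

text \<open>
  The logarithmic derivative \<open>S' / S\<close>.
\<close>

definition Airy_W :: "real fps" where "Airy_W = fps_deriv Airy_S * inverse Airy_S"

text \<open>
  Formally, \<open>u = sqrt x B(t)\<close> with \<open>t = x powr (-3/2)\<close>: the three terms come from differentiating the
  exponential, the power \<open>x powr (-1/4)\<close> and \<open>S\<close>.
\<close>

definition riccati_fps :: "real fps" where
  "riccati_fps = 1 + fps_const (1/4) * fps_X + fps_const (3/2) * fps_X ^ 2 * Airy_W"

text \<open>
  Since \<open>u' = u^2 - x = x (B(t)^2 - 1)\<close>, these are the coefficients of \<open>x powr (1 - 3k/2)\<close> in the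
  expansion of \<open>u'\<close>.
\<close>

definition asymp_coeff :: "nat \<Rightarrow> real" where "asymp_coeff k = fps_nth (riccati_fps ^ 2 - 1) k"

lemma Airy_S_nth_0: "fps_nth Airy_S 0 = 1"
proof -
  have "of_real (Gamma (1/6) * Gamma (5/6)) = (of_real (2 * pi) :: complex)"
    using Gamma_1_6_5_6 by (simp flip: Gamma_complex_of_real)
  then have "Gamma (1/6) * Gamma (5/6) = 2 * pi" by (simp only: of_real_eq_iff)
  then show ?thesis by (simp add: Airy_S_def)
qed

lemma Airy_S_nth_Suc:
  "real (Suc k) * fps_nth Airy_S (Suc k) = - (3/4) * ((real k)\<^sup>2 + real k + 5/36) * fps_nth Airy_S k"
proof -
  have nonpos: "real k + a \<notin> \<int>\<^sub>\<le>\<^sub>0" if "a > 0" for a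
    using that nonpos_Ints_nonpos[of "real k + a"] by auto
  have G: "Gamma (real (Suc k) + a) = (real k + a) * Gamma (real k + a)" if "a > 0" for a
    using Gamma_plus1[OF nonpos[OF that]] by (simp add: add_ac)
  have f: "(fact (Suc k) :: real) = real (Suc k) * fact k" by simp
  have nz: "real (Suc k) \<noteq> 0" "(fact k :: real) \<noteq> 0" by (simp_all del: of_nat_Suc)
  have "real (Suc k) * fps_nth Airy_S (Suc k) = real (Suc k) * ((- 3 / 2) ^ Suc k * ((real k + 1/6) * Gamma (real k + 1/6) * ((real k + 5/6) * Gamma (real k + 5/6)) /
      (2 * pi * 2 ^ Suc k * (real (Suc k) * fact k))))"
    unfolding Airy_S_def fps_nth_Abs_fps f by (simp only: G zero_less_divide_iff zero_less_numeral zero_less_one simp_thms)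
  also have "\<dots> = - (3/4) * ((real k + 1/6) * (real k + 5/6)) * fps_nth Airy_S k"
    using nz by (simp add: Airy_S_def divide_simps del: of_nat_Suc)
  also have "(real k + 1/6) * (real k + 5/6) = (real k)\<^sup>2 + real k + 5/36"
    by (simp add: power2_eq_square field_simps)
  finally show ?thesis .
qed

text \<open>
  With \<open>\<theta> = t d/dt\<close> the recurrence of the coefficients says \<open>S' = -3/4 (\<theta>^2 + \<theta> + 5/36) S\<close>.
\<close>

lemma Airy_S_ode:
  "fps_deriv Airy_S = fps_const (- 3/4) * (fps_X ^ 2 * fps_deriv (fps_deriv Airy_S) + fps_const 2 * fps_X * fps_deriv Airy_S + fps_const (5/36) * Airy_S)"
proof (rule fps_ext)
  fix n
  let ?r = "fps_const (- 3/4) * (fps_X ^ 2 * fps_deriv (fps_deriv Airy_S) + fps_const 2 * fps_X * fps_deriv Airy_S + fps_const (5/36) * Airy_S)"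
  have 1: "fps_nth (fps_X * fps_deriv Airy_S) n = real n * fps_nth Airy_S n"
    by (cases n) auto
  have 2: "fps_nth (fps_X ^ 2 * fps_deriv (fps_deriv Airy_S)) n = real n * (real n - 1) * fps_nth Airy_S n"
  proof (cases "n < 2")
    case True
    then have "n = 0 \<or> n = 1" by auto
    then show ?thesis by (auto simp: fps_X_power_mult_nth)
  next
    case False
    then obtain m where "n = Suc (Suc m)" by (metis add_2_eq_Suc le_Suc_ex not_less)
    then show ?thesis by (simp add: fps_X_power_mult_nth)
  qed
  have "fps_nth ?r n
     = - 3/4 * (fps_nth (fps_X ^ 2 * fps_deriv (fps_deriv Airy_S)) n + 2 * fps_nth (fps_X * fps_deriv Airy_S) n + 5/36 * fps_nth Airy_S n)"
    by (simp only: fps_mult_left_const_nth fps_add_nth mult.assoc)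
  also have "\<dots> = - (3/4) * ((real n)\<^sup>2 + real n + 5/36) * fps_nth Airy_S n"
    unfolding 1 2 by (simp add: field_simps power2_eq_square)
  also have "\<dots> = fps_nth (fps_deriv Airy_S) n" using Airy_S_nth_Suc[of n] by simp
  finally show "fps_nth (fps_deriv Airy_S) n = fps_nth ?r n" ..
qed

lemma Airy_W_mult_S: "Airy_W * Airy_S = fps_deriv Airy_S"
proof -
  have "inverse Airy_S * Airy_S = 1" by (intro inverse_mult_eq_1) (simp add: Airy_S_nth_0)
  then show ?thesis by (simp add: Airy_W_def mult.assoc)
qed

lemma Airy_W_riccati:
  "fps_const 4 * Airy_W + fps_const 3 * (fps_X ^ 2 * (fps_deriv Airy_W + Airy_W ^ 2) + fps_const 2 * fps_X * Airy_W + fps_const (5/36)) = 0"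
proof -
  have S0: "Airy_S \<noteq> 0" using Airy_S_nth_0 by auto
  have d2: "fps_deriv (fps_deriv Airy_S) = (fps_deriv Airy_W + Airy_W ^ 2) * Airy_S"
    unfolding Airy_W_mult_S[symmetric] by (simp add: algebra_simps power2_eq_square)
       (simp add: Airy_W_mult_S[symmetric] algebra_simps)
  have "(fps_const 4 * Airy_W + fps_const 3 * (fps_X ^ 2 * (fps_deriv Airy_W + Airy_W ^ 2) + fps_const 2 * fps_X * Airy_W + fps_const (5/36))) * Airy_S
    = fps_const 4 * fps_deriv Airy_S + fps_const 3 * (fps_X ^ 2 * fps_deriv (fps_deriv Airy_S) + fps_const 2 * fps_X * fps_deriv Airy_S + fps_const (5/36) * Airy_S)"
    unfolding d2 unfolding Airy_W_mult_S[symmetric] by (simp only: algebra_simps)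
  also have "\<dots> = 0"
  proof -
    define Y where "Y = fps_X ^ 2 * fps_deriv (fps_deriv Airy_S) + fps_const 2 * fps_X * fps_deriv Airy_S + fps_const (5/36) * Airy_S"
    have "fps_deriv Airy_S = fps_const (- 3/4) * Y" unfolding Y_def by (rule Airy_S_ode)
    then have "fps_const 4 * fps_deriv Airy_S + fps_const 3 * Y = (fps_const 4 * fps_const (-3/4) + fps_const 3) * Y"
      by (simp only: algebra_simps)
    also have "fps_const (4::real) * fps_const (-3/4) + fps_const 3 = 0" by (simp only: fps_const_mult fps_const_add) simp
    finally show ?thesis by (simp add: Y_def)
  qed
  finally show ?thesis using S0 by (simp only: mult_eq_0_iff simp_thms)
qed

text \<open>
  The Riccati equation \<open>u^2 - x = u'\<close> for \<open>u = sqrt x B(t)\<close>, divided by \<open>x\<close>; the right-hand side uses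
  \<open>dt/dx = -3/2 t / x\<close>.
\<close>

lemma riccati_fps_equation:
  "riccati_fps ^ 2 - 1 = fps_X * (fps_const (1/2) * riccati_fps - fps_const (3/2) * (fps_X * fps_deriv riccati_fps))"
proof -
  have dB: "fps_deriv riccati_fps = fps_const (1/4) + fps_const 3 * fps_X * Airy_W + fps_const (3/2) * fps_X ^ 2 * fps_deriv Airy_W"
  proof -
    have "fps_deriv (fps_X ^ 2 :: real fps) = fps_const 2 * fps_X"
      by (simp add: power2_eq_square)
    then have "fps_deriv riccati_fps = fps_const (1/4) + (fps_const (3/2) * fps_const 2) * fps_X * Airy_W + fps_const (3/2) * fps_X ^ 2 * fps_deriv Airy_W"
      unfolding riccati_fps_def by (simp add: algebra_simps del: fps_const_mult)
    then show ?thesis by simp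
  qed
  \<comment> \<open>All rational constants become integer multiples of one constant, so that only ring reasoning remains.\<close>
  define c where "c = fps_const (1/16 :: real)"
  have c: "fps_const (1/4 :: real) = 4 * c" "fps_const (3/2 :: real) = 24 * c" "fps_const (3::real) = 48 * c"
     "fps_const (1/2 :: real) = 8 * c" "fps_const (2::real) = 32 * c" "fps_const (4::real) = 64 * c" "16 * c = 1"
    unfolding c_def numeral_fps_const by (simp_all only: fps_const_mult) simp_all
  have 3: "fps_const 3 * fps_const (5/36 :: real) = 5 * fps_const (1/12)"
    unfolding numeral_fps_const by (simp only: fps_const_mult) simp
  have 4: "3 * fps_const (1/12 :: real) = 4 * c"
    unfolding c_def numeral_fps_const by (simp only: fps_const_mult) simp
  have ric: "64 * c * Airy_W + 48 * c * (fps_X ^ 2 * (fps_deriv Airy_W + Airy_W ^ 2) + 32 * c * fps_X * Airy_W) + 5 * fps_const (1/12) = 0"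
    using Airy_W_riccati 3 unfolding c by (simp only: algebra_simps)
  have "16 * c * (riccati_fps ^ 2 - 1 - fps_X * (fps_const (1/2) * riccati_fps - fps_const (3/2) * (fps_X * fps_deriv riccati_fps))) = 0"
    unfolding dB unfolding riccati_fps_def c using ric 4 c(7) by algebra
  then show ?thesis using c(7) by simp
qed

lemma riccati_fps_nth_0: "fps_nth riccati_fps 0 = 1" by (simp add: riccati_fps_def)

lemma riccati_fps_nth_1: "fps_nth riccati_fps 1 = 1/4" by (simp add: riccati_fps_def fps_X_power_mult_nth mult.assoc)

lemma riccati_fps_nth_Suc_Suc: "fps_nth riccati_fps (Suc (Suc n)) = 3/2 * fps_nth Airy_W n"
  by (simp add: riccati_fps_def fps_X_power_mult_nth mult.assoc)

lemma asymp_coeff_Suc: "asymp_coeff (Suc k) = (1/2 - 3/2 * real k) * fps_nth riccati_fps k"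
  unfolding asymp_coeff_def riccati_fps_equation by (cases k) (auto simp: algebra_simps)

lemma asymp_coeff_0: "asymp_coeff 0 = 0"
  unfolding asymp_coeff_def riccati_fps_equation by simp

lemma asymp_coeff_1: "asymp_coeff 1 = 1/2" using asymp_coeff_Suc[of 0] by (simp add: riccati_fps_nth_0)

lemma asymp_coeff_2: "asymp_coeff 2 = - 1/4" using asymp_coeff_Suc[of 1] riccati_fps_nth_1 by (simp add: numeral_2_eq_2)

lemma Airy_p_series_eq_S: "fps_nth (1 + Airy_p_series) k = (- \<i>) ^ k * of_real (fps_nth Airy_S k)"
proof (cases "k = 0")
  case True
  then show ?thesis by (simp add: Airy_S_nth_0 Airy_p_series_def)
next
  case False
  have AB: "(- 3 * \<i> / 2) ^ k / (- 2) ^ k = (- \<i>) ^ k * ((- 3/2) ^ k / 2 ^ k)"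
    unfolding power_divide[symmetric] power_mult_distrib[symmetric] by (simp add: mult.commute)
  have *: "(- 3 * \<i> / 2) ^ k * (x / (2 * of_real pi * (- 2) ^ k * y)) = (- \<i>) ^ k * ((- 3/2) ^ k * (x / (2 * of_real pi * 2 ^ k * y)))" for x y
  proof -
    have split: "A * (x / (2 * of_real pi * B * y)) = (A / B) * (x / (2 * of_real pi * y))" for A B :: complex
      by (simp only: divide_inverse inverse_mult_distrib mult_ac)
    show ?thesis unfolding split using AB by (simp only: mult.assoc)
  qed
  have "of_real (fps_nth Airy_S k) = (- 3/2) ^ k * (Gamma (of_nat k + 1/6) * Gamma (of_nat k + 5/6) / (2 * of_real pi * 2 ^ k * fact k) :: complex)"
    by (simp add: Airy_S_def flip: Gamma_complex_of_real)
  then show ?thesis using False * by (simp add: Airy_p_series_def)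
qed

text \<open>
  Differentiating \<open>ln (1 + F)\<close> gives \<open>F' / (1 + F)\<close>, and \<open>1 + F\<close> is \<open>S(- \<i> y)\<close>.
\<close>

lemma Airy_p_conv_W: "of_nat (Suc n) * Airy_p (Suc n) = (- \<i>) ^ Suc n * of_real (fps_nth Airy_W n)"
proof -
  define V where "V = Abs_fps (\<lambda>n. (- \<i>) ^ Suc n * of_real (fps_nth Airy_W n))"
  have a0: "fps_nth Airy_p_series 0 = 0" by (simp add: Airy_p_series_def)
  have V: "V * (1 + Airy_p_series) = fps_deriv Airy_p_series"
  proof (rule fps_ext)
    fix n
    have "fps_nth (V * (1 + Airy_p_series)) n = (\<Sum>j=0..n. (- \<i>) ^ Suc j * of_real (fps_nth Airy_W j) * ((- \<i>) ^ (n - j) * of_real (fps_nth Airy_S (n - j))))"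
      unfolding fps_mult_nth V_def Airy_p_series_eq_S by simp
    also have "\<dots> = (\<Sum>j=0..n. (- \<i>) ^ Suc n * of_real (fps_nth Airy_W j * fps_nth Airy_S (n - j)))"
    proof (rule sum.cong)
      fix j assume "j \<in> {0..n}"
      then have "(- \<i>) ^ Suc j * (- \<i>) ^ (n - j) = (- \<i>) ^ Suc n" by (simp flip: power_add)
      then show "(- \<i>) ^ Suc j * of_real (fps_nth Airy_W j) * ((- \<i>) ^ (n - j) * of_real (fps_nth Airy_S (n - j))) = (- \<i>) ^ Suc n * of_real (fps_nth Airy_W j * fps_nth Airy_S (n - j))"
        by (metis (no_types, lifting) mult.assoc mult.commute of_real_mult)
    qed simp
    also have "\<dots> = (- \<i>) ^ Suc n * of_real (fps_nth (Airy_W * Airy_S) n)"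
      by (simp add: fps_mult_nth sum_distrib_left)
    also have "\<dots> = of_nat (Suc n) * ((- \<i>) ^ Suc n * of_real (fps_nth Airy_S (Suc n)))"
      unfolding Airy_W_mult_S by simp
    also have "\<dots> = fps_nth (fps_deriv Airy_p_series) n"
      unfolding Airy_p_series_eq_S[symmetric] by simp
    finally show "fps_nth (V * (1 + Airy_p_series)) n = fps_nth (fps_deriv Airy_p_series) n" .
  qed
  have "fps_deriv (fps_ln 1 oo Airy_p_series) = (fps_deriv (fps_ln 1) oo Airy_p_series) * fps_deriv Airy_p_series"
    by (rule fps_compose_deriv[OF a0])
  also have "fps_deriv (fps_ln (1::complex)) = inverse (1 + fps_X)" by (simp add: fps_ln_deriv)
  also have "inverse (1 + fps_X) oo Airy_p_series = inverse (1 + Airy_p_series)"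
    by (subst fps_inverse_compose[OF a0]) (auto simp: fps_compose_add_distrib a0 fps_X_fps_compose_startby0)
  also have "inverse (1 + Airy_p_series) * fps_deriv Airy_p_series = V"
  proof -
    have "inverse (1 + Airy_p_series) * (1 + Airy_p_series) = 1"
      by (intro inverse_mult_eq_1) (simp add: a0)
    then show ?thesis unfolding V[symmetric] by (metis mult.assoc mult.commute mult_1_right)
  qed
  finally have "fps_nth (fps_deriv (fps_ln 1 oo Airy_p_series)) n = fps_nth V n" by simp
  then show ?thesis by (simp add: V_def Airy_p_def)
qed

lemma asymp_coeff_even:
  assumes "j \<ge> 1"
  shows "of_real (asymp_coeff (2 * j + 2)) = - ((3 * of_nat j + 1) * (3 * of_nat j) * (- 1) ^ j * Airy_p (2 * j))"
proof -
  obtain m where m: "2 * j = Suc m" using assms by (cases "2 * j") auto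
  have "(- \<i>) ^ Suc m = (- 1) ^ j" unfolding m[symmetric] power_mult by simp
  then have "of_nat (2 * j) * Airy_p (2 * j) = (- 1) ^ j * of_real (fps_nth Airy_W m)"
    using Airy_p_conv_W[of m] m by simp
  then have W: "of_real (fps_nth Airy_W m) = (- 1) ^ j * (of_nat (2 * j) * Airy_p (2 * j))"
    by (simp flip: power_add mult_2 add: mult.assoc[symmetric])
  have "asymp_coeff (Suc (Suc (Suc m))) = (1/2 - 3/2 * real (Suc (Suc m))) * (3/2 * fps_nth Airy_W m)"
    unfolding asymp_coeff_Suc riccati_fps_nth_Suc_Suc ..
  also have "1/2 - 3/2 * real (Suc (Suc m)) = - (3 * real j + 1)"
    using m by (simp flip: m) (simp add: field_simps)
  also have "Suc (Suc (Suc m)) = 2 * j + 2" using m by simp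
  finally have "complex_of_real (asymp_coeff (2 * j + 2)) = of_real (- (3 * real j + 1) * (3/2 * fps_nth Airy_W m))"
    by (rule arg_cong)
  then have eq: "complex_of_real (asymp_coeff (2 * j + 2)) = - (3 * of_nat j + 1) * (3/2 * of_real (fps_nth Airy_W m))"
    by simp
  show ?thesis unfolding eq W by (simp add: algebra_simps)
qed

section \<open>Asymptotic expansion on the positive axis\<close>

text \<open>
  If \<open>e\<close> exceeded \<open>c = r x\<close> at some point, then \<open>e - c\<close> would satisfy \<open>(e - c)' \<ge> a (e - c)\<close> from there
  on and grow at least linearly, contrary to its boundedness. Comparison uses the integrating factor
  \<open>exp (- A)\<close> with \<open>A\<close> an antiderivative of \<open>a\<close>.
\<close>

lemma unstable_ode_bound_upper:
  fixes e a \<rho> r :: "real \<Rightarrow> real"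
  assumes deriv: "\<And>x. x \<ge> x1 \<Longrightarrow> (e has_real_derivative a x * e x + \<rho> x) (at x)"
      and cont: "continuous_on {x1..} a"
      and a1: "\<And>x. x \<ge> x1 \<Longrightarrow> a x \<ge> 1"
      and rho: "\<And>x. x \<ge> x1 \<Longrightarrow> \<bar>\<rho> x\<bar> \<le> r x"
      and anti: "\<And>x y. x1 \<le> x \<Longrightarrow> x \<le> y \<Longrightarrow> r y \<le> r x"
      and bounded: "\<And>x. x \<ge> x1 \<Longrightarrow> e x \<le> M"
      and x: "x \<ge> x1"
  shows "e x \<le> r x"
proof (rule ccontr)
  assume "\<not> e x \<le> r x"
  define c where "c = r x"
  define d where "d = e x - c"
  have d: "d > 0" using \<open>\<not> e x \<le> r x\<close> by (simp add: d_def c_def)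
  have c0: "c \<ge> 0" using rho[OF x] by (simp add: c_def)
  have grow: "e y \<ge> c + d * (1 + (y - x))" if y: "y > x" for y
  proof -
    have cont': "continuous_on {x..y} a" using x by (intro continuous_on_subset[OF cont]) auto
    define A where "A = (\<lambda>s. integral {x..s} a)"
    have A': "(A has_real_derivative a s) (at s)" if s: "x < s" "s < y" for s
    proof -
      have "(A has_real_derivative a s) (at s within {x..y})"
        unfolding A_def using s by (intro integral_has_real_derivative[OF cont']) auto
      then show ?thesis using s by (simp add: at_within_Icc_at)
    qed
    have contA: "continuous_on {x..y} A"
      unfolding A_def by (intro indefinite_integral_continuous_1 integrable_continuous_real cont')
    have Ax: "A x = 0" by (simp add: A_def)
    have Ay: "A y \<ge> y - x"
    proof -
      have "integral {x..y} (\<lambda>_. 1) \<le> integral {x..y} a"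
        using x a1 by (intro integral_le integrable_continuous_real cont') auto
      then show ?thesis using y by (simp add: A_def)
    qed
    define h where "h = (\<lambda>s. (e s - c) * exp (- A s))"
    have conte: "continuous_on {x..y} e"
      using x by (intro continuous_at_imp_continuous_on ballI DERIV_isCont[OF deriv]) auto
    have "h x \<le> h y"
    proof (rule DERIV_nonneg_imp_increasing_open[where f = h and a = x and b = y])
      show "x \<le> y" using y by simp
      show "continuous_on {x..y} h" unfolding h_def by (intro continuous_intros conte contA)
      fix s assume s: "x < s" "s < y"
      have sx: "s \<ge> x1" using s x by simp
      have "(h has_real_derivative (a s * e s + \<rho> s) * exp (- A s) + (exp (- A s) * (- a s)) * (e s - c)) (at s)"
        unfolding h_def
        by (rule derivative_eq_intros deriv[OF sx] A'[OF s] refl)+ simp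
      moreover have "(a s * e s + \<rho> s) * exp (- A s) + (exp (- A s) * (- a s)) * (e s - c) = (a s * c + \<rho> s) * exp (- A s)"
        by (simp add: algebra_simps)
      moreover have "a s * c + \<rho> s \<ge> 0"
      proof -
        have "\<bar>\<rho> s\<bar> \<le> c" using rho[OF sx] anti[OF x, of s] s by (simp add: c_def)
        moreover have "1 * c \<le> a s * c" using a1[OF sx] c0 by (intro mult_right_mono) auto
        ultimately show ?thesis by linarith
      qed
      ultimately show "\<exists>z. (h has_real_derivative z) (at s) \<and> 0 \<le> z"
        by (metis mult_nonneg_nonneg exp_ge_zero)
    qed
    then have "d \<le> (e y - c) * exp (- A y)" by (simp add: h_def d_def Ax)
    then have "d * exp (A y) \<le> e y - c" by (simp add: exp_minus field_simps)
    moreover have "d * (1 + (y - x)) \<le> d * exp (A y)"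
      using d Ay exp_ge_add_one_self[of "A y"] by (intro mult_left_mono) linarith+
    ultimately show ?thesis by linarith
  qed
  define y where "y = x + 1 + \<bar>M\<bar> / d"
  have "y > x" using d by (auto simp: y_def intro: add_pos_nonneg)
  then have "e y \<ge> c + d * (1 + (y - x))" by (rule grow)
  also have "d * (1 + (y - x)) = 2 * d + \<bar>M\<bar>" using d by (simp add: y_def field_simps)
  finally show False using bounded[of y] \<open>y > x\<close> x c0 d by linarith
qed

lemma unstable_ode_bound:
  fixes e a \<rho> r :: "real \<Rightarrow> real"
  assumes deriv: "\<And>x. x \<ge> x1 \<Longrightarrow> (e has_real_derivative a x * e x + \<rho> x) (at x)"
      and cont: "continuous_on {x1..} a"
      and a1: "\<And>x. x \<ge> x1 \<Longrightarrow> a x \<ge> 1"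
      and rho: "\<And>x. x \<ge> x1 \<Longrightarrow> \<bar>\<rho> x\<bar> \<le> r x"
      and anti: "\<And>x y. x1 \<le> x \<Longrightarrow> x \<le> y \<Longrightarrow> r y \<le> r x"
      and bounded: "\<And>x. x \<ge> x1 \<Longrightarrow> \<bar>e x\<bar> \<le> M"
      and x: "x \<ge> x1"
  shows "\<bar>e x\<bar> \<le> r x"
proof -
  have "e x \<le> r x"
    by (rule unstable_ode_bound_upper[OF deriv cont a1 rho anti _ x]) (use bounded in \<open>force simp: abs_le_iff\<close>)+
  moreover have "- e x \<le> r x"
  proof (rule unstable_ode_bound_upper[OF _ cont a1 _ anti _ x, where \<rho> = "\<lambda>x. - \<rho> x"])
    show "((\<lambda>x. - e x) has_real_derivative a x * (- e x) + - \<rho> x) (at x)" if "x \<ge> x1" for x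
      using DERIV_minus[OF deriv[OF that]] by simp
    show "\<bar>- \<rho> x\<bar> \<le> r x" if "x \<ge> x1" for x using rho[OF that] by simp
    show "- e x \<le> M" if "x \<ge> x1" for x using bounded[OF that] by simp
  qed
  ultimately show ?thesis by simp
qed

lemma poly_bound_low_coeffs:
  fixes Q :: "real poly"
  assumes "\<And>k. k < N \<Longrightarrow> coeff Q k = 0"
  obtains C where "C \<ge> 0" "\<And>t. 0 \<le> t \<Longrightarrow> t \<le> 1 \<Longrightarrow> \<bar>poly Q t\<bar> \<le> C * t ^ N"
proof -
  obtain Q' where Q': "Q = monom 1 N * Q'"
    using assms monom_1_dvd_iff'[of N Q] by (auto elim: dvdE)
  have "compact (poly Q' ` {0..1})" by (intro compact_continuous_image continuous_intros) auto
  then obtain C where "\<forall>t\<in>{0..1}. \<bar>poly Q' t\<bar> \<le> C"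
    by (auto dest!: compact_imp_bounded simp: bounded_iff)
  then have C: "\<bar>poly Q' t\<bar> \<le> C" if "0 \<le> t" "t \<le> 1" for t using that by auto
  show ?thesis
  proof (rule that[of "max C 0"])
    fix t :: real assume t: "0 \<le> t" "t \<le> 1"
    have "\<bar>poly Q t\<bar> = \<bar>poly Q' t\<bar> * t ^ N" using t by (simp add: Q' poly_monom abs_mult)
    also have "\<dots> \<le> max C 0 * t ^ N" using C[OF t] t by (intro mult_right_mono) auto
    finally show "\<bar>poly Q t\<bar> \<le> max C 0 * t ^ N" .
  qed auto
qed

lemma fps_mult_low_zero:
  fixes F H :: "'a :: comm_ring_1 fps"
  assumes "\<And>k. k < N \<Longrightarrow> fps_nth F k = 0" "k < N"
  shows "fps_nth (F * H) k = 0"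
  unfolding fps_mult_nth using assms by (intro sum.neutral) auto

definition riccati_poly :: "nat \<Rightarrow> real poly" where
  "riccati_poly N = (\<Sum>k<N. monom (fps_nth riccati_fps k) k)"

lemma coeff_sum_monom: "coeff (\<Sum>k<N. monom (c k) k) k = (if k < N then c k else 0)"
  by (simp add: coeff_sum)

text \<open>
  Replacing \<open>B\<close> by a truncation changes neither side of the two identities in degrees below \<open>N\<close>, because
  the error is divisible by \<open>t^N\<close> and \<open>t d/dt\<close> preserves this.
\<close>

lemma riccati_poly_low:
  assumes "k < N"
  defines "P \<equiv> riccati_poly N"
  shows "coeff (P ^ 2 - 1 - [:0, 1:] * (smult (1/2) P - smult (3/2) ([:0, 1:] * pderiv P))) k = 0"
    and "coeff (P ^ 2 - 1 - (\<Sum>k<N. monom (asymp_coeff k) k)) k = 0"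
proof -
  define F where "F = fps_of_poly P"
  let ?Q = "P ^ 2 - 1 - [:0, 1:] * (smult (1/2) P - smult (3/2) ([:0, 1:] * pderiv P))"
  let ?F = "F ^ 2 - 1 - fps_X * (fps_const (1/2) * F - fps_const (3/2) * (fps_X * fps_deriv F))"
  define E where "E = F - riccati_fps"
  have E: "fps_nth E k = 0" if "k < N" for k
    using that by (simp add: E_def F_def P_def riccati_poly_def coeff_sum_monom)
  have F: "F = riccati_fps + E" by (simp add: E_def)
  have sq: "F ^ 2 - 1 = (riccati_fps ^ 2 - 1) + E * (F + riccati_fps)"
    unfolding F by (simp add: algebra_simps power2_eq_square)
  have EF: "fps_nth (E * H) k = 0" for H by (rule fps_mult_low_zero[OF E assms(1)])
  have "fps_of_poly ?Q =
    ?F"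
    unfolding F_def by (simp only: fps_of_poly_diff fps_of_poly_mult fps_of_poly_power
       fps_of_poly_smult fps_of_poly_pderiv fps_of_poly_fps_X fps_of_poly_1)
  then have "coeff ?Q k =
    fps_nth ?F k"
    by (metis fps_of_poly_nth)
  also have "?F =
     E * (F + riccati_fps) - E * (fps_const (1/2) * fps_X) + fps_const (3/2) * (fps_X * (fps_X * fps_deriv E))"
    unfolding sq riccati_fps_equation unfolding F by (simp add: algebra_simps)
  also have "fps_nth \<dots> k = 3/2 * fps_nth (fps_X * (fps_X * fps_deriv E)) k"
    by (simp only: fps_sub_nth fps_add_nth EF fps_mult_left_const_nth diff_zero diff_self add_0)
  also have "fps_nth (fps_X * (fps_X * fps_deriv E)) k = 0"
    using E assms(1) by (cases k) (auto simp: fps_X_mult_nth)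
  finally show "coeff ?Q k = 0" by simp
  have "fps_of_poly (P ^ 2 - 1) = F ^ 2 - 1"
    unfolding F_def by (simp only: fps_of_poly_diff fps_of_poly_power fps_of_poly_1)
  then have "coeff (P ^ 2 - 1) k = fps_nth (F ^ 2 - 1) k" by (metis fps_of_poly_nth)
  then have "coeff (P ^ 2 - 1 - (\<Sum>k<N. monom (asymp_coeff k) k)) k = fps_nth (F ^ 2 - 1) k - asymp_coeff k"
    using assms(1) by (simp only: coeff_diff coeff_sum_monom if_True)
  also have "\<dots> = 0" unfolding sq by (simp add: EF asymp_coeff_def)
  finally show "coeff (P ^ 2 - 1 - (\<Sum>k<N. monom (asymp_coeff k) k)) k = 0" .
qed

text \<open>
  Let \<open>\<phi>\<close> be the truncated formal solution. Subtracting its approximate Riccati equation from that of \<open>u\<close>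
  gives \<open>e' = (u + \<phi>) e + \<rho>\<close> for \<open>e = u - \<phi>\<close>, and \<open>u + \<phi> \<ge> 1\<close> far out, so \<open>e\<close> is as small as the
  residual \<open>\<rho>\<close>. The expansion of \<open>u' = u^2 - x\<close> follows algebraically, so that no asymptotic expansion has to
  be differentiated. The two bounds assumed for \<open>u'\<close> provide the boundedness of \<open>e\<close>.
\<close>

lemma neg_log_deriv2_asymptotics:
  assumes G: "\<And>x. x \<ge> 0 \<Longrightarrow> 0 \<le> (neg_log_deriv x)\<^sup>2 - x" "\<And>x. x \<ge> 0 \<Longrightarrow> (neg_log_deriv x)\<^sup>2 - x \<le> K"
  obtains C where "\<And>x. x \<ge> 1 \<Longrightarrow>
    \<bar>(neg_log_deriv x)\<^sup>2 - x - (\<Sum>k<Suc N. asymp_coeff k * x powr (1 - 3/2 * real k))\<bar> \<le> C * x powr (- 3/2 * real N)"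
proof -
  \<comment> \<open>One coefficient more than needed: passing from \<open>e\<close> to \<open>(u + \<phi>) e\<close> costs a factor \<open>sqrt x\<close>.\<close>
  define P where "P = riccati_poly (Suc N)"
  define Q where "Q = P ^ 2 - 1 - [:0, 1:] * (smult (1/2) P - smult (3/2) ([:0, 1:] * pderiv P))"
  define R where "R = P ^ 2 - 1 - (\<Sum>k<Suc N. monom (asymp_coeff k) k)"
  have lowQ: "coeff Q k = 0" if "k < Suc N" for k
    using riccati_poly_low(1)[OF that] by (simp only: P_def Q_def)
  have lowR: "coeff R k = 0" if "k < Suc N" for k
    using riccati_poly_low(2)[OF that] by (simp only: P_def R_def)
  obtain CQ where CQ: "CQ \<ge> 0" "\<And>t. 0 \<le> t \<Longrightarrow> t \<le> 1 \<Longrightarrow> \<bar>poly Q t\<bar> \<le> CQ * t ^ Suc N"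
    using poly_bound_low_coeffs[OF lowQ] by blast
  obtain CR where CR: "CR \<ge> 0" "\<And>t. 0 \<le> t \<Longrightarrow> t \<le> 1 \<Longrightarrow> \<bar>poly R t\<bar> \<le> CR * t ^ Suc N"
    using poly_bound_low_coeffs[OF lowR] by blast
  have lowP: "coeff (P - 1) k = 0" if "k < 1" for k
    using that by (simp add: P_def riccati_poly_def coeff_sum_monom riccati_fps_nth_0 del: sum.lessThan_Suc)
  obtain CP where CP: "CP \<ge> 0" "\<And>t. 0 \<le> t \<Longrightarrow> t \<le> 1 \<Longrightarrow> \<bar>poly (P - 1) t\<bar> \<le> CP * t ^ 1"
    using poly_bound_low_coeffs[OF lowP] by blast
  define t where "t = (\<lambda>x::real. x powr (- 3/2))"
  have t01: "0 \<le> t x" "t x \<le> 1" if "x \<ge> 1" for x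
    using that powr_mono[of "-3/2" 0 x] by (auto simp: t_def)
  have tpow: "x * t x ^ k = x powr (1 - 3/2 * real k)" if "x \<ge> 1" for x k
  proof -
    have "x * t x ^ k = x powr 1 * x powr (real k * (- 3/2))" using that by (simp add: t_def powr_power)
    also have "\<dots> = x powr (1 - 3/2 * real k)" unfolding powr_add[symmetric] by (simp add: mult.commute)
    finally show ?thesis .
  qed
  define \<phi> where "\<phi> = (\<lambda>x. x powr (1/2) * poly P (t x))"
  define \<phi>' where "\<phi>' = (\<lambda>x. x * (t x * (1/2 * poly P (t x) - 3/2 * (t x * poly (pderiv P) (t x)))))"
  have phi_deriv: "(\<phi> has_real_derivative \<phi>' x) (at x)" if x: "x \<ge> 1" for x
  proof -
    have "(\<phi> has_real_derivative (1/2 * x powr (1/2 - 1)) * poly P (t x) + (poly (pderiv P) (t x) * (- 3/2 * x powr (- 3/2 - 1))) * x powr (1/2)) (at x)"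
      unfolding \<phi>_def t_def using x
      by (intro DERIV_mult DERIV_chain2[OF poly_DERIV] has_real_derivative_powr) auto
    moreover have "x powr (1/2 - 1) = x * t x"
      using x powr_add[of x 1 "- 3/2"] by (simp add: t_def)
    moreover have "x powr (- 3/2 - 1) * x powr (1/2) = x * (t x * t x)"
    proof -
      have "x * (t x * t x) = x powr 1 * (x powr (-3/2) * x powr (-3/2))" using x by (simp add: t_def)
      also have "\<dots> = x powr (- 3/2 - 1) * x powr (1/2)" by (simp only: powr_add[symmetric]) simp
      finally show ?thesis ..
    qed
    ultimately show ?thesis unfolding \<phi>'_def by (elim DERIV_cong) (simp add: algebra_simps)
  qed
  have sqr: "(x powr (1/2))\<^sup>2 = x" if "x \<ge> 1" for x :: real
    using that by (simp add: powr_power)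
  have phi_sq: "(\<phi> x)\<^sup>2 = x * (poly P (t x))\<^sup>2" if "x \<ge> 1" for x
    using sqr[OF that] by (simp add: \<phi>_def power_mult_distrib)
  define \<rho> where "\<rho> = (\<lambda>x. (\<phi> x)\<^sup>2 - x - \<phi>' x)"
  have rho_eq: "\<rho> x = x * poly Q (t x)" if "x \<ge> 1" for x
    unfolding \<rho>_def phi_sq[OF that] \<phi>'_def Q_def by (simp add: algebra_simps)
  define r where "r = (\<lambda>x. CQ * x powr (1 - 3/2 * real (Suc N)))"
  have rho_le: "\<bar>\<rho> x\<bar> \<le> r x" if x: "x \<ge> 1" for x
  proof -
    have "\<bar>\<rho> x\<bar> \<le> x * (CQ * t x ^ Suc N)"
      unfolding rho_eq[OF x] abs_mult using x CQ(2)[OF t01[OF x]] by (intro mult_mono) auto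
    also have "\<dots> = r x" unfolding r_def tpow[OF x, symmetric] by simp
    finally show ?thesis .
  qed
  have r_anti: "r y \<le> r x" if "1 \<le> x" "x \<le> y" for x y
    unfolding r_def using that CQ(1) by (intro mult_left_mono powr_mono2') auto
  define e where "e = (\<lambda>x. neg_log_deriv x - \<phi> x)"
  have u_bounds: "x powr (1/2) \<le> neg_log_deriv x" "neg_log_deriv x \<le> x powr (1/2) + sqrt K" if x: "x \<ge> 1" for x
  proof -
    have u0: "neg_log_deriv x \<ge> 0" using neg_log_deriv_pos[of x] x by simp
    show "x powr (1/2) \<le> neg_log_deriv x"
      by (rule power2_le_imp_le[OF _ u0]) (use sqr[OF x] G(1)[of x] x in simp)
    have K: "K \<ge> 0" using G(1)[of 0] G(2)[of 0] by linarith
    have "(neg_log_deriv x)\<^sup>2 \<le> (x powr (1/2))\<^sup>2 + (sqrt K)\<^sup>2 + 2 * (x powr (1/2) * sqrt K)"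
    proof -
      have "x powr (1/2) * sqrt K \<ge> 0" using K by simp
      moreover have "(neg_log_deriv x)\<^sup>2 - x \<le> K" using G(2)[of x] x by simp
      ultimately show ?thesis using sqr[OF x] real_sqrt_pow2[OF K] by linarith
    qed
    also have "\<dots> = (x powr (1/2) + sqrt K)\<^sup>2" by (simp add: power2_sum)
    finally show "neg_log_deriv x \<le> x powr (1/2) + sqrt K" by (rule power2_le_imp_le) (use K in simp)
  qed
  have phi_near: "\<bar>\<phi> x - x powr (1/2)\<bar> \<le> CP" if x: "x \<ge> 1" for x
  proof -
    have "\<phi> x - x powr (1/2) = x powr (1/2) * poly (P - 1) (t x)" by (simp add: \<phi>_def algebra_simps)
    then have "\<bar>\<phi> x - x powr (1/2)\<bar> \<le> x powr (1/2) * (CP * t x)"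
      using CP(2)[OF t01[OF x]] by (simp add: abs_mult mult_left_mono)
    also have "x powr (1/2) * (CP * t x) = CP * x powr (-1)"
      using powr_add[of x "1/2" "-3/2"] by (simp add: t_def)
    also have "\<dots> \<le> CP * 1" using x CP(1) powr_mono[of "-1" 0 x] by (intro mult_left_mono) auto
    finally show ?thesis by simp
  qed
  have e_bounded: "\<bar>e x\<bar> \<le> CP + sqrt K" if "x \<ge> 1" for x
    using u_bounds[OF that] phi_near[OF that] unfolding e_def by linarith
  \<comment> \<open>Beyond this point \<open>CP t \<le> 1\<close>, so \<open>P(t)\<close> differs from 1 by at most 1.\<close>
  define x1 where "x1 = max 1 CP"
  have x1: "x1 \<ge> 1" "x1 \<ge> CP" by (auto simp: x1_def)
  have phi_nonneg: "\<phi> x \<ge> 0" if x: "x \<ge> x1" for x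
  proof -
    have x0: "x \<ge> 1" using x x1 by simp
    have "CP * t x \<le> x * x powr (-1)"
      using x x0 x1 unfolding t_def by (intro mult_mono powr_mono) auto
    then have "CP * t x \<le> 1" using x0 by (simp add: powr_minus)
    then have "\<bar>poly (P - 1) (t x)\<bar> \<le> 1" using CP(2)[OF t01[OF x0]] by simp
    then have "poly P (t x) \<ge> 0" by simp
    then show ?thesis by (simp add: \<phi>_def)
  qed
  have e_le: "\<bar>e x\<bar> \<le> r x" if x: "x \<ge> x1" for x
  proof (rule unstable_ode_bound[OF _ _ _ _ _ _ x, where a = "\<lambda>x. neg_log_deriv x + \<phi> x" and \<rho> = \<rho> and M = "CP + sqrt K"])
    show "(e has_real_derivative (neg_log_deriv x + \<phi> x) * e x + \<rho> x) (at x)" if "x \<ge> x1" for x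
    proof -
      have "(e has_real_derivative ((neg_log_deriv x)\<^sup>2 - x) - \<phi>' x) (at x)"
        unfolding e_def using that x1 by (intro DERIV_diff DERIV_neg_log_deriv phi_deriv) auto
      then show ?thesis by (elim DERIV_cong) (simp add: e_def \<rho>_def power2_eq_square algebra_simps)
    qed
    show "continuous_on {x1..} (\<lambda>x. neg_log_deriv x + \<phi> x)"
      using x1 by (intro continuous_at_imp_continuous_on ballI continuous_intros DERIV_isCont[OF DERIV_neg_log_deriv] DERIV_isCont[OF phi_deriv]) auto
    show "1 \<le> neg_log_deriv x + \<phi> x" if "x \<ge> x1" for x
    proof -
      have "x \<ge> 1" using that x1 by simp
      then show ?thesis using u_bounds(1)[of x] phi_nonneg[OF that] ge_one_powr_ge_zero[of x "1/2"] by simp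
    qed
    show "\<bar>\<rho> x\<bar> \<le> r x" if "x \<ge> x1" for x using that x1 by (intro rho_le) simp
    show "r y \<le> r x" if "x1 \<le> x" "x \<le> y" for x y using that x1 by (intro r_anti) simp_all
    show "\<bar>e x\<bar> \<le> CP + sqrt K" if "x \<ge> x1" for x using that x1 by (intro e_bounded) simp
  qed
  define H where "H = (\<lambda>x. (neg_log_deriv x)\<^sup>2 - x - (\<Sum>k<Suc N. asymp_coeff k * x powr (1 - 3/2 * real k)))"
  define C3 where "C3 = 2 + sqrt K + CP"
  have H_eq: "H x = e x * (neg_log_deriv x + \<phi> x) + x * poly R (t x)" if x: "x \<ge> 1" for x
  proof -
    have "x * poly R (t x) = (\<phi> x)\<^sup>2 - x - (\<Sum>k<Suc N. asymp_coeff k * (x * t x ^ k))"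
      unfolding R_def phi_sq[OF x] by (simp add: poly_sum poly_monom algebra_simps sum_distrib_left)
    then show ?thesis unfolding H_def e_def tpow[OF x] by (simp add: power2_eq_square algebra_simps)
  qed
  have H_le1: "\<bar>H x\<bar> \<le> (CQ * C3 + CR) * x powr (- 3/2 * real N)" if x: "x \<ge> x1" for x
  proof -
    have x0: "x \<ge> 1" using x x1 by simp
    have p1: "x powr (1/2) \<ge> 1" using x0 by (simp add: ge_one_powr_ge_zero)
    have "K \<ge> 0" using G(1)[of 0] G(2)[of 0] by linarith
    then have K: "sqrt K \<ge> 0" by simp
    have "neg_log_deriv x + \<phi> x \<le> 2 * x powr (1/2) + sqrt K + CP"
      using u_bounds(2)[OF x0] phi_near[OF x0] by linarith
    also have "\<dots> \<le> C3 * x powr (1/2)"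
      using mult_left_mono[OF p1, of "sqrt K + CP"] K CP(1) by (simp add: C3_def algebra_simps)
    finally have s: "\<bar>neg_log_deriv x + \<phi> x\<bar> \<le> C3 * x powr (1/2)"
      using u_bounds(1)[OF x0] phi_nonneg[OF x] p1 by simp
    have "\<bar>H x\<bar> \<le> \<bar>e x\<bar> * \<bar>neg_log_deriv x + \<phi> x\<bar> + x * \<bar>poly R (t x)\<bar>"
      unfolding H_eq[OF x0] using x0 by (intro order_trans[OF abs_triangle_ineq]) (simp add: abs_mult)
    also have "\<dots> \<le> r x * (C3 * x powr (1/2)) + x * (CR * t x ^ Suc N)"
      using e_le[OF x] s CR(2)[OF t01[OF x0]] x0 by (intro add_mono mult_mono) auto
    also have "x * (CR * t x ^ Suc N) = CR * x powr (1 - 3/2 * real (Suc N))"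
      unfolding tpow[OF x0, symmetric] by simp
    also have "r x * (C3 * x powr (1/2)) = CQ * C3 * x powr (- 3/2 * real N)"
    proof -
      have "x powr (1 - 3/2 * real (Suc N)) * x powr (1/2) = x powr (- 3/2 * real N)"
        unfolding powr_add[symmetric] by (rule arg_cong[where f = "\<lambda>z. x powr z"]) (simp add: field_simps)
      then show ?thesis by (simp add: r_def mult.assoc mult.left_commute)
    qed
    also have "x powr (1 - 3/2 * real (Suc N)) \<le> x powr (- 3/2 * real N)"
      using x0 by (intro powr_mono) (auto simp: field_simps)
    finally show ?thesis using CR(1) by (simp add: distrib_right mult_left_mono)
  qed
  have contH: "continuous_on {1..x1} H"
    unfolding H_def
    by (intro continuous_at_imp_continuous_on ballI continuous_intros DERIV_isCont[OF DERIV_neg_log_deriv]) auto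
  then have "compact (H ` {1..x1})" by (intro compact_continuous_image) auto
  then obtain C4 where C4: "\<forall>x\<in>{1..x1}. \<bar>H x\<bar> \<le> C4"
    by (auto dest!: compact_imp_bounded simp: bounded_iff)
  have C4': "C4 \<ge> 0" using C4 x1 by (meson abs_ge_zero atLeastAtMost_iff order_refl order_trans)
  define C where "C = max (CQ * C3 + CR) (C4 * x1 powr (3/2 * real N))"
  show ?thesis
  proof (rule that[of C])
    fix x :: real assume x: "x \<ge> 1"
    have "\<bar>H x\<bar> \<le> C * x powr (- 3/2 * real N)"
    proof (cases "x \<ge> x1")
      case True
      have "\<bar>H x\<bar> \<le> (CQ * C3 + CR) * x powr (- 3/2 * real N)" by (rule H_le1[OF True])
      also have "\<dots> \<le> C * x powr (- 3/2 * real N)" by (intro mult_right_mono) (auto simp: C_def)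
      finally show ?thesis .
    next
      case False
      have "x powr (3/2 * real N) \<le> x1 powr (3/2 * real N)" using False x by (intro powr_mono2) auto
      then have "C4 * x powr (3/2 * real N) * x powr (- 3/2 * real N) \<le> C4 * x1 powr (3/2 * real N) * x powr (- 3/2 * real N)"
        using C4' by (intro mult_right_mono mult_left_mono) auto
      also have "\<dots> \<le> C * x powr (- 3/2 * real N)" by (intro mult_right_mono) (auto simp: C_def)
      also have "C4 * x powr (3/2 * real N) * x powr (- 3/2 * real N) = C4"
        using x by (simp add: mult.assoc powr_add[symmetric])
      finally show ?thesis using C4 False x by force
    qed
    then show "\<bar>(neg_log_deriv x)\<^sup>2 - x - (\<Sum>k<Suc N. asymp_coeff k * x powr (1 - 3/2 * real k))\<bar> \<le> C * x powr (- 3/2 * real N)"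
      by (simp only: H_def)
  qed
qed

section \<open>Integrals depending on a complex exponent\<close>

lemma norm_exp_minus_1_le: "norm (exp z - 1) \<le> norm z * exp (norm z)" for z :: complex
proof -
  have "norm (exp z - exp 0) \<le> exp (norm z) * norm (z - 0)"
  proof (rule field_differentiable_bound[where S = "closed_segment 0 z"])
    fix w assume w: "w \<in> closed_segment 0 z"
    show "(exp has_field_derivative exp w) (at w within closed_segment 0 z)"
      by (intro derivative_eq_intros) auto
    have "norm w \<le> norm z" using segment_bound1[OF w] by simp
    then show "norm (exp w) \<le> exp (norm z)"
      using complex_Re_le_cmod[of w] by (simp add: order_trans)
  qed auto
  then show ?thesis by (simp add: mult.commute)
qed

text \<open>
  Integrability at the two points \<open>w \<plusminus> 2\<epsilon>\<close> already dominates the difference quotients near \<open>w\<close>, since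
  \<open>\<bar>L\<bar> exp (\<epsilon> \<bar>L\<bar>) \<le> exp (2\<epsilon> \<bar>L\<bar>) / \<epsilon>\<close>. With \<open>L = ln\<close> on the half-line this covers Mellin transforms, with
  counting measure it covers Dirichlet series.
\<close>

lemma holomorphic_on_exp_integral:
  fixes L :: "'a \<Rightarrow> real" and H :: "'a \<Rightarrow> complex"
  assumes U: "open U"
      and [measurable]: "L \<in> borel_measurable M" "H \<in> borel_measurable M"
      and int: "\<And>w. w \<in> U \<Longrightarrow> integrable M (\<lambda>x. exp (w * of_real (L x)) * H x)"
  shows "(\<lambda>w. integral\<^sup>L M (\<lambda>x. exp (w * of_real (L x)) * H x)) holomorphic_on U"
  unfolding holomorphic_on_open[OF U]
proof
  fix w assume w: "w \<in> U"
  obtain d where d: "d > 0" "cball w d \<subseteq> U" using U w open_contains_cball_eq by blast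
  define \<epsilon> where "\<epsilon> = d / 2"
  have \<epsilon>: "\<epsilon> > 0" using d by (simp add: \<epsilon>_def)
  define f where "f = (\<lambda>w x. exp (w * of_real (L x)) * H x)"
  define D where "D = (\<lambda>x. (norm (f (w + of_real (2 * \<epsilon>)) x) + norm (f (w - of_real (2 * \<epsilon>)) x)) / \<epsilon>)"
  have in_U: "w + of_real (2 * \<epsilon>) \<in> U" "w - of_real (2 * \<epsilon>) \<in> U"
    using d by (auto simp: \<epsilon>_def dist_norm intro!: subsetD[OF d(2)])
  have intD: "integrable M D"
    unfolding D_def f_def
    by (intro integrable_divide Bochner_Integration.integrable_add integrable_norm int in_U)
  define g where "g = (\<lambda>x. of_real (L x) * f w x)"
  have lim: "((\<lambda>h. (integral\<^sup>L M (f (w + h)) - integral\<^sup>L M (f w)) / h) \<longlongrightarrow> integral\<^sup>L M g) (at 0)"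
    unfolding tendsto_at_iff_sequentially o_def
  proof (intro allI impI)
    fix X :: "nat \<Rightarrow> complex" assume X0: "\<forall>i. X i \<in> UNIV - {0}" and X: "X \<longlonglongrightarrow> 0"
    have "\<forall>\<^sub>F n in sequentially. norm (X n) < \<epsilon>"
      using order_tendstoD(2)[OF tendsto_norm[OF X]] \<epsilon> by simp
    then obtain N where N: "\<And>n. n \<ge> N \<Longrightarrow> norm (X n) < \<epsilon>" by (auto simp: eventually_sequentially)
    define Y where "Y = (\<lambda>n. X (n + N))"
    have Y: "Y n \<noteq> 0" "norm (Y n) < \<epsilon>" for n using X0 N by (auto simp: Y_def)
    have Ylim: "Y \<longlonglongrightarrow> 0" unfolding Y_def by (rule LIMSEQ_ignore_initial_segment[OF X])
    have in_U': "w + Y n \<in> U" for n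
      using Y(2)[of n] d by (auto simp: \<epsilon>_def dist_norm intro!: subsetD[OF d(2)])
    have quot: "(f (w + h) x - f w x) / h = f w x * ((exp (h * of_real (L x)) - 1) / h)" for h x
      by (simp add: f_def exp_add algebra_simps diff_divide_distrib)
    have "(\<lambda>n. integral\<^sup>L M (\<lambda>x. (f (w + Y n) x - f w x) / Y n)) \<longlonglongrightarrow> integral\<^sup>L M g"
    proof (rule integral_dominated_convergence[OF _ _ intD])
      show "g \<in> borel_measurable M" unfolding g_def f_def by measurable
      show "(\<lambda>x. (f (w + Y n) x - f w x) / Y n) \<in> borel_measurable M" for n
        unfolding f_def by measurable
      show "AE x in M. (\<lambda>n. (f (w + Y n) x - f w x) / Y n) \<longlonglongrightarrow> g x"
      proof (rule AE_I2)
        fix x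
        have "((\<lambda>h::complex. exp (h * of_real (L x))) has_field_derivative of_real (L x)) (at 0)"
          by (auto intro!: derivative_eq_intros)
        then have "((\<lambda>h::complex. (exp (h * of_real (L x)) - 1) / h) \<longlongrightarrow> of_real (L x)) (at 0)"
          by (simp add: has_field_derivative_iff)
        moreover have "filterlim Y (at 0) sequentially"
          using Ylim Y by (auto simp: filterlim_at)
        ultimately have "(\<lambda>n. (exp (Y n * of_real (L x)) - 1) / Y n) \<longlonglongrightarrow> of_real (L x)"
          by (rule filterlim_compose)
        then have "(\<lambda>n. f w x * ((exp (Y n * of_real (L x)) - 1) / Y n)) \<longlonglongrightarrow> f w x * of_real (L x)"
          by (intro tendsto_mult tendsto_const)
        then show "(\<lambda>n. (f (w + Y n) x - f w x) / Y n) \<longlonglongrightarrow> g x"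
          by (simp add: quot g_def mult.commute)
      qed
      show "AE x in M. norm ((f (w + Y n) x - f w x) / Y n) \<le> D x" for n
      proof (rule AE_I2)
        fix x
        define l where "l = \<bar>L x\<bar>"
        have "norm ((exp (Y n * of_real (L x)) - 1) / Y n) \<le> norm (Y n * of_real (L x)) * exp (norm (Y n * of_real (L x))) / norm (Y n)"
          unfolding norm_divide by (intro divide_right_mono norm_exp_minus_1_le) auto
        also have "\<dots> = l * exp (norm (Y n) * l)"
          using Y(1)[of n] by (simp add: norm_mult l_def)
        also have "\<dots> \<le> (exp (\<epsilon> * l) / \<epsilon>) * exp (\<epsilon> * l)"
        proof (intro mult_mono)
          have "\<epsilon> * l \<le> exp (\<epsilon> * l)" using exp_ge_add_one_self[of "\<epsilon> * l"] by linarith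
          then show "l \<le> exp (\<epsilon> * l) / \<epsilon>" using \<epsilon> by (simp add: field_simps)
          show "exp (norm (Y n) * l) \<le> exp (\<epsilon> * l)"
            using Y(2)[of n] by (auto simp: l_def intro!: mult_right_mono)
        qed (use \<epsilon> in \<open>auto simp: l_def\<close>)
        also have "\<dots> = exp (2 * \<epsilon> * l) / \<epsilon>" by (simp add: exp_add[symmetric])
        also have "\<dots> \<le> (exp (2 * \<epsilon> * L x) + exp (- (2 * \<epsilon> * L x))) / \<epsilon>"
          using \<epsilon> by (intro divide_right_mono; cases "L x \<ge> 0"; simp add: l_def)
        finally have "norm (f w x) * norm ((exp (Y n * of_real (L x)) - 1) / Y n) \<le> norm (f w x) * ((exp (2 * \<epsilon> * L x) + exp (- (2 * \<epsilon> * L x))) / \<epsilon>)"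
          by (intro mult_left_mono) auto
        also have "\<dots> = D x"
        proof -
          have fs: "norm (f (w + of_real r) x) = norm (f w x) * exp (r * L x)" for r
          proof -
            have "f (w + of_real r) x = f w x * exp (of_real (r * L x))"
              by (simp add: f_def exp_add algebra_simps)
            then show ?thesis by (simp add: norm_mult)
          qed
          show ?thesis
            using fs[of "2 * \<epsilon>"] fs[of "- (2 * \<epsilon>)"] by (simp add: D_def algebra_simps)
        qed
        finally show "norm ((f (w + Y n) x - f w x) / Y n) \<le> D x"
          unfolding quot norm_mult .
      qed
    qed
    also have "(\<lambda>n. integral\<^sup>L M (\<lambda>x. (f (w + Y n) x - f w x) / Y n)) = (\<lambda>n. (integral\<^sup>L M (f (w + Y n)) - integral\<^sup>L M (f w)) / Y n)"
      using int[OF in_U'] int[OF w] unfolding f_def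
      by (intro ext) (simp add: Bochner_Integration.integral_diff)
    finally show "(\<lambda>n. (integral\<^sup>L M (f (w + X n)) - integral\<^sup>L M (f w)) / X n) \<longlonglongrightarrow> integral\<^sup>L M g"
      unfolding Y_def by (rule LIMSEQ_offset)
  qed
  show "\<exists>F'. ((\<lambda>w. integral\<^sup>L M (\<lambda>x. exp (w * of_real (L x)) * H x)) has_field_derivative F') (at w)"
    using lim unfolding DERIV_def f_def[symmetric] by (auto simp: f_def)
qed

text \<open>
  Write \<open>1 / (x + l)^2\<close> as a Gamma integral in \<open>t\<close> and exchange the order of integration.
\<close>

lemma nn_integral_Beta_scaled:
  fixes s l :: real
  assumes s: "0 < s" "s < 2" and l: "l > 0"
  shows "(\<integral>\<^sup>+x. ennreal (indicator {0<..} x * (x powr (1 - s) * (1 / (x + l)\<^sup>2))) \<partial>lborel)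
           = ennreal (Gamma s * Gamma (2 - s) * l powr (- s))"
proof -
  let ?I = "\<lambda>x::real. \<integral>\<^sup>+t. ennreal (indicator {0<..} t * (t powr (2 - 1) * exp (- (x + l) * t))) \<partial>lborel"
  let ?J = "\<lambda>t::real. \<integral>\<^sup>+x. ennreal (indicator {0<..} x * (x powr ((2 - s) - 1) * exp (- t * x))) \<partial>lborel"
  let ?K = "\<integral>\<^sup>+t. ennreal (indicator {0<..} t * (t powr (s - 1) * exp (- l * t))) \<partial>lborel"
  let ?h = "\<lambda>x::real. ennreal (indicator {0<..} x * (x powr (1 - s) * (1 / (x + l)\<^sup>2)))"
  let ?f = "\<lambda>x t::real. indicator {0<..} x * (indicator {0<..} t * (x powr (1 - s) * (t powr (2 - 1) * exp (- (x + l) * t))))"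
  have m [measurable]: "(\<lambda>(x, t). ennreal (?f x t)) \<in> borel_measurable (lborel \<Otimes>\<^sub>M lborel)"
    by measurable
  have 1: "?h x = (\<integral>\<^sup>+t. ennreal (?f x t) \<partial>lborel)" for x :: real
  proof (cases "x > 0")
    case True
    have "(\<integral>\<^sup>+t. ennreal (?f x t) \<partial>lborel) = (\<integral>\<^sup>+t. ennreal (x powr (1 - s)) * ennreal (indicator {0<..} t * (t powr (2 - 1) * exp (- (x + l) * t))) \<partial>lborel)"
      using True by (intro nn_integral_cong) (simp add: ennreal_mult[symmetric] mult_ac)
    also have "\<dots> = ennreal (x powr (1 - s)) * ?I x"
      by (intro nn_integral_cmult) auto
    also have "?I x = ennreal (Gamma 2 * (x + l) powr (- 2))"
      using True l by (intro nn_integral_Gamma_scaled) auto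
    also have "Gamma 2 * (x + l) powr (- 2) = 1 / (x + l)\<^sup>2"
      using True l Gamma_fact[of 1, where 'a = real] by (simp add: powr_minus_divide)
    finally show ?thesis using True by (simp add: ennreal_mult[symmetric])
  qed auto
  have 2: "(\<integral>\<^sup>+x. ennreal (?f x t) \<partial>lborel) = ennreal (Gamma (2 - s)) * ennreal (indicator {0<..} t * (t powr (s - 1) * exp (- l * t)))" for t :: real
  proof (cases "t > 0")
    case True
    have "(\<integral>\<^sup>+x. ennreal (?f x t) \<partial>lborel) = (\<integral>\<^sup>+x. ennreal (t * exp (- l * t)) * ennreal (indicator {0<..} x * (x powr ((2 - s) - 1) * exp (- t * x))) \<partial>lborel)"
      using True by (intro nn_integral_cong) (simp add: ennreal_mult[symmetric] mult_ac algebra_simps exp_add exp_diff exp_minus divide_inverse)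
    also have "\<dots> = ennreal (t * exp (- l * t)) * ?J t"
      by (intro nn_integral_cmult) auto
    also have "?J t = ennreal (Gamma (2 - s) * t powr (- (2 - s)))"
      using True s by (intro nn_integral_Gamma_scaled) auto
    also have "ennreal (t * exp (- l * t)) * ennreal (Gamma (2 - s) * t powr (- (2 - s))) = ennreal (Gamma (2 - s)) * ennreal (t powr (s - 1) * exp (- l * t))"
    proof -
      have "t * t powr (- (2 - s)) = t powr (s - 1)"
        using True powr_add[of t 1 "- (2 - s)"] by simp
      then have "t * exp (- l * t) * (Gamma (2 - s) * t powr (- (2 - s))) = Gamma (2 - s) * (t powr (s - 1) * exp (- l * t))"
        by (metis mult.assoc mult.commute)
      then show ?thesis using s True by (simp add: ennreal_mult[symmetric] Gamma_real_nonneg)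
    qed
    finally show ?thesis using True by simp
  qed auto
  have "(\<integral>\<^sup>+x. ?h x \<partial>lborel) = (\<integral>\<^sup>+x. \<integral>\<^sup>+t. ennreal (?f x t) \<partial>lborel \<partial>lborel)"
    unfolding 1 ..
  also have "\<dots> = (\<integral>\<^sup>+t. \<integral>\<^sup>+x. ennreal (?f x t) \<partial>lborel \<partial>lborel)"
    by (rule lborel_pair.Fubini'[symmetric, OF m])
  also have "\<dots> = ennreal (Gamma (2 - s)) * ?K"
    unfolding 2 by (intro nn_integral_cmult) auto
  also have "?K = ennreal (Gamma s * l powr (- s))"
    using s l by (intro nn_integral_Gamma_scaled) auto
  finally show ?thesis using s by (simp add: ennreal_mult[symmetric] Gamma_real_nonneg mult_ac)
qed

lemma set_integral_FTC_at_top: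
  fixes F :: "real \<Rightarrow> 'a :: euclidean_space"
  assumes int: "set_integrable lborel {a..} f"
      and F: "\<And>x. x \<ge> a \<Longrightarrow> (F has_vector_derivative f x) (at x)"
      and lim: "(F \<longlongrightarrow> l) at_top"
  shows "(LINT x:{a..}|lborel. f x) = l - F a"
proof -
  have "((\<lambda>y. \<integral>x. indicator {..y} x *\<^sub>R (indicator {a..} x *\<^sub>R f x) \<partial>lborel) \<longlongrightarrow> (LINT x:{a..}|lborel. f x)) at_top"
    using int unfolding set_integrable_def set_lebesgue_integral_def
    by (intro tendsto_integral_at_top) auto
  moreover have "((\<lambda>y. \<integral>x. indicator {..y} x *\<^sub>R (indicator {a..} x *\<^sub>R f x) \<partial>lborel) \<longlongrightarrow> l - F a) at_top"
  proof (rule Lim_transform_eventually)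
    show "((\<lambda>y. F y - F a) \<longlongrightarrow> l - F a) at_top" by (intro tendsto_intros lim)
    show "\<forall>\<^sub>F y in at_top. F y - F a = (\<integral>x. indicator {..y} x *\<^sub>R (indicator {a..} x *\<^sub>R f x) \<partial>lborel)"
      using eventually_ge_at_top[of a]
    proof eventually_elim
      case (elim y)
      have inty: "set_integrable lborel {a..y} f" by (rule set_integrable_subset[OF int]) auto
      have "(\<integral>x. indicator {..y} x *\<^sub>R (indicator {a..} x *\<^sub>R f x) \<partial>lborel) = (LINT x:{a..y}|lborel. f x)"
        unfolding set_lebesgue_integral_def by (intro Bochner_Integration.integral_cong) (auto simp: indicator_def)
      also have "\<dots> = integral {a..y} f" by (rule set_borel_integral_eq_integral(2)[OF inty])
      also have "\<dots> = F y - F a"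
        by (rule integral_unique, rule fundamental_theorem_of_calculus[OF elim])
           (use F in \<open>auto intro: has_vector_derivative_at_within\<close>)
      finally show ?case ..
    qed
  qed
  ultimately show ?thesis by (rule tendsto_unique[rotated]) simp
qed

lemma set_integrable_powr_at_top:
  assumes "a < (-1::real)"
  shows "set_integrable lborel {1..} (\<lambda>x. x powr a)"
  unfolding set_integrable_def
proof (rule integrableI_nonneg)
  have "(\<integral>\<^sup>+x. ennreal (indicator {1..} x * x powr a) \<partial>lborel) = ennreal (- (1 powr (a + 1)) / (a + 1))"
    by (intro nn_integral_has_integral_lebesgue has_integral_powr_to_inf) (use assms in auto)
  then show "(\<integral>\<^sup>+x. ennreal (indicator {1..} x *\<^sub>R x powr a) \<partial>lborel) < \<infinity>" by simp
qed auto

lemma set_integrable_powr_from_0: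
  assumes "a > (-1::real)"
  shows "set_integrable lborel {0<..1} (\<lambda>x. x powr a)"
  unfolding set_integrable_def
proof (rule integrableI_nonneg)
  have "(\<integral>\<^sup>+x. ennreal (indicator {0..1} x * x powr a) \<partial>lborel) = ennreal (1 powr (a + 1) / (a + 1))"
    by (intro nn_integral_has_integral_lebesgue has_integral_powr_from_0) (use assms in auto)
  moreover have "(\<integral>\<^sup>+x. ennreal (indicator {0<..1} x *\<^sub>R x powr a) \<partial>lborel) \<le> (\<integral>\<^sup>+x. ennreal (indicator {0..1} x * x powr a) \<partial>lborel)"
    by (intro nn_integral_mono ennreal_leI) (auto simp: indicator_def)
  ultimately show "(\<integral>\<^sup>+x. ennreal (indicator {0<..1} x *\<^sub>R x powr a) \<partial>lborel) < \<infinity>"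
    by (metis ennreal_less_top infinity_ennreal_def order_le_less_trans)
qed auto

section \<open>The Mellin transform and its continuation\<close>

text \<open>
  By the Riccati equation this is the derivative of \<open>u\<close>.
\<close>

definition neg_log_deriv2 :: "real \<Rightarrow> real" where "neg_log_deriv2 x = (neg_log_deriv x)\<^sup>2 - x"

text \<open>
  The term \<open>k = 0\<close> of the sum vanishes, because the coefficient is 0; keeping it allows the index to agree
  with that of the formal series.
\<close>

definition Ai_remainder :: "nat \<Rightarrow> real \<Rightarrow> real" where
  "Ai_remainder N x = neg_log_deriv2 x - (\<Sum>k<Suc N. asymp_coeff k * x powr (1 - 3/2 * real k))"

lemma DERIV_neg_log_deriv_eq: "x \<ge> 0 \<Longrightarrow> (neg_log_deriv has_real_derivative neg_log_deriv2 x) (at x)"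
  using DERIV_neg_log_deriv by (simp add: neg_log_deriv2_def)

lemma isCont_neg_log_deriv2: "x \<ge> 0 \<Longrightarrow> isCont neg_log_deriv2 x"
  unfolding neg_log_deriv2_def[abs_def] by (intro continuous_intros DERIV_isCont[OF DERIV_neg_log_deriv])

text \<open>
  The half-line is cut at 1: near the origin \<open>u'\<close> is bounded, and only the part beyond 1 is
  expanded. Together the two intervals cover the positive numbers exactly once.
\<close>

definition head_integrand :: "real \<Rightarrow> real" where "head_integrand x = indicator {0<..<1} x * neg_log_deriv2 x"

definition tail_integrand :: "nat \<Rightarrow> real \<Rightarrow> real" where "tail_integrand N x = indicator {1..} x * Ai_remainder N x"

text \<open>
  Below, the Mellin variable \<open>w\<close> is \<open>1 - s\<close>, and \<open>x powr w\<close> is written as an exponential so that the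
  dependence on \<open>w\<close> is visibly holomorphic.
\<close>

definition Mellin_head :: "complex \<Rightarrow> complex" where
  "Mellin_head w = (\<integral>x. exp (w * of_real (ln x)) * of_real (head_integrand x) \<partial>lborel)"

definition Mellin_tail :: "nat \<Rightarrow> complex \<Rightarrow> complex" where
  "Mellin_tail N w = (\<integral>x. exp (w * of_real (ln x)) * of_real (tail_integrand N x) \<partial>lborel)"

definition Mellin_poles :: "nat \<Rightarrow> complex \<Rightarrow> complex" where
  "Mellin_poles N s = (\<Sum>k<Suc N. of_real (asymp_coeff k) / (s - of_real (3 - 3/2 * real k)))"

text \<open>
  The Mellin transform of \<open>u'\<close> after subtraction of the first \<open>N\<close> terms of the expansion on the tail and
  integration of these terms in closed form. It makes sense for \<open>2 - 3N/2 < Re s < 2\<close>, away from the poles.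
\<close>

definition Mellin_continued :: "nat \<Rightarrow> complex \<Rightarrow> complex" where
  "Mellin_continued N s = Mellin_head (1 - s) + Mellin_tail N (1 - s) + Mellin_poles N s"

lemma head_integrand_measurable [measurable]: "head_integrand \<in> borel_measurable borel"
proof -
  have "(\<lambda>x. indicator {0<..<1} x *\<^sub>R neg_log_deriv2 x) \<in> borel_measurable borel"
    by (intro borel_measurable_continuous_on_indicator continuous_at_imp_continuous_on ballI isCont_neg_log_deriv2) auto
  then show ?thesis by (simp add: head_integrand_def[abs_def])
qed

lemma tail_integrand_measurable [measurable]: "tail_integrand N \<in> borel_measurable borel"
proof -
  have "(\<lambda>x. indicator {1..} x *\<^sub>R Ai_remainder N x) \<in> borel_measurable borel"
    unfolding Ai_remainder_def
    by (intro borel_measurable_continuous_on_indicator continuous_at_imp_continuous_on ballI continuous_intros isCont_neg_log_deriv2) auto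
  then show ?thesis by (simp add: tail_integrand_def[abs_def])
qed

lemma powr_integral_at_top:
  assumes b: "Re b < -1"
  shows "set_integrable lborel {1..} (\<lambda>x. exp (b * of_real (ln x)))"
    and "(LINT x:{1..}|lborel. exp (b * of_real (ln x))) = - 1 / (b + 1)"
proof -
  have b1: "b + 1 \<noteq> 0" using b by (auto simp: complex_eq_iff)
  show int: "set_integrable lborel {1..} (\<lambda>x. exp (b * of_real (ln x)))"
    using set_integrable_powr_at_top[OF b] unfolding set_integrable_def
  proof (rule Bochner_Integration.integrable_bound)
    show "AE x in lborel. norm (indicator {1..} x *\<^sub>R exp (b * of_real (ln x))) \<le> norm (indicator {1..} x *\<^sub>R x powr Re b)"
      by (intro AE_I2) (auto simp: indicator_def powr_def mult.commute)
  qed auto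
  have "(LINT x:{1..}|lborel. exp (b * of_real (ln x))) = 0 - exp ((b + 1) * of_real (ln 1)) / (b + 1)"
  proof (rule set_integral_FTC_at_top[OF int])
    fix x :: real assume x: "x \<ge> 1"
    have "((\<lambda>z. exp ((b + 1) * z) / (b + 1)) has_field_derivative exp ((b + 1) * of_real (ln x))) (at (of_real (ln x)))"
      using b1 by (auto intro!: derivative_eq_intros)
    moreover have "((\<lambda>x. of_real (ln x) :: complex) has_vector_derivative of_real (1 / x)) (at x)"
      using x by (intro has_vector_derivative_of_real) (auto intro!: derivative_eq_intros simp: has_real_derivative_iff_has_vector_derivative[symmetric])
    ultimately have "((\<lambda>x. exp ((b + 1) * of_real (ln x)) / (b + 1)) has_vector_derivative of_real (1 / x) * exp ((b + 1) * of_real (ln x))) (at x)"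
      using field_vector_diff_chain_at[of "\<lambda>x. of_real (ln x)" "of_real (1 / x)" x "\<lambda>z. exp ((b + 1) * z) / (b + 1)"] by (simp add: o_def)
    also have "of_real (1 / x) * exp ((b + 1) * of_real (ln x)) = exp (b * of_real (ln x))"
      using x by (simp add: distrib_right exp_add exp_of_real)
    finally show "((\<lambda>x. exp ((b + 1) * of_real (ln x)) / (b + 1)) has_vector_derivative exp (b * of_real (ln x))) (at x)" .
  next
    have "((\<lambda>x. x powr (Re b + 1) / norm (b + 1)) \<longlongrightarrow> 0 / norm (b + 1)) at_top"
      using b b1 by (intro tendsto_divide tendsto_neg_powr tendsto_const filterlim_ident) auto
    then have "((\<lambda>x. x powr (Re b + 1) / norm (b + 1)) \<longlongrightarrow> 0) at_top" by simp
    then show "((\<lambda>x. exp ((b + 1) * of_real (ln x)) / (b + 1)) \<longlongrightarrow> 0) at_top"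
    proof (rule Lim_null_comparison[rotated])
      show "\<forall>\<^sub>F x in at_top. norm (exp ((b + 1) * of_real (ln x)) / (b + 1)) \<le> x powr (Re b + 1) / norm (b + 1)"
        using eventually_gt_at_top[of 0] by eventually_elim (simp add: norm_divide powr_def mult.commute)
    qed
  qed
  then show "(LINT x:{1..}|lborel. exp (b * of_real (ln x))) = - 1 / (b + 1)" by simp
qed

locale Airy_zeros =
  fixes l :: "nat \<Rightarrow> real"
  assumes zeros: "bij_betw (\<lambda>n. - complex_of_real (l n)) UNIV {z. Airy_Ai z = 0}"
begin

lemma l_pos: "l n > 0"
proof -
  have "Airy_Ai (- of_real (l n)) = 0" using zeros by (auto simp: bij_betw_def)
  then obtain a where "- complex_of_real (l n) = of_real a" "a < 0" by (rule Airy_Ai_zero_obtain)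
  then show ?thesis by (metis neg_less_0_iff_less of_real_eq_iff of_real_minus)
qed

lemma neg_log_deriv2_sums:
  assumes x: "x \<ge> 0"
  shows "(\<lambda>n. 1 / (x + l n)\<^sup>2) sums neg_log_deriv2 x"
proof (rule sums_if_exhaustion_limit[where S = "\<lambda>R. {n. l n < R}"])
  let ?i = "\<lambda>n. - complex_of_real (l n)"
  have inj: "inj ?i" using zeros by (simp add: bij_betw_def)
  have img: "{a \<in> ball 0 R. Airy_Ai a = 0} = ?i ` {n. l n < R}" for R
  proof -
    have "{a. Airy_Ai a = 0} = range ?i" using zeros by (simp add: bij_betw_def)
    then have "{a \<in> ball 0 R. Airy_Ai a = 0} = ball 0 R \<inter> range ?i" by blast
    also have "\<dots> = ?i ` {n. l n < R}" using l_pos by (auto simp: abs_of_pos)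
    finally show ?thesis .
  qed
  show "finite {n. l n < R}" for R
  proof -
    obtain K where K: "\<And>z. norm (Airy_Ai z) \<le> exp (K + norm z * sqrt (6 * norm z))"
      using Airy_Ai_growth by blast
    show ?thesis
    proof (cases "R > 0")
      case True
      have "finite {z \<in> ball 0 R. Airy_Ai z = 0}"
        by (rule Jensen_zero_count(1)[OF holomorphic_Airy_Ai Airy_Ai_0_neq_0 Airy_Ai_zero_simple True, where A = "K + (2 * R) * sqrt (6 * (2 * R))"])
           (use K in metis)+
      then show ?thesis unfolding img using inj by (metis finite_imageD inj_on_subset subset_UNIV)
    next
      case False
      then have "{n. l n < R} = {}" using l_pos by (auto simp: not_less intro: order_trans less_imp_le)
      then show ?thesis by simp
    qed
  qed
  have "(\<Sum>a\<in>{a \<in> ball 0 R. Airy_Ai a = 0}. 1 / (of_real x - a)\<^sup>2) = of_real (\<Sum>n\<in>{n. l n < R}. 1 / (x + l n)\<^sup>2)" for R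
    unfolding img using inj by (subst sum.reindex) (auto intro: inj_on_subset)
  then have "((\<lambda>R. complex_of_real (\<Sum>n\<in>{n. l n < R}. 1 / (x + l n)\<^sup>2)) \<longlongrightarrow> of_real (neg_log_deriv2 x)) at_top"
    using Airy_Ai_log_deriv_sum_zeros[OF x] by (simp only: neg_log_deriv2_def)
  then show "((\<lambda>R. \<Sum>n\<in>{n. l n < R}. 1 / (x + l n)\<^sup>2) \<longlongrightarrow> neg_log_deriv2 x) at_top"
    by (simp only: tendsto_of_real_iff)
  show "\<exists>R. n \<in> {n. l n < R}" for n by (auto intro: gt_ex)
qed auto

lemma neg_log_deriv2_nonneg: "x \<ge> 0 \<Longrightarrow> neg_log_deriv2 x \<ge> 0"
  using sums_le[OF _ sums_zero neg_log_deriv2_sums] by simp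

lemma neg_log_deriv2_le:
  assumes x: "x \<ge> 0"
  shows "neg_log_deriv2 x \<le> neg_log_deriv2 0"
proof (rule sums_le[OF _ neg_log_deriv2_sums[OF x] neg_log_deriv2_sums[OF order_refl]])
  fix n
  show "1 / (x + l n)\<^sup>2 \<le> 1 / (0 + l n)\<^sup>2"
    using x l_pos[of n] by (intro frac_le power_mono) auto
qed

lemma Ai_remainder_bound:
  obtains C where "C \<ge> 0" "\<And>x. x \<ge> 1 \<Longrightarrow> \<bar>Ai_remainder N x\<bar> \<le> C * x powr (- 3/2 * real N)"
proof -
  have nn: "0 \<le> (neg_log_deriv x)\<^sup>2 - x" and up: "(neg_log_deriv x)\<^sup>2 - x \<le> neg_log_deriv2 0" if "x \<ge> 0" for x
    using neg_log_deriv2_nonneg[OF that] neg_log_deriv2_le[OF that] by (simp_all add: neg_log_deriv2_def)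
  obtain C where C: "\<And>x. x \<ge> 1 \<Longrightarrow>
    \<bar>(neg_log_deriv x)\<^sup>2 - x - (\<Sum>k<Suc N. asymp_coeff k * x powr (1 - 3/2 * real k))\<bar> \<le> C * x powr (- 3/2 * real N)"
    using neg_log_deriv2_asymptotics[OF nn up, of N] by blast
  have "0 \<le> C" using order_trans[OF abs_ge_zero C[of 1]] by simp
  then show ?thesis using that C by (simp only: Ai_remainder_def neg_log_deriv2_def)
qed

lemma Mellin_head_integrable:
  assumes w: "Re w > -1"
  shows "integrable lborel (\<lambda>x. exp (w * of_real (ln x)) * of_real (head_integrand x))"
proof (rule Bochner_Integration.integrable_bound)
  let ?l = "\<lambda>x. norm (exp (w * of_real (ln x)) * of_real (head_integrand x))"
  let ?r = "\<lambda>x. norm (neg_log_deriv2 0 * (indicator {0<..1} x *\<^sub>R x powr Re w))"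
  show "integrable lborel (\<lambda>x. neg_log_deriv2 0 * (indicator {0<..1} x *\<^sub>R x powr Re w))"
    using set_integrable_powr_from_0[OF w] unfolding set_integrable_def by (intro integrable_mult_right)
  show "AE x in lborel. ?l x \<le> ?r x"
  proof (rule AE_I2)
    fix x :: real
    show "?l x \<le> ?r x"
    proof (cases "0 < x \<and> x < 1")
      case True
      then have "?l x = x powr Re w * neg_log_deriv2 x"
        using neg_log_deriv2_nonneg[of x] by (simp add: norm_mult powr_def mult.commute head_integrand_def tail_integrand_def)
      also have "\<dots> \<le> x powr Re w * neg_log_deriv2 0" using True neg_log_deriv2_le[of x] by (intro mult_left_mono) auto
      finally show ?thesis using True neg_log_deriv2_nonneg[of 0] by (simp add: abs_mult mult.commute)
    qed (auto simp: head_integrand_def)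
  qed
qed measurable

lemma Mellin_tail_integrable:
  assumes w: "Re w < 3/2 * real N - 1"
  shows "integrable lborel (\<lambda>x. exp (w * of_real (ln x)) * of_real (tail_integrand N x))"
proof -
  obtain C where C: "C \<ge> 0" "\<And>x. x \<ge> 1 \<Longrightarrow> \<bar>Ai_remainder N x\<bar> \<le> C * x powr (- 3/2 * real N)"
    using Ai_remainder_bound by blast
  let ?l = "\<lambda>x. norm (exp (w * of_real (ln x)) * of_real (tail_integrand N x))"
  let ?r = "\<lambda>x. norm (C * (indicator {1..} x *\<^sub>R x powr (Re w - 3/2 * real N)))"
  show ?thesis
  proof (rule Bochner_Integration.integrable_bound)
    show "integrable lborel (\<lambda>x. C * (indicator {1..} x *\<^sub>R x powr (Re w - 3/2 * real N)))"
      using set_integrable_powr_at_top[of "Re w - 3/2 * real N"] w unfolding set_integrable_def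
      by (intro integrable_mult_right) auto
    show "AE x in lborel. ?l x \<le> ?r x"
    proof (rule AE_I2)
      fix x :: real
      show "?l x \<le> ?r x"
      proof (cases "x \<ge> 1")
        case True
        then have "?l x = x powr Re w * \<bar>Ai_remainder N x\<bar>"
          by (simp add: norm_mult powr_def mult.commute head_integrand_def tail_integrand_def)
        also have "\<dots> \<le> x powr Re w * (C * x powr (- 3/2 * real N))" using True C(2)[of x] by (intro mult_left_mono) auto
        also have "\<dots> = C * (x powr (Re w - 3/2 * real N))" using powr_add[of x "Re w" "- 3/2 * real N"] by simp
        finally show ?thesis using True C(1) by (simp add: abs_mult)
      qed (auto simp: tail_integrand_def)
    qed
  qed measurable
qed

lemma Mellin_head_holomorphic: "(\<lambda>s. Mellin_head (1 - s)) holomorphic_on {s. Re s < 2}"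
proof -
  have "Mellin_head holomorphic_on {w. Re w > -1}"
    unfolding Mellin_head_def[abs_def]
    by (intro holomorphic_on_exp_integral Mellin_head_integrable open_halfspace_Re_gt) auto
  then have "(Mellin_head \<circ> (\<lambda>s. 1 - s)) holomorphic_on {s. Re s < 2}"
    by (intro holomorphic_on_compose_gen[where t = "{w. Re w > -1}"] holomorphic_intros) auto
  then show ?thesis by (simp add: o_def)
qed

lemma Mellin_tail_holomorphic: "(\<lambda>s. Mellin_tail N (1 - s)) holomorphic_on {s. Re s > 2 - 3/2 * real N}"
proof -
  have "Mellin_tail N holomorphic_on {w. Re w < 3/2 * real N - 1}"
    unfolding Mellin_tail_def[abs_def]
    by (intro holomorphic_on_exp_integral Mellin_tail_integrable open_halfspace_Re_lt) auto
  then have "(Mellin_tail N \<circ> (\<lambda>s. 1 - s)) holomorphic_on {s. Re s > 2 - 3/2 * real N}"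
    by (intro holomorphic_on_compose_gen[where t = "{w. Re w < 3/2 * real N - 1}"] holomorphic_intros) auto
  then show ?thesis by (simp add: o_def)
qed

lemma Mellin_tail_step:
  assumes s: "Re s > 2 - 3/2 * real N"
  shows "Mellin_tail N (1 - s) = Mellin_tail (Suc N) (1 - s) + of_real (asymp_coeff (Suc N)) / (s - of_real (3 - 3/2 * real (Suc N)))"
proof -
  define a where "a = 1 - 3/2 * real (Suc N)"
  define b where "b = 1 - s + of_real a"
  have b: "Re b < -1" using s by (simp add: b_def a_def field_simps)
  let ?c = "complex_of_real (asymp_coeff (Suc N))"
  let ?I = "\<integral>x. ?c * (indicator {1..} x *\<^sub>R exp (b * of_real (ln x))) \<partial>lborel"
  have eq: "exp ((1 - s) * of_real (ln x)) * of_real (tail_integrand N x) =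
     exp ((1 - s) * of_real (ln x)) * of_real (tail_integrand (Suc N) x) + ?c * (indicator {1..} x *\<^sub>R exp (b * of_real (ln x)))" for x :: real
  proof (cases "x \<ge> 1")
    case True
    have "Ai_remainder N x = Ai_remainder (Suc N) x + asymp_coeff (Suc N) * x powr a"
      by (simp add: Ai_remainder_def a_def)
    moreover have "complex_of_real (x powr a) = exp (of_real a * of_real (ln x))"
      using True by (simp add: powr_def exp_of_real[symmetric])
    moreover have "exp (b * of_real (ln x)) = exp ((1 - s) * of_real (ln x)) * exp (of_real a * of_real (ln x))"
      by (simp only: b_def distrib_right exp_add)
    ultimately show ?thesis using True by (simp add: tail_integrand_def distrib_left mult_ac)
  qed (auto simp: tail_integrand_def)
  have int: "integrable lborel (\<lambda>x. ?c * (indicator {1..} x *\<^sub>R exp (b * of_real (ln x))))"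
    using powr_integral_at_top(1)[OF b] unfolding set_integrable_def by (intro integrable_mult_right)
  have "Mellin_tail N (1 - s) = Mellin_tail (Suc N) (1 - s) + ?I"
    unfolding Mellin_tail_def eq using s by (intro Bochner_Integration.integral_add Mellin_tail_integrable int) (simp_all add: field_simps)
  also have "?I = ?c * (- 1 / (b + 1))"
    using powr_integral_at_top(2)[OF b] by (simp only: integral_mult_right_zero set_lebesgue_integral_def)
  also have "- 1 / (b + 1) = 1 / (s - of_real (3 - 3/2 * real (Suc N)))"
  proof -
    have "s - of_real (3 - 3/2 * real (Suc N)) = - (b + 1)" by (simp add: b_def a_def)
    then show ?thesis by (simp only: divide_minus_right minus_divide_left)
  qed
  finally show ?thesis by simp
qed

text \<open>
  A further subtracted term is integrated exactly by the pole that it adds. This also holds at the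
  poles, where both sides carry the same junk value: the additional poles lie to the left of \<open>s\<close>.
\<close>

lemma Mellin_continued_eq:
  assumes "N \<le> N'" "Re s > 2 - 3/2 * real N"
  shows "Mellin_continued N s = Mellin_continued N' s"
  using assms(1)
proof (induction N' rule: dec_induct)
  case (step n)
  have "Re s > 2 - 3/2 * real n" using assms(2) step.hyps by simp
  from Mellin_tail_step[OF this] have "Mellin_continued n s = Mellin_continued (Suc n) s"
    by (simp add: Mellin_continued_def Mellin_poles_def)
  then show ?case using step.IH by simp
qed simp

text \<open>
  All terms are nonnegative for real exponents, so Tonelli's theorem permits termwise integration, and the
  finiteness of the integral proves the convergence of the zeta series at the same time.
\<close>

lemma Mellin_transform_zeta:
  assumes \<sigma>: "3/2 < \<sigma>" "\<sigma> < 2"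
  shows "summable (\<lambda>n. l n powr (- \<sigma>))"
    and "Mellin_continued 1 (of_real \<sigma>) = of_real (Gamma \<sigma> * Gamma (2 - \<sigma>) * (\<Sum>n. l n powr (- \<sigma>)))"
proof -
  define h where "h = (\<lambda>x. indicator {0<..} x * (x powr (1 - \<sigma>) * neg_log_deriv2 x))"
  define b where "b = complex_of_real (1/2 - \<sigma>)"
  let ?w = "1 - complex_of_real \<sigma>"
  have b: "Re b < -1" using \<sigma> by (simp add: b_def)
  let ?I = "\<integral>x. complex_of_real (asymp_coeff 1) * (indicator {1..} x *\<^sub>R exp (b * of_real (ln x))) \<partial>lborel"
  let ?t = "\<lambda>x n. indicator {0<..} x * (x powr (1 - \<sigma>) * (1 / (x + l n)\<^sup>2))"
  have h_nonneg: "h x \<ge> 0" for x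
    using neg_log_deriv2_nonneg[of x] by (auto simp: h_def indicator_def)
  have h_eq: "complex_of_real (h x) = exp (?w * of_real (ln x)) * of_real (head_integrand x) +
      exp (?w * of_real (ln x)) * of_real (tail_integrand 1 x) + of_real (asymp_coeff 1) * (indicator {1..} x *\<^sub>R exp (b * of_real (ln x)))" for x
  proof -
    have pw: "exp (?w * of_real (ln x)) = of_real (x powr (1 - \<sigma>))" "exp (b * of_real (ln x)) = of_real (x powr (1/2 - \<sigma>))" if "x > 0"
      using that by (simp_all add: powr_def b_def exp_of_real[symmetric])
    have pa: "x powr (1/2 - \<sigma>) = x powr (1 - \<sigma>) * x powr (- (1/2))"
      by (simp add: powr_add[symmetric])
    consider "x \<le> 0" | "0 < x" "x < 1" | "1 \<le> x" by linarith
    then show ?thesis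
    proof cases
      case 3
      have "x powr (1 - \<sigma>) * neg_log_deriv2 x = x powr (1 - \<sigma>) * Ai_remainder 1 x + asymp_coeff 1 * x powr (1/2 - \<sigma>)"
        unfolding pa by (simp add: Ai_remainder_def asymp_coeff_0 algebra_simps)
      then show ?thesis using 3 pw
        by (simp add: h_def head_integrand_def tail_integrand_def flip: of_real_mult of_real_add)
    qed (use pw in \<open>auto simp: h_def head_integrand_def tail_integrand_def\<close>)
  qed
  have int1: "integrable lborel (\<lambda>x. exp (?w * of_real (ln x)) * of_real (head_integrand x))"
    using \<sigma> by (intro Mellin_head_integrable) auto
  have int2: "integrable lborel (\<lambda>x. exp (?w * of_real (ln x)) * of_real (tail_integrand 1 x))"
    using \<sigma> by (intro Mellin_tail_integrable) auto
  have int3: "integrable lborel (\<lambda>x. complex_of_real (asymp_coeff 1) * (indicator {1..} x *\<^sub>R exp (b * of_real (ln x))))"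
    using powr_integral_at_top(1)[OF b] unfolding set_integrable_def by (intro integrable_mult_right)
  have intc: "integrable lborel (\<lambda>x. complex_of_real (h x))"
    unfolding h_eq by (intro Bochner_Integration.integrable_add int1 int2 int3)
  have "integrable lborel h" using integrable_Re[OF intc] by simp
  have "of_real (integral\<^sup>L lborel h) = (\<integral>x. complex_of_real (h x) \<partial>lborel)"
    by (rule integral_of_real[symmetric]) fact
  also have "\<dots> = Mellin_head ?w + Mellin_tail 1 ?w + ?I"
    unfolding h_eq Mellin_head_def Mellin_tail_def
    by (subst Bochner_Integration.integral_add[OF Bochner_Integration.integrable_add[OF int1 int2] int3],
        subst Bochner_Integration.integral_add[OF int1 int2]) simp
  also have "?I = of_real (asymp_coeff 1) * (- 1 / (b + 1))"
    using powr_integral_at_top(2)[OF b] by (simp only: integral_mult_right_zero set_lebesgue_integral_def)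
  also have "of_real (asymp_coeff 1) * (- 1 / (b + 1)) = Mellin_poles 1 (of_real \<sigma>)"
  proof -
    have "complex_of_real \<sigma> - of_real (3 - 3/2 * real 1) = - (b + 1)" by (simp add: b_def)
    then show ?thesis unfolding Mellin_poles_def by (simp add: asymp_coeff_0 del: of_real_diff) (simp add: divide_minus_right[symmetric] del: divide_minus_right)
  qed
  finally have M: "Mellin_continued 1 (of_real \<sigma>) = of_real (integral\<^sup>L lborel h)" by (simp add: Mellin_continued_def)
  define q where "q = (\<lambda>n. Gamma \<sigma> * Gamma (2 - \<sigma>) * l n powr (- \<sigma>))"
  have Gpos: "Gamma \<sigma> * Gamma (2 - \<sigma>) > 0" using \<sigma> by simp
  have q0: "q n \<ge> 0" for n using Gpos by (simp add: q_def)
  have "ennreal (integral\<^sup>L lborel h) = (\<integral>\<^sup>+x. ennreal (h x) \<partial>lborel)"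
    by (rule nn_integral_eq_integral[symmetric]) (use \<open>integrable lborel h\<close> h_nonneg in auto)
  also have "\<dots> = (\<integral>\<^sup>+x. (\<Sum>n. ennreal (?t x n)) \<partial>lborel)"
  proof (rule nn_integral_cong)
    fix x :: real
    show "ennreal (h x) = (\<Sum>n. ennreal (?t x n))"
    proof (cases "x > 0")
      case True
      have s: "(\<lambda>n. x powr (1 - \<sigma>) * (1 / (x + l n)\<^sup>2)) sums (x powr (1 - \<sigma>) * neg_log_deriv2 x)"
        using neg_log_deriv2_sums[of x] True by (intro sums_mult) simp
      have "(\<Sum>n. ennreal (x powr (1 - \<sigma>) * (1 / (x + l n)\<^sup>2))) = ennreal (\<Sum>n. x powr (1 - \<sigma>) * (1 / (x + l n)\<^sup>2))"
        by (rule suminf_ennreal2) (use s in \<open>auto simp: sums_iff\<close>)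
      then show ?thesis using True sums_unique[OF s] by (simp add: h_def)
    qed (simp add: h_def)
  qed
  also have "\<dots> = (\<Sum>n. \<integral>\<^sup>+x. ennreal (?t x n) \<partial>lborel)"
    by (rule nn_integral_suminf) measurable
  also have "\<dots> = (\<Sum>n. ennreal (q n))"
    unfolding q_def using \<sigma> l_pos by (subst nn_integral_Beta_scaled) auto
  finally have eq: "(\<Sum>n. ennreal (q n)) = ennreal (integral\<^sup>L lborel h)" ..
  have sq: "summable q"
    by (rule summable_suminf_not_top[OF q0]) (simp add: eq)
  then show sl: "summable (\<lambda>n. l n powr (- \<sigma>))"
    using Gpos unfolding q_def by (subst (asm) summable_cmult_iff) auto
  have "ennreal (suminf q) = ennreal (integral\<^sup>L lborel h)"
    using suminf_ennreal2[OF q0 sq] eq by simp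
  then have "suminf q = integral\<^sup>L lborel h"
    using suminf_nonneg[OF sq q0] h_nonneg by (subst (asm) ennreal_inj) auto
  moreover have "suminf q = Gamma \<sigma> * Gamma (2 - \<sigma>) * (\<Sum>n. l n powr (- \<sigma>))"
    unfolding q_def by (rule suminf_mult[OF sl])
  ultimately show "Mellin_continued 1 (of_real \<sigma>) = of_real (Gamma \<sigma> * Gamma (2 - \<sigma>) * (\<Sum>n. l n powr (- \<sigma>)))"
    using M by simp
qed

lemma summable_l_powr:
  assumes "\<sigma> > 3/2"
  shows "summable (\<lambda>n. l n powr (- \<sigma>))"
proof (cases "\<sigma> < 2")
  case True
  then show ?thesis using assms by (intro Mellin_transform_zeta(1))
next
  case False
  have s: "summable (\<lambda>n. l n powr (- 7/4))" using Mellin_transform_zeta(1)[of "7/4"] by simp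
  have "\<forall>\<^sub>F n in sequentially. l n powr (- 7/4) < 1"
    by (rule order_tendstoD(2)[OF summable_LIMSEQ_zero[OF s]]) simp
  then have "\<forall>\<^sub>F n in sequentially. norm (l n powr (- \<sigma>)) \<le> l n powr (- 7/4)"
  proof eventually_elim
    case (elim n)
    \<comment> \<open>Eventually the term for \<open>7/4\<close> is below 1, so its \<open>p\<close>-th power with \<open>p \<ge> 1\<close> is smaller still.\<close>
    define p where "p = \<sigma> * 4 / 7"
    have "l n powr (- \<sigma>) = (l n powr (- 7/4)) powr p" by (simp add: powr_powr p_def)
    also have "\<dots> \<le> (l n powr (- 7/4)) powr 1"
      using elim l_pos[of n] False by (intro powr_mono') (auto simp: p_def)
    finally show ?case using l_pos[of n] by simp
  qed
  then show ?thesis by (rule summable_comparison_test_ev[OF _ s])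
qed

definition zeta_zeros :: "complex \<Rightarrow> complex" where
  "zeta_zeros s = (\<Sum>n. exp (- s * of_real (ln (l n))))"

lemma norm_zeta_term: "norm (exp (- s * of_real (ln (l n)))) = l n powr (- Re s)"
  using l_pos[of n] by (simp add: powr_def)

lemma zeta_zeros_summable:
  assumes "Re s > 3/2"
  shows "summable (\<lambda>n. norm (exp (- s * of_real (ln (l n)))))"
  unfolding norm_zeta_term using assms by (rule summable_l_powr)

lemma zeta_zeros_holomorphic: "zeta_zeros holomorphic_on {s. Re s > 3/2}"
proof -
  have int: "integrable (count_space UNIV) (\<lambda>n. exp (w * of_real (ln (l n))) * 1)" if "Re w < - 3/2" for w
    using zeta_zeros_summable[of "- w"] that by (simp add: integrable_count_space_nat_iff)
  have "(\<lambda>w. integral\<^sup>L (count_space UNIV) (\<lambda>n. exp (w * of_real (ln (l n))) * 1)) holomorphic_on {w. Re w < - 3/2}"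
    by (intro holomorphic_on_exp_integral open_halfspace_Re_lt int) auto
  then have "((\<lambda>w. integral\<^sup>L (count_space UNIV) (\<lambda>n. exp (w * of_real (ln (l n))) * 1)) \<circ> uminus) holomorphic_on {s. Re s > 3/2}"
    by (intro holomorphic_on_compose_gen[where t = "{w. Re w < - 3/2}"] holomorphic_intros) auto
  also have "?this \<longleftrightarrow> zeta_zeros holomorphic_on {s. Re s > 3/2}"
  proof (rule holomorphic_cong)
    fix s assume "s \<in> {s. Re s > 3/2}"
    then have "integrable (count_space UNIV) (\<lambda>n. exp (- s * of_real (ln (l n))) * 1)" by (intro int) auto
    from integral_count_space_nat[OF this]
    show "((\<lambda>w. integral\<^sup>L (count_space UNIV) (\<lambda>n. exp (w * of_real (ln (l n))) * 1)) \<circ> uminus) s = zeta_zeros s"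
      by (simp add: zeta_zeros_def)
  qed simp
  finally show ?thesis .
qed

definition Mellin_regular :: "nat \<Rightarrow> complex \<Rightarrow> complex" where
  "Mellin_regular N s = Mellin_head (1 - s) + Mellin_tail N (1 - s)"

lemma Mellin_regular_holomorphic: "Mellin_regular N holomorphic_on {s. 2 - 3/2 * real N < Re s \<and> Re s < 2}"
  unfolding Mellin_regular_def[abs_def]
  by (intro holomorphic_on_add holomorphic_on_subset[OF Mellin_head_holomorphic] holomorphic_on_subset[OF Mellin_tail_holomorphic]) auto

lemma Mellin_poles_holomorphic:
  assumes "\<And>k. k \<le> N \<Longrightarrow> of_real (3 - 3/2 * real k) \<notin> S"
  shows "Mellin_poles N holomorphic_on S"
proof -
  have "s - of_real (3 - 3/2 * real k) \<noteq> 0" if "k < Suc N" "s \<in> S" for k s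
    using assms[of k] that by auto
  then show ?thesis unfolding Mellin_poles_def[abs_def] by (intro holomorphic_intros) auto
qed

lemma strip_open: "open {s. a < Re s \<and> Re s < b}"
  by (simp add: open_Collect_conj open_halfspace_Re_gt open_halfspace_Re_lt)

text \<open>
  Both sides are holomorphic on the strip, and they agree on its real points.
\<close>

lemma zeta_zeros_eq_Mellin:
  assumes s: "3/2 < Re s" "Re s < 2"
  shows "zeta_zeros s = rGamma s * rGamma (2 - s) * Mellin_continued 1 s"
proof -
  define S where "S = {s. 3/2 < Re s \<and> Re s < 2}"
  define f where "f = (\<lambda>s. zeta_zeros s - rGamma s * rGamma (2 - s) * Mellin_continued 1 s)"
  have holM: "Mellin_continued 1 holomorphic_on S"
  proof -
    have "(\<lambda>s. Mellin_regular 1 s + Mellin_poles 1 s) holomorphic_on S"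
    proof (intro holomorphic_on_add)
      show "Mellin_regular 1 holomorphic_on S"
        by (rule holomorphic_on_subset[OF Mellin_regular_holomorphic]) (auto simp: S_def)
      show "Mellin_poles 1 holomorphic_on S"
      proof (rule Mellin_poles_holomorphic)
        fix k :: nat assume "k \<le> 1"
        then have "k = 0 \<or> k = 1" by auto
        then show "of_real (3 - 3/2 * real k) \<notin> S" by (auto simp: S_def)
      qed
    qed
    then show ?thesis by (simp add: Mellin_continued_def[abs_def] Mellin_regular_def)
  qed
  have holf: "f holomorphic_on S"
    unfolding f_def
    by (intro holomorphic_intros holM holomorphic_on_subset[OF zeta_zeros_holomorphic]) (auto simp: S_def)
  have conn: "connected S"
  proof -
    have "S = {s. Re s > 3/2} \<inter> {s. Re s < 2}" by (auto simp: S_def)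
    then show ?thesis by (simp only: convex_connected convex_Int convex_halfspace_Re_gt convex_halfspace_Re_lt)
  qed
  define U where "U = complex_of_real ` {3/2<..<2}"
  have lp: "(7/4 :: complex) islimpt U"
  proof -
    have "complex_of_real (7/4) islimpt U"
      unfolding U_def
    proof (rule islimpt_isCont_image)
      show "(7/4 :: real) islimpt {3/2<..<2}" by (intro interior_limit_point) simp
      show "\<forall>\<^sub>F y in at (7/4 :: real). complex_of_real y \<noteq> complex_of_real (7/4)"
        unfolding of_real_eq_iff by (auto simp: eventually_at intro: exI[of _ 1])
    qed auto
    then show ?thesis by simp
  qed
  have "f s = 0"
  proof (rule analytic_continuation[OF holf _ conn _ _ lp])
    show "open S" unfolding S_def by (rule strip_open)
    show "U \<subseteq> S" "(7/4) \<in> S" "s \<in> S" using s by (auto simp: U_def S_def)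
    fix z assume "z \<in> U"
    then obtain \<sigma> where z: "z = of_real \<sigma>" and \<sigma>: "3/2 < \<sigma>" "\<sigma> < 2" by (auto simp: U_def)
    have "zeta_zeros z = (\<Sum>n. complex_of_real (l n powr (- \<sigma>)))"
      unfolding zeta_zeros_def z using l_pos by (simp add: powr_def exp_of_real[symmetric] less_imp_neq[symmetric])
    also have "\<dots> = of_real (\<Sum>n. l n powr (- \<sigma>))"
      by (rule suminf_of_real[symmetric]) (rule Mellin_transform_zeta(1)[OF \<sigma>])
    finally have "zeta_zeros z = of_real (\<Sum>n. l n powr (- \<sigma>))" .
    moreover have "rGamma z * rGamma (2 - z) * Mellin_continued 1 z = of_real (\<Sum>n. l n powr (- \<sigma>))"
    proof -
      have G: "Gamma z = of_real (Gamma \<sigma>)" "Gamma (2 - z) = of_real (Gamma (2 - \<sigma>))"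
        unfolding z by (simp_all flip: Gamma_complex_of_real)
      have "Gamma \<sigma> > 0" "Gamma (2 - \<sigma>) > 0" using \<sigma> by auto
      then show ?thesis unfolding rGamma_inverse_Gamma G unfolding z Mellin_transform_zeta(2)[OF \<sigma>]
        by (simp add: field_simps)
    qed
    ultimately show "f z = 0" by (simp add: f_def)
  qed
  then show ?thesis by (simp add: f_def)
qed

text \<open>
  The two formulas agree for \<open>3/2 < Re s < 2\<close>; the change at \<open>7/4\<close> is an arbitrary point of this
  overlap. The number of subtracted terms grows with the distance to the left.
\<close>

definition zeta_continued :: "complex \<Rightarrow> complex" where
  "zeta_continued s = (if Re s > 7/4 then zeta_zeros s
     else rGamma s * rGamma (2 - s) * Mellin_continued (nat \<lceil>2 - Re s\<rceil> + 1) s)"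

lemma zeta_continued_eq:
  assumes N: "2 - 3/2 * real N < Re s" "N \<ge> 1" and s: "Re s < 2"
  shows "zeta_continued s = rGamma s * rGamma (2 - s) * Mellin_continued N s"
proof (cases "Re s > 7/4")
  case True
  have "Mellin_continued 1 s = Mellin_continued N s" using N True by (intro Mellin_continued_eq) auto
  then show ?thesis using zeta_zeros_eq_Mellin[of s] True s by (simp add: zeta_continued_def)
next
  case False
  define N' where "N' = nat \<lceil>2 - Re s\<rceil> + 1"
  have "real N' \<ge> 2 - Re s" unfolding N'_def by linarith
  moreover have "real N' \<ge> 1" by (simp add: N'_def)
  ultimately have N': "2 - 3/2 * real N' < Re s" by linarith
  have "Mellin_continued N' s = Mellin_continued N s"
  proof (cases "N \<le> N'")
    case True
    then show ?thesis by (rule Mellin_continued_eq[OF _ N(1), symmetric])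
  next
    case False
    then have "N' \<le> N" by simp
    then show ?thesis by (rule Mellin_continued_eq[OF _ N'])
  qed
  then show ?thesis using False by (simp add: zeta_continued_def N'_def)
qed

lemma zeta_continued_eq_zeta:
  assumes "Re s > 3/2"
  shows "zeta_continued s = zeta_zeros s"
proof (cases "Re s > 7/4")
  case False
  have "zeta_continued s = rGamma s * rGamma (2 - s) * Mellin_continued 1 s"
    by (rule zeta_continued_eq) (use assms False in auto)
  also have "\<dots> = zeta_zeros s" by (rule zeta_zeros_eq_Mellin[symmetric]) (use assms False in auto)
  finally show ?thesis .
qed (simp add: zeta_continued_def)

lemma zeta_continued_analytic_right: "Re s > 3/2 \<Longrightarrow> zeta_continued analytic_on {s}"
proof -
  assume s: "Re s > 3/2"
  have "zeta_continued holomorphic_on {s. Re s > 3/2}"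
    using zeta_zeros_holomorphic by (rule holomorphic_transform) (simp add: zeta_continued_eq_zeta)
  then show ?thesis using s by (auto simp: analytic_at intro!: exI[of _ "{s. Re s > 3/2}"] open_halfspace_Re_gt)
qed

lemma zeta_continued_near:
  assumes N: "2 - 3/2 * real N < Re s" "N \<ge> 1" and s: "Re s < 2"
  shows "\<forall>\<^sub>F z in nhds s. zeta_continued z = rGamma z * rGamma (2 - z) * (Mellin_regular N z + Mellin_poles N z)"
proof -
  have "\<forall>\<^sub>F z in nhds s. z \<in> {z. 2 - 3/2 * real N < Re z \<and> Re z < 2}"
    using N s by (intro eventually_nhds_in_open strip_open) auto
  then show ?thesis
  proof eventually_elim
    case (elim z)
    then show ?case using zeta_continued_eq[of N z] N(2) by (simp add: Mellin_continued_def Mellin_regular_def)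
  qed
qed

lemma Mellin_regular_analytic:
  assumes N: "2 - 3/2 * real N < Re s" and s: "Re s < 2"
  shows "Mellin_regular N analytic_on {s}"
  unfolding analytic_at
  by (rule exI[of _ "{s. 2 - 3/2 * real N < Re s \<and> Re s < 2}"])
     (use N s Mellin_regular_holomorphic strip_open in auto)

lemma zeta_continued_meromorphic: "zeta_continued meromorphic_on UNIV"
proof (subst meromorphic_on_meromorphic_at, intro ballI)
  fix s :: complex
  show "zeta_continued meromorphic_on {s}"
  proof (cases "Re s > 3/2")
    case True
    then show ?thesis by (intro analytic_on_imp_meromorphic_on zeta_continued_analytic_right)
  next
    case False
    obtain N :: nat where "real N > max 1 (2 - Re s)" using reals_Archimedean2 by blast
    then have N: "2 - 3/2 * real N < Re s" "N \<ge> 1" by auto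
    have "(\<lambda>z. rGamma z * rGamma (2 - z) * (Mellin_regular N z + Mellin_poles N z)) meromorphic_on {s}"
      unfolding Mellin_poles_def
      by (intro meromorphic_intros analytic_on_imp_meromorphic_on[OF Mellin_regular_analytic] N analytic_on_imp_meromorphic_on analytic_intros)
         (use False in auto)
    moreover have "\<forall>\<^sub>F z in at s. zeta_continued z = rGamma z * rGamma (2 - z) * (Mellin_regular N z + Mellin_poles N z)"
      using zeta_continued_near[OF N] False by (auto simp: eventually_nhds_conv_at)
    ultimately show ?thesis by (subst meromorphic_on_cong[where g = "\<lambda>z. rGamma z * rGamma (2 - z) * (Mellin_regular N z + Mellin_poles N z)"]) auto
  qed
qed

section \<open>Special values\<close>

lemma zeta_continued_limit:
  assumes N: "2 - 3/2 * real N < Re s" "N \<ge> 1" and s: "Re s < 2"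
      and lim: "((\<lambda>z. rGamma z * rGamma (2 - z) * (Mellin_regular N z + Mellin_poles N z)) \<longlongrightarrow> c) (at s)"
  shows "(zeta_continued \<longlongrightarrow> c) (at s)"
  using lim
proof (rule Lim_transform_eventually)
  show "\<forall>\<^sub>F z in at s. rGamma z * rGamma (2 - z) * (Mellin_regular N z + Mellin_poles N z) = zeta_continued z"
    using zeta_continued_near[OF N s] unfolding eventually_nhds_conv_at by (auto elim: eventually_mono)
qed

lemma Mellin_regular_isCont:
  assumes "2 - 3/2 * real N < Re s" "Re s < 2"
  shows "isCont (Mellin_regular N) s"
  using Mellin_regular_analytic[OF assms] by (rule analytic_at_imp_isCont)

lemma partial_fractions_isCont:
  assumes "\<And>k. k \<in> K \<Longrightarrow> s \<noteq> of_real (3 - 3/2 * real k)"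
  shows "isCont (\<lambda>z. \<Sum>k\<in>K. complex_of_real (asymp_coeff k) / (z - of_real (3 - 3/2 * real k))) s"
  using assms by (intro continuous_intros) (auto simp: right_minus_eq)

text \<open>
  A pole \<open>3 - 3k/2\<close> is equal to \<open>- n\<close> only if \<open>3 k = 2 n + 6\<close>, i.e. only if 3 divides \<open>n\<close>.
\<close>

lemma zeta_continued_tendsto_regular:
  assumes n: "\<not> 3 dvd n"
  shows "(zeta_continued \<longlongrightarrow> 0) (at (- of_nat n))"
\<comment> \<open>Any \<open>N\<close> with \<open>2 - 3N/2 < - n\<close> would do.\<close>
proof (rule zeta_continued_limit[where N = "2 * n + 6"])
  let ?N = "2 * n + 6"
  have "isCont (Mellin_poles ?N) (- of_nat n)"
    unfolding Mellin_poles_def[abs_def]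
  proof (rule partial_fractions_isCont)
    fix k
    show "- complex_of_nat n \<noteq> of_real (3 - 3/2 * real k)"
    proof
      assume "- complex_of_nat n = of_real (3 - 3/2 * real k)"
      then have "Re (- complex_of_nat n) = Re (of_real (3 - 3/2 * real k))" by (rule arg_cong)
      then have "real (3 * k) = real (2 * n + 6)" by simp
      then have "3 * k = 2 * n + 6" unfolding of_nat_eq_iff .
      then have "3 dvd n" by presburger
      then show False using n by contradiction
    qed
  qed
  then have "isCont (\<lambda>z. rGamma z * rGamma (2 - z) * (Mellin_regular ?N z + Mellin_poles ?N z)) (- of_nat n)"
    by (intro continuous_intros Mellin_regular_isCont) (auto simp: field_simps)
  then show "((\<lambda>z. rGamma z * rGamma (2 - z) * (Mellin_regular ?N z + Mellin_poles ?N z)) \<longlongrightarrow> 0) (at (- of_nat n))"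
    by (simp add: isCont_def rGamma_nonpos_Int)
qed (auto simp: field_simps)

text \<open>
  The pole at \<open>- 3j\<close> belongs to \<open>k = 2j + 2\<close>. It meets the simple zero of \<open>rGamma\<close> with derivative
  \<open>(-1)^n n!\<close> at \<open>- n\<close>, and \<open>rGamma (2 + n) = 1 / (n + 1)!\<close>; the product of the three is the limit.
\<close>

lemma zeta_continued_tendsto_multiple_of_3:
  "(zeta_continued \<longlongrightarrow> (- 1) ^ j * of_real (asymp_coeff (2 * j + 2)) / (3 * of_nat j + 1)) (at (- (3 * of_nat j)))"
proof -
  define n where "n = 3 * j"
  define k0 where "k0 = 2 * j + 2"
  define N where "N = 2 * n + 6"
  define g where "g = complex_of_real (asymp_coeff k0)"
  define s where "s = - complex_of_nat n"
  define T' where "T' = (\<lambda>z. \<Sum>k\<in>{..<Suc N} - {k0}. complex_of_real (asymp_coeff k) / (z - of_real (3 - 3/2 * real k)))"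
  have N: "2 - 3/2 * real N < Re s" "N \<ge> 1" "Re s < 2" by (auto simp: N_def s_def field_simps)
  have pole: "complex_of_real (3 - 3/2 * real k) = s \<longleftrightarrow> k = k0" for k
  proof -
    have "complex_of_real (3 - 3/2 * real k) = s \<longleftrightarrow> 3 - 3/2 * real k = - real n"
    proof -
      have "s = of_real (- real n)" by (simp add: s_def)
      then show ?thesis by (simp only: of_real_eq_iff)
    qed
    also have "\<dots> \<longleftrightarrow> k = k0"
    proof
      assume "3 - 3/2 * real k = - real n"
      then have "real k = real k0" by (simp add: n_def k0_def)
      then show "k = k0" unfolding of_nat_eq_iff .
    qed (simp add: n_def k0_def field_simps)
    finally show ?thesis .
  qed
  have T: "Mellin_poles N z = g / (z - s) + T' z" for z
  proof -
    have k0: "k0 \<in> {..<Suc N}" by (auto simp: k0_def N_def n_def)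
    show ?thesis
      unfolding Mellin_poles_def T'_def g_def sum.remove[OF finite_lessThan k0] using pole[of k0] by simp
  qed
  have "isCont T' s" unfolding T'_def using pole by (intro partial_fractions_isCont) auto
  then have c1: "isCont (\<lambda>z. rGamma z * rGamma (2 - z) * (Mellin_regular N z + T' z)) s"
    by (intro continuous_intros Mellin_regular_isCont N)
  have rG0: "rGamma s = 0" by (auto simp: s_def intro!: rGamma_nonpos_Int)
  have "((\<lambda>z. rGamma z * rGamma (2 - z) * (Mellin_regular N z + T' z)) \<longlongrightarrow> 0) (at s)"
    using c1 rG0 by (simp add: isCont_def)
  moreover have "((\<lambda>z. g * (rGamma z / (z - s)) * rGamma (2 - z)) \<longlongrightarrow> g * ((- 1) ^ n * fact n) * rGamma (2 - s)) (at s)"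
  proof (intro tendsto_mult tendsto_const)
    have "(rGamma has_field_derivative (- 1) ^ n * fact n) (at s)"
      unfolding s_def by (rule has_field_derivative_rGamma_nonpos_int)
    then show "((\<lambda>z. rGamma z / (z - s)) \<longlongrightarrow> (- 1) ^ n * fact n) (at s)"
      unfolding has_field_derivative_iff rG0 by (simp add: LIM_offset_zero_iff)
    have "isCont (\<lambda>z. rGamma (2 - z)) s" by (intro continuous_intros)
    then show "((\<lambda>z. rGamma (2 - z)) \<longlongrightarrow> rGamma (2 - s)) (at s)" by (simp add: isCont_def)
  qed
  ultimately have "((\<lambda>z. rGamma z * rGamma (2 - z) * (Mellin_regular N z + T' z) + g * (rGamma z / (z - s)) * rGamma (2 - z))
      \<longlongrightarrow> 0 + g * ((- 1) ^ n * fact n) * rGamma (2 - s)) (at s)"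
    by (rule tendsto_add)
  also have "(\<lambda>z. rGamma z * rGamma (2 - z) * (Mellin_regular N z + T' z) + g * (rGamma z / (z - s)) * rGamma (2 - z))
     = (\<lambda>z. rGamma z * rGamma (2 - z) * (Mellin_regular N z + Mellin_poles N z))"
    unfolding T by (intro ext) (simp add: algebra_simps)
  also have "0 + g * ((- 1) ^ n * fact n) * rGamma (2 - s) = (- 1) ^ j * g / (3 * of_nat j + 1)"
  proof -
    have arg: "2 - s = 1 + of_nat (Suc n)" by (simp add: s_def)
    have "rGamma (2 - s) = inverse (fact (Suc n))"
      unfolding rGamma_inverse_Gamma arg Gamma_fact ..
    moreover have "(- 1 :: complex) ^ n = (- 1) ^ j" by (simp add: n_def power_mult)
    moreover have "fact n * inverse (fact (Suc n)) = (1 / (3 * of_nat j + 1) :: complex)"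
    proof -
      have "(of_nat (Suc n) :: complex) = 3 * of_nat j + 1" by (simp add: n_def)
      then show ?thesis unfolding fact_Suc by (simp add: inverse_mult_distrib mult.left_commute divide_inverse del: of_nat_Suc)
    qed
    ultimately show ?thesis
      by (simp only: add_0 mult.assoc mult.left_commute[of "fact n"] divide_inverse mult_1_left)
         (simp only: mult_ac)
  qed
  finally have "(zeta_continued \<longlongrightarrow> (- 1) ^ j * g / (3 * of_nat j + 1)) (at s)"
    by (rule zeta_continued_limit[OF N])
  then show ?thesis by (simp add: s_def g_def k0_def n_def)
qed

lemma neg_log_deriv_minus_sqrt_tendsto_0: "((\<lambda>x. neg_log_deriv x - x powr (1/2)) \<longlongrightarrow> 0) at_top"
proof (rule Lim_null_comparison)
  have "((\<lambda>x. neg_log_deriv2 0 * x powr (-1/2)) \<longlongrightarrow> neg_log_deriv2 0 * 0) at_top"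
    by (intro tendsto_mult tendsto_const tendsto_neg_powr filterlim_ident) auto
  then show "((\<lambda>x. neg_log_deriv2 0 * x powr (-1/2)) \<longlongrightarrow> 0) at_top" by simp
  show "\<forall>\<^sub>F x in at_top. norm (neg_log_deriv x - x powr (1/2)) \<le> neg_log_deriv2 0 * x powr (-1/2)"
    using eventually_gt_at_top[of 0]
  proof eventually_elim
    case (elim x)
    define r where "r = x powr (1/2)"
    have r: "r > 0" "r\<^sup>2 = x" using elim by (auto simp: r_def powr_power)
    have u: "neg_log_deriv x > 0" using elim by (intro neg_log_deriv_pos) simp
    have eq: "(neg_log_deriv x - r) * (neg_log_deriv x + r) = neg_log_deriv2 x"
      using r by (simp add: neg_log_deriv2_def power2_eq_square algebra_simps)
    have "neg_log_deriv x - r = neg_log_deriv2 x / (neg_log_deriv x + r)" using eq u r by (simp add: field_simps)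
    moreover have "neg_log_deriv2 x / (neg_log_deriv x + r) \<ge> 0" using neg_log_deriv2_nonneg[of x] elim u r by simp
    moreover have "neg_log_deriv2 x / (neg_log_deriv x + r) \<le> neg_log_deriv2 0 / r"
      using neg_log_deriv2_le[of x] neg_log_deriv2_nonneg[of x] elim u r by (intro frac_le) auto
    moreover have "neg_log_deriv2 0 / r = neg_log_deriv2 0 * x powr (-1/2)"
    proof -
      have "x powr (-1/2) = inverse r" unfolding r_def powr_minus[symmetric] by simp
      then show ?thesis by (simp only: divide_inverse)
    qed
    ultimately show ?case unfolding real_norm_def r_def[symmetric] by linarith
  qed
qed

text \<open>
  At \<open>s = 1\<close> the power drops out and both integrals are evaluated by the fundamental theorem of calculus:
  \<open>u(1) - u(0)\<close> from the head, \<open>1 - u(1)\<close> from the tail, and \<open>-1\<close> from the pole at \<open>3/2\<close>.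
\<close>

lemma Mellin_continued_1: "Mellin_continued 1 1 = - of_real (neg_log_deriv 0)"
proof -
  have "Mellin_head 0 = of_real (\<integral>x. head_integrand x \<partial>lborel)"
    unfolding Mellin_head_def by simp
  also have "(\<integral>x. head_integrand x \<partial>lborel) = neg_log_deriv 1 - neg_log_deriv 0"
  proof -
    have "integrable lborel head_integrand" using integrable_Re[OF Mellin_head_integrable[of 0]] by simp
    then have "set_integrable lborel {0<..<1} neg_log_deriv2"
      by (simp add: set_integrable_def head_integrand_def[abs_def])
    from set_borel_integral_eq_integral(2)[OF this]
    have "(\<integral>x. head_integrand x \<partial>lborel) = integral {0<..<1} neg_log_deriv2"
      by (simp add: set_lebesgue_integral_def head_integrand_def)
    also have "\<dots> = integral {0..1} neg_log_deriv2" using integral_open_interval_real[of 0 1 neg_log_deriv2] by simp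
    also have "\<dots> = neg_log_deriv 1 - neg_log_deriv 0"
      by (intro integral_unique fundamental_theorem_of_calculus)
         (auto intro!: has_field_derivative_at_within DERIV_neg_log_deriv_eq simp: has_real_derivative_iff_has_vector_derivative[symmetric])
    finally show ?thesis .
  qed
  finally have m0: "Mellin_head 0 = of_real (neg_log_deriv 1 - neg_log_deriv 0)" .
  have "Mellin_tail 1 0 = of_real (\<integral>x. tail_integrand 1 x \<partial>lborel)"
    unfolding Mellin_tail_def by simp
  also have "(\<integral>x. tail_integrand 1 x \<partial>lborel) = (LINT x:{1..}|lborel. Ai_remainder 1 x)"
    by (simp add: set_lebesgue_integral_def tail_integrand_def)
  also have "\<dots> = 0 - (neg_log_deriv 1 - 1 powr (1/2))"
  proof (rule set_integral_FTC_at_top[OF _ _ neg_log_deriv_minus_sqrt_tendsto_0])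
    have "integrable lborel (tail_integrand 1)" using integrable_Re[OF Mellin_tail_integrable[of 0 1]] by simp
    then show "set_integrable lborel {1..} (Ai_remainder 1)"
      by (simp add: set_integrable_def tail_integrand_def[abs_def])
    fix x :: real assume x: "x \<ge> 1"
    have "((\<lambda>x. neg_log_deriv x - x powr (1/2)) has_real_derivative neg_log_deriv2 x - 1/2 * x powr (1/2 - 1)) (at x)"
      using x by (intro DERIV_diff DERIV_neg_log_deriv_eq has_real_derivative_powr) auto
    also have "neg_log_deriv2 x - 1/2 * x powr (1/2 - 1) = Ai_remainder 1 x"
      using asymp_coeff_1 by (simp add: Ai_remainder_def asymp_coeff_0)
    finally show "((\<lambda>x. neg_log_deriv x - x powr (1/2)) has_vector_derivative Ai_remainder 1 x) (at x)"
      by (simp add: has_real_derivative_iff_has_vector_derivative)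
  qed
  finally have mJ: "Mellin_tail 1 0 = of_real (1 - neg_log_deriv 1)" by simp
  have "Mellin_poles 1 1 = - 1" by (simp add: Mellin_poles_def asymp_coeff_0 asymp_coeff_1[unfolded One_nat_def])
  then show ?thesis using m0 mJ by (simp add: Mellin_continued_def)
qed

lemma zeta_continued_tendsto_at_1: "(zeta_continued \<longlongrightarrow> - of_real (neg_log_deriv 0)) (at 1)"
proof (rule zeta_continued_limit[where N = 1])
  have "isCont (Mellin_poles 1) 1"
    unfolding Mellin_poles_def[abs_def]
  proof (rule partial_fractions_isCont)
    fix k :: nat assume "k \<in> {..<Suc 1}"
    then have "k = 0 \<or> k = 1" by auto
    then show "1 \<noteq> complex_of_real (3 - 3/2 * real k)" by (auto simp: complex_eq_iff)
  qed
  then have "isCont (\<lambda>z. rGamma z * rGamma (2 - z) * (Mellin_regular 1 z + Mellin_poles 1 z)) 1"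
    by (intro continuous_intros Mellin_regular_isCont) auto
  moreover have "Mellin_regular 1 1 + Mellin_poles 1 1 = - of_real (neg_log_deriv 0)"
    using Mellin_continued_1 by (simp add: Mellin_continued_def Mellin_regular_def)
  ultimately show "((\<lambda>z. rGamma z * rGamma (2 - z) * (Mellin_regular 1 z + Mellin_poles 1 z)) \<longlongrightarrow> - of_real (neg_log_deriv 0)) (at 1)"
    by (simp add: isCont_def)
qed auto

text \<open>
  All values are limits of the explicit formula; a finite limit at an isolated singularity also shows that
  the function is analytic there after removal of the singularity.
\<close>

lemma zeta_continuation:
  defines "Z \<equiv> remove_sings zeta_continued"
  shows "Z nicely_meromorphic_on UNIV"
    and "Re s > 3/2 \<Longrightarrow> Z s = zeta_zeros s"
    and "(n::int) \<le> 1 \<Longrightarrow> Z analytic_on {of_int n}"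
    and "Z 1 = - of_real (neg_log_deriv 0)"
    and "Z 0 = - 1/4"
    and "j \<ge> 1 \<Longrightarrow> Z (- (3 * of_nat j)) = - (3 * of_nat j) * Airy_p (2 * j)"
    and "\<not> 3 dvd m \<Longrightarrow> Z (- of_nat m) = 0"
proof -
  show "Z nicely_meromorphic_on UNIV"
    unfolding Z_def by (rule remove_sings_nicely_meromorphic[OF zeta_continued_meromorphic])
  show "Z s = zeta_zeros s" if "Re s > 3/2"
    using remove_sings_at_analytic[OF zeta_continued_analytic_right[OF that]] zeta_continued_eq_zeta[OF that]
    by (simp add: Z_def)
  have analytic: "Z analytic_on {s}" if "(zeta_continued \<longlongrightarrow> c) (at s)" for s c
  proof -
    have "isolated_singularity_at zeta_continued s"
      using zeta_continued_meromorphic by (simp add: meromorphic_on_altdef)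
    then show ?thesis unfolding Z_def using that by (rule remove_sings_analytic_at)
  qed
  show "Z analytic_on {of_int n}" if n: "n \<le> 1" for n :: int
  proof (cases "n = 1")
    case True
    then show ?thesis using analytic[OF zeta_continued_tendsto_at_1] by simp
  next
    case False
    define m where "m = nat (- n)"
    have nm: "of_int n = - complex_of_nat m" using False n by (simp add: m_def)
    show ?thesis
    proof (cases "3 dvd m")
      case True
      then obtain j where "m = 3 * j" by blast
      then show ?thesis using analytic[OF zeta_continued_tendsto_multiple_of_3[of j]] by (simp add: nm)
    next
      case False
      then show ?thesis using analytic[OF zeta_continued_tendsto_regular] by (simp add: nm)
    qed
  qed
  show "Z 1 = - of_real (neg_log_deriv 0)"
    unfolding Z_def by (rule remove_sings_eqI[OF zeta_continued_tendsto_at_1])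
  show "Z (- of_nat m) = 0" if "\<not> 3 dvd m" for m
    unfolding Z_def by (rule remove_sings_eqI[OF zeta_continued_tendsto_regular[OF that]])
  have Z3: "Z (- (3 * of_nat j)) = (- 1) ^ j * of_real (asymp_coeff (2 * j + 2)) / (3 * of_nat j + 1)" for j
    unfolding Z_def by (rule remove_sings_eqI[OF zeta_continued_tendsto_multiple_of_3])
  show "Z 0 = - 1/4" using Z3[of 0] asymp_coeff_2 by (simp add: numeral_2_eq_2)
  show "Z (- (3 * of_nat j)) = - (3 * of_nat j) * Airy_p (2 * j)" if j: "j \<ge> 1" for j
  proof -
    have nz: "3 * of_nat j + 1 \<noteq> (0::complex)"
      by (metis of_nat_numeral of_nat_mult of_nat_1 of_nat_add of_nat_eq_0_iff add_is_0 one_neq_zero)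
    have sgn: "(- 1 :: complex) ^ j * (- 1) ^ j = 1" by (simp flip: power_mult_distrib)
    have "(- 1) ^ j * complex_of_real (asymp_coeff (2 * j + 2)) =
        - (((- 1) ^ j * (- 1) ^ j) * ((3 * of_nat j + 1) * (3 * of_nat j) * Airy_p (2 * j)))"
      unfolding asymp_coeff_even[OF j] by (simp only: mult_minus_right mult_ac)
    also have "\<dots> = (3 * of_nat j + 1) * (- (3 * of_nat j) * Airy_p (2 * j))"
      unfolding sgn by (simp add: algebra_simps)
    finally show ?thesis unfolding Z3 using nz by simp
  qed
qed

end

theorem mainTheorem10:
  fixes i :: "nat \<Rightarrow> complex"
  assumes zeros: "bij_betw i {1..} {z. Airy_Ai z = 0}"
  shows "(\<forall>n\<ge>1. i n \<in> \<real> \<and> Re (i n) < 0) \<and>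
    (\<forall>s. Re s > 3/2 \<longrightarrow> summable (\<lambda>n. (- i (Suc n)) powr (- s))) \<and>
    (\<exists>Z. Z nicely_meromorphic_on UNIV \<and>
         (\<forall>s. Re s > 3/2 \<longrightarrow> Z s = Airy_zeta i s) \<and>
         (\<forall>n::int. n \<le> 1 \<longrightarrow> Z analytic_on {of_int n}) \<and>
         Z 1 = - of_real (3 powr (1/3) * (Gamma (2/3) / Gamma (1/3))) \<and>
         Z 0 = - 1/4 \<and>
         (\<forall>j\<ge>1. Z (- (3 * of_nat j)) = - (3 * of_nat j) * Airy_p (2 * j)) \<and>
         (\<forall>n\<ge>1. \<not> 3 dvd n \<longrightarrow> Z (- of_nat n) = 0))"
proof -
  define l where "l = (\<lambda>n. - Re (i (Suc n)))"
  have real_neg: "i n \<in> \<real> \<and> Re (i n) < 0" if "n \<ge> 1" for n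
  proof -
    have "Airy_Ai (i n) = 0" using zeros that by (auto simp: bij_betw_def)
    then obtain a where "i n = of_real a" "a < 0" by (rule Airy_Ai_zero_obtain)
    then show ?thesis by simp
  qed
  have i_eq: "i (Suc n) = - of_real (l n)" for n
    using real_neg[of "Suc n"] by (simp add: l_def)
  interpret Airy_zeros l
  proof
    have "bij_betw Suc UNIV {1..}"
      by (rule bij_betwI[where g = "\<lambda>n. n - 1"]) auto
    from bij_betw_trans[OF this zeros]
    show "bij_betw (\<lambda>n. - complex_of_real (l n)) UNIV {z. Airy_Ai z = 0}"
      by (simp add: o_def i_eq)
  qed
  have term_eq: "(- i (Suc n)) powr (- s) = exp (- s * of_real (ln (l n)))" for n s
    using l_pos[of n] by (simp add: i_eq powr_def Ln_of_real)
  have summ: "summable (\<lambda>n. (- i (Suc n)) powr (- s))" if "Re s > 3/2" for s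
    unfolding term_eq by (rule summable_norm_cancel[OF zeta_zeros_summable[OF that]])
  have zeta: "Airy_zeta i s = zeta_zeros s" for s
    unfolding Airy_zeta_def zeta_zeros_def term_eq ..
  show ?thesis
    using real_neg summ
    by (intro conjI exI[of _ "remove_sings zeta_continued"] allI impI)
       (simp_all only: zeta zeta_continuation simp_thms flip: neg_log_deriv_0)
qed

end
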